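(* Let $\Delta$ be a complete rational fan in $N_{\mathbb{R}}$, where $N\cong\mathbb{Z}^n$, and let $c_1\in A^{k_1}(X(\Delta))$ and $c_2\in A^{k_2}(X(\Delta))$ be Minkowski weights. Then the Allermann-Rau intersection product equals the cup product of Minkowski weights: $$c_1\bullet c_2=c_1\cup c_2 .$$
   Context: Notation. $N$ is a lattice of rank $n$, $M=N^\vee$, $N_{\mathbb{R}}=N\otimes\mathbb{R}$. For a cone $\tau$, $N_\tau$ is the set of lattice points in the linear span of $\tau$. $\Delta^{(k)}$ is the set of codimension $k$ cones of the fan $\Delta$. If $\tau\in\Delta^{(k+1)}$ is contained in $\sigma\in\Delta^{(k)}$, then $v_{\sigma/\tau}\in N/N_\tau$ is the primitive generator of the ray $(\sigma+N_\tau)/N_\tau$. A fan is unimodular if each cone is generated by a subset of a lattice basis. Minkowski weights. A codimension $k$ Minkowski weight on $\Delta$ is a function $c:\Delta^{(k)}\to\mathbb{Z}$ with $\sum_{\sigma\supset\tau}c(\sigma)v_{\sigma/\tau}=0$ in $N/N_\tau$ for every $\tau\in\Delta^{(k+1)}$. For $\Delta$ complete, the Chow cohomology group $A^k(X(\Delta))$ is identified with the group of codimension $k$ Minkowski weights (Fulton-Sturmfels). If $\widetilde\Delta$ refines $\Delta$, a weight $c$ on $\Delta$ is regarded as a weight on $\widetilde\Delta$ by giving a codimension $k$ cone of $\widetilde\Delta$ the value $c(\sigma)$ if it lies in some $\sigma\in\Delta^{(k)}$, and $0$ otherwise. The Cartesian product is $(c_1\times c_2)(\sigma_1\times\sigma_2)=c_1(\sigma_1)c_2(\sigma_2)$,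 a weight of codimension $k_1+k_2$ on $\Delta\times\Delta$. Cup product (fan displacement rule). For $v\in N$ generic (outside every proper subspace of the form $\mathrm{Span}(\sigma_1)+\mathrm{Span}(\sigma_2)$, $\sigma_i\in\Delta$) and $\gamma\in\Delta^{(k_1+k_2)}$, $$(c_1\cup c_2)(\gamma)=\sum_{(\sigma_1,\sigma_2)\in\Delta^{(k_1)}\times\Delta^{(k_2)}}m^{\gamma}_{\sigma_1,\sigma_2}c_1(\sigma_1)c_2(\sigma_2),$$ where $m^\gamma_{\sigma_1,\sigma_2}=[N:N_{\sigma_1}+N_{\sigma_2}]$ if $\gamma\subset\sigma_1$, $\gamma\subset\sigma_2$ and $\sigma_1\cap(\sigma_2+v)\neq\emptyset$, and $m^\gamma_{\sigma_1,\sigma_2}=0$ otherwise. The map $\kappa$. Let $\Delta$ be complete and unimodular. For a Minkowski weight $c$ of codimension $k$, $\mathrm{Supp}(c)$ is the union of the closed cones $\sigma$ with $c(\sigma)\ne0$. Let $f$ be a continuous function on $\mathrm{Supp}(c)$ that is integral linear on each cone $\sigma\subset\mathrm{Supp}(c)$ (an element of $M/\sigma^\perp$). Then $\kappa(c,f)\in A^{k+1}(X(\Delta))$ is the Minkowski weight $$\kappa(c,f)(\tau)=-\sum_{\sigma\in\Delta^{(k)},\,\sigma\supset\tau}f(v_{\sigma/\tau})\,c(\sigma),\qquad \tau\in\Delta^{(k+1)},$$ where $f(v_{\sigma/\tau})$ means: choose $m\in M$ agreeing with $f$ on $\tau$ (the same $m$ for all $\sigma\supset\tau$) and evaluate at $v_{\sigma/\tau}$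 the linear function induced by $f|_\sigma-m$ on the image of $\mathrm{Span}(\sigma)$ modulo $\mathrm{Span}(\tau)$ (by balancing the sum does not depend on $m$; terms with $c(\sigma)=0$ are $0$). Equivalently, $\kappa(c,f)=c\cup\eta^*\tilde f$ for any integral piecewise-linear extension $\tilde f$ of $f$ to $\Delta$, where $\eta^*\tilde f=\sum_{\rho}-\tilde f(v_\rho)[V(\rho)]$ (sum over rays $\rho$ of $\Delta$ with primitive generators $v_\rho$; $V(\rho)$ the corresponding torus-invariant divisor). Pushforward. Let $\pi:N\times N\to N$ be the projection onto the first factor, and let $\Delta'$ be a refinement of $\Delta\times\Delta$. For a $d$-dimensional weight $e$ on $\Delta'$ (a Minkowski weight on the $d$-dimensional cones), $\pi_*e$ is the $d$-dimensional weight on $\Delta$ whose value on a $d$-dimensional cone $\sigma'\in\Delta$ is, for a generic point $p$ of the relative interior of $\sigma'$, $\sum_\sigma[N_{\sigma'}:\pi(N_\sigma)]\,e(\sigma)$, the sum being over $d$-dimensional $\sigma\in\Delta'$ with $\dim\pi(\sigma)=d$, $\pi(\sigma)\subset\sigma'$ and $p\in\pi(\sigma)$. Allermann-Rau product. Let $x_i,y_i$ ($1\le i\le n$) be the coordinates on $N\times N$ obtained by applying a fixed basis of $M$ to the first and second factor respectively. Set $\chi_i=\min(0,y_i-x_i)$. Let $\Delta'$ be a unimodular fan refining $\Delta\times\Delta$ on which every $\chi_i$ is piecewise linear (linear on each cone). Then $$c_1\bullet c_2=\pi_*\bigl(\kappa(\cdots\kappa(\kappa(c_1\times c_2,\chi_1),\chi_2)\cdots,\chi_n)\bigr),$$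 a Minkowski weight of codimension $k_1+k_2$ on $\Delta$ (at each step $\chi_i$ is restricted to the support of the weight). *)

theory Defs
  imports "HOL-Analysis.Analysis" "HOL-Library.Set_Algebras"
begin

section \<open>Lattices\<close>

text \<open>The real vector space \<open>N\<^sub>\<real>\<close> is the Euclidean space \<open>'a\<close> itself, so that the rank
  of \<open>N\<close> is \<open>DIM('a)\<close>; no use is made of the inner product. \<open>N\<close> is a subset of \<open>'a\<close>.\<close>

definition lattice_basis :: "'a::euclidean_space set \<Rightarrow> 'a set \<Rightarrow> bool" where
  "lattice_basis N B \<longleftrightarrow> independent B \<and> span B = UNIV \<and>
     N = {(\<Sum>b\<in>B. real_of_int (a b) *\<^sub>R b) | a. True}"

definition full_lattice :: "'a::euclidean_space set \<Rightarrow> bool" where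
  "full_lattice N \<longleftrightarrow> (\<exists>B. lattice_basis N B)"

definition dual_lattice :: "'a::euclidean_space set \<Rightarrow> ('a \<Rightarrow> real) set" where
  "dual_lattice N = {m. linear m \<and> (\<forall>x\<in>N. m x \<in> \<int>)}"

text \<open>The family \<open>u 0, \<dots>, u (n - 1)\<close>, with \<open>n = DIM('a)\<close>, is a \<open>\<int>\<close>-basis of \<open>M\<close>.\<close>

definition dual_lattice_basis :: "'a::euclidean_space set \<Rightarrow> (nat \<Rightarrow> 'a \<Rightarrow> real) \<Rightarrow> bool" where
  "dual_lattice_basis N u \<longleftrightarrow>
     (\<forall>i<DIM('a). u i \<in> dual_lattice N) \<and>
     (\<forall>m\<in>dual_lattice N. \<exists>a::nat \<Rightarrow> int. \<forall>x. m x = (\<Sum>i<DIM('a). real_of_int (a i) * u i x)) \<and>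
     (\<forall>a::nat \<Rightarrow> int. (\<forall>x. (\<Sum>i<DIM('a). real_of_int (a i) * u i x) = 0)
        \<longrightarrow> (\<forall>i<DIM('a). a i = 0))"

text \<open>\<open>N\<^sub>\<tau>\<close>:\<close>

definition sublattice :: "'a::euclidean_space set \<Rightarrow> 'a set \<Rightarrow> 'a set" where
  "sublattice N \<tau> = N \<inter> span \<tau>"

text \<open>The index \<open>[A : B]\<close> of a subgroup, as the number of cosets. It is \<open>0\<close> if the index is
  infinite; where it is used below, the index is finite.\<close>

definition lattice_index :: "'a::euclidean_space set \<Rightarrow> 'a set \<Rightarrow> nat" where
  "lattice_index A B = card ((\<lambda>a. a +o B) ` A)"


section \<open>Fans\<close>

definition rational_cone :: "'a::euclidean_space set \<Rightarrow> 'a set \<Rightarrow> bool" where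
  "rational_cone N \<sigma> \<longleftrightarrow>
     (\<exists>S. finite S \<and> S \<subseteq> N \<and> \<sigma> = convex_cone hull S) \<and> \<sigma> \<inter> uminus ` \<sigma> = {0}"

text \<open>The library counts the empty set as a face of every convex set, hence the side condition.\<close>

definition fan :: "'a::euclidean_space set \<Rightarrow> 'a set set \<Rightarrow> bool" where
  "fan N \<Delta> \<longleftrightarrow> finite \<Delta> \<and> \<Delta> \<noteq> {} \<and>
     (\<forall>\<sigma>\<in>\<Delta>. rational_cone N \<sigma>) \<and>
     (\<forall>\<sigma>\<in>\<Delta>. \<forall>\<tau>. \<tau> face_of \<sigma> \<and> \<tau> \<noteq> {} \<longrightarrow> \<tau> \<in> \<Delta>) \<and>
     (\<forall>\<sigma>\<^sub>1\<in>\<Delta>. \<forall>\<sigma>\<^sub>2\<in>\<Delta>. \<sigma>\<^sub>1 \<inter> \<sigma>\<^sub>2 face_of \<sigma>\<^sub>1 \<and> \<sigma>\<^sub>1 \<inter> \<sigma>\<^sub>2 face_of \<sigma>\<^sub>2)"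

definition complete_fan :: "'a::euclidean_space set \<Rightarrow> 'a set set \<Rightarrow> bool" where
  "complete_fan N \<Delta> \<longleftrightarrow> fan N \<Delta> \<and> \<Union>\<Delta> = UNIV"

definition unimodular_fan :: "'a::euclidean_space set \<Rightarrow> 'a set set \<Rightarrow> bool" where
  "unimodular_fan N \<Delta> \<longleftrightarrow> fan N \<Delta> \<and>
     (\<forall>\<sigma>\<in>\<Delta>. \<exists>B S. lattice_basis N B \<and> S \<subseteq> B \<and> \<sigma> = convex_cone hull S)"

definition fan_refines :: "'a::euclidean_space set set \<Rightarrow> 'a set set \<Rightarrow> bool" where
  "fan_refines \<Delta>' \<Delta> \<longleftrightarrow> \<Union>\<Delta>' = \<Union>\<Delta> \<and> (\<forall>\<sigma>'\<in>\<Delta>'. \<exists>\<sigma>\<in>\<Delta>. \<sigma>' \<subseteq> \<sigma>)"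

definition product_fan ::
    "'a::euclidean_space set set \<Rightarrow> 'b::euclidean_space set set \<Rightarrow> ('a \<times> 'b) set set" where
  "product_fan \<Delta>\<^sub>1 \<Delta>\<^sub>2 = {\<sigma>\<^sub>1 \<times> \<sigma>\<^sub>2 | \<sigma>\<^sub>1 \<sigma>\<^sub>2. \<sigma>\<^sub>1 \<in> \<Delta>\<^sub>1 \<and> \<sigma>\<^sub>2 \<in> \<Delta>\<^sub>2}"

text \<open>\<open>\<Delta>\<^bsup>(k)\<^esup>\<close>, empty if \<open>k > DIM('a)\<close>:\<close>

definition codim_cones :: "'a::euclidean_space set set \<Rightarrow> nat \<Rightarrow> 'a set set" where
  "codim_cones \<Delta> k = {\<sigma>\<in>\<Delta>. dim \<sigma> + k = DIM('a)}"

definition linear_on_cones :: "'a::euclidean_space set set \<Rightarrow> ('a \<Rightarrow> real) \<Rightarrow> bool" where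
  "linear_on_cones \<Delta> f \<longleftrightarrow> (\<forall>\<sigma>\<in>\<Delta>. \<exists>l. linear l \<and> (\<forall>x\<in>\<sigma>. f x = l x))"


section \<open>Minkowski weights\<close>

text \<open>\<open>u\<close> represents the class \<open>v\<^bsub>\<sigma>/\<tau>\<^esub>\<close> in \<open>N / N\<^sub>\<tau>\<close>: its class lies on the ray
  \<open>(\<sigma> + span \<tau>) / span \<tau>\<close>, is nonzero, and is not a proper multiple of another class.\<close>

definition represents_normal ::
    "'a::euclidean_space set \<Rightarrow> 'a set \<Rightarrow> 'a set \<Rightarrow> 'a \<Rightarrow> bool" where
  "represents_normal N \<sigma> \<tau> u \<longleftrightarrow>
     u \<in> N \<and> u \<in> \<sigma> + span \<tau> \<and> u \<notin> span \<tau> \<and>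
     (\<forall>w\<in>N. \<forall>j::nat. u - real j *\<^sub>R w \<in> sublattice N \<tau> \<longrightarrow> j = 1)"

text \<open>A representative of \<open>v\<^bsub>\<sigma>/\<tau>\<^esub>\<close>; two of them differ by an element of \<open>N\<^sub>\<tau>\<close>.\<close>

definition normal_vector :: "'a::euclidean_space set \<Rightarrow> 'a set \<Rightarrow> 'a set \<Rightarrow> 'a" where
  "normal_vector N \<sigma> \<tau> = (SOME u. represents_normal N \<sigma> \<tau> u)"

text \<open>A codimension \<open>k\<close> weight on \<open>\<Delta>\<close> is given by a function on all subsets of \<open>'a\<close>, of which
  only the values on \<open>codim_cones \<Delta> k\<close> matter.\<close>

definition minkowski_weight ::
    "'a::euclidean_space set \<Rightarrow> 'a set set \<Rightarrow> nat \<Rightarrow> ('a set \<Rightarrow> int) \<Rightarrow> bool" where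
  "minkowski_weight N \<Delta> k c \<longleftrightarrow>
     (\<forall>\<tau>\<in>codim_cones \<Delta> (k + 1).
        (\<Sum>\<sigma> | \<sigma> \<in> codim_cones \<Delta> k \<and> \<tau> \<subseteq> \<sigma>. real_of_int (c \<sigma>) *\<^sub>R normal_vector N \<sigma> \<tau>)
          \<in> sublattice N \<tau>)"

text \<open>The codimension \<open>k\<close> weight \<open>c\<close> on \<open>\<Delta>\<close>, regarded as a weight on a refinement \<open>\<Delta>'\<close>. A
  codimension \<open>k\<close> cone of \<open>\<Delta>'\<close> lies in at most one codimension \<open>k\<close> cone of \<open>\<Delta>\<close>.\<close>

definition refine_weight ::
    "'a::euclidean_space set set \<Rightarrow> 'a set set \<Rightarrow> nat \<Rightarrow> ('a set \<Rightarrow> int) \<Rightarrow> 'a set \<Rightarrow> int" where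
  "refine_weight \<Delta>' \<Delta> k c \<sigma>' =
     (if \<sigma>' \<in> codim_cones \<Delta>' k \<and> (\<exists>\<sigma>\<in>codim_cones \<Delta> k. \<sigma>' \<subseteq> \<sigma>)
      then c (THE \<sigma>. \<sigma> \<in> codim_cones \<Delta> k \<and> \<sigma>' \<subseteq> \<sigma>) else 0)"

text \<open>A cone \<open>\<sigma>\<^sub>1 \<times> \<sigma>\<^sub>2\<close> of codimension \<open>k\<^sub>1 + k\<^sub>2\<close> may have factors of codimensions other than
  \<open>k\<^sub>1\<close> and \<open>k\<^sub>2\<close>; there the product weight is \<open>0\<close>.\<close>

definition product_weight ::
    "'a::euclidean_space set set \<Rightarrow> nat \<Rightarrow> ('a set \<Rightarrow> int) \<Rightarrow> nat \<Rightarrow> ('a set \<Rightarrow> int)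
       \<Rightarrow> ('a \<times> 'a) set \<Rightarrow> int" where
  "product_weight \<Delta> k\<^sub>1 c\<^sub>1 k\<^sub>2 c\<^sub>2 \<sigma> =
     (if \<sigma> \<in> product_fan (codim_cones \<Delta> k\<^sub>1) (codim_cones \<Delta> k\<^sub>2)
      then c\<^sub>1 (fst ` \<sigma>) * c\<^sub>2 (snd ` \<sigma>) else 0)"


section \<open>The cup product\<close>

definition generic_displacement :: "'a::euclidean_space set set \<Rightarrow> 'a \<Rightarrow> bool" where
  "generic_displacement \<Delta> v \<longleftrightarrow>
     (\<forall>\<sigma>\<^sub>1\<in>\<Delta>. \<forall>\<sigma>\<^sub>2\<in>\<Delta>. span \<sigma>\<^sub>1 + span \<sigma>\<^sub>2 \<noteq> UNIV \<longrightarrow> v \<notin> span \<sigma>\<^sub>1 + span \<sigma>\<^sub>2)"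

definition displacement_mult ::
    "'a::euclidean_space set \<Rightarrow> 'a \<Rightarrow> 'a set \<Rightarrow> 'a set \<Rightarrow> 'a set \<Rightarrow> nat" where
  "displacement_mult N v \<gamma> \<sigma>\<^sub>1 \<sigma>\<^sub>2 =
     (if \<gamma> \<subseteq> \<sigma>\<^sub>1 \<and> \<gamma> \<subseteq> \<sigma>\<^sub>2 \<and> \<sigma>\<^sub>1 \<inter> (v +o \<sigma>\<^sub>2) \<noteq> {}
      then lattice_index N (sublattice N \<sigma>\<^sub>1 + sublattice N \<sigma>\<^sub>2) else 0)"

definition cup_product ::
    "'a::euclidean_space set \<Rightarrow> 'a set set \<Rightarrow> 'a \<Rightarrow> nat \<Rightarrow> ('a set \<Rightarrow> int) \<Rightarrow> nat \<Rightarrow> ('a set \<Rightarrow> int)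
       \<Rightarrow> 'a set \<Rightarrow> int" where
  "cup_product N \<Delta> v k\<^sub>1 c\<^sub>1 k\<^sub>2 c\<^sub>2 \<gamma> =
     (if \<gamma> \<in> codim_cones \<Delta> (k\<^sub>1 + k\<^sub>2)
      then \<Sum>(\<sigma>\<^sub>1, \<sigma>\<^sub>2) \<in> codim_cones \<Delta> k\<^sub>1 \<times> codim_cones \<Delta> k\<^sub>2.
             int (displacement_mult N v \<gamma> \<sigma>\<^sub>1 \<sigma>\<^sub>2) * c\<^sub>1 \<sigma>\<^sub>1 * c\<^sub>2 \<sigma>\<^sub>2
      else 0)"


section \<open>The map kappa\<close>

text \<open>An element of \<open>M\<close> which agrees with \<open>f\<close> on \<open>\<sigma>\<close>, that is, a representative of \<open>f|\<sigma>\<close> in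
  \<open>M / \<sigma>\<^sup>\<bottom>\<close>.\<close>

definition integral_extension ::
    "'a::euclidean_space set \<Rightarrow> ('a \<Rightarrow> real) \<Rightarrow> 'a set \<Rightarrow> 'a \<Rightarrow> real" where
  "integral_extension N f \<sigma> = (SOME m. m \<in> dual_lattice N \<and> (\<forall>x\<in>\<sigma>. m x = f x))"

text \<open>The extension of \<open>f|\<tau>\<close> is the \<open>m\<close> of the definition of \<open>f(v\<^bsub>\<sigma>/\<tau>\<^esub>)\<close>, the same for all
  \<open>\<sigma>\<close> containing \<open>\<tau>\<close>. The difference of the two extensions vanishes on \<open>\<tau>\<close>, and its value at
  the representative of \<open>v\<^bsub>\<sigma>/\<tau>\<^esub>\<close> is an integer; the floor only converts it to type \<open>int\<close>. If \<open>f\<close>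
  is not linear on some \<open>\<sigma>\<close> outside the support of \<open>c\<close>, the corresponding term is \<open>0\<close> because of
  the factor \<open>c \<sigma>\<close>.\<close>

definition kappa ::
    "'a::euclidean_space set \<Rightarrow> 'a set set \<Rightarrow> nat \<Rightarrow> ('a set \<Rightarrow> int) \<Rightarrow> ('a \<Rightarrow> real)
       \<Rightarrow> 'a set \<Rightarrow> int" where
  "kappa N \<Delta> k c f \<tau> =
     (if \<tau> \<in> codim_cones \<Delta> (k + 1)
      then - (\<Sum>\<sigma> | \<sigma> \<in> codim_cones \<Delta> k \<and> \<tau> \<subseteq> \<sigma>.
                \<lfloor>integral_extension N f \<sigma> (normal_vector N \<sigma> \<tau>)
                   - integral_extension N f \<tau> (normal_vector N \<sigma> \<tau>)\<rfloor> * c \<sigma>)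
      else 0)"

primrec kappa_iter ::
    "'a::euclidean_space set \<Rightarrow> 'a set set \<Rightarrow> nat \<Rightarrow> ('a set \<Rightarrow> int) \<Rightarrow> (nat \<Rightarrow> 'a \<Rightarrow> real)
       \<Rightarrow> nat \<Rightarrow> 'a set \<Rightarrow> int" where
  "kappa_iter N \<Delta> k c f 0 = c"
| "kappa_iter N \<Delta> k c f (Suc i) = kappa N \<Delta> (k + i) (kappa_iter N \<Delta> k c f i) (f i)"


section \<open>The Allermann-Rau product\<close>

text \<open>A point of the relative interior of \<open>\<sigma>'\<close> off the lower-dimensional projected cones. If
  \<open>fst\<close> is injective on \<open>\<sigma> \<in> \<Delta>'\<close> with \<open>dim \<sigma> = dim \<sigma>'\<close>, this keeps \<open>p\<close> off the relative
  boundary of \<open>fst ` \<sigma>\<close>.\<close>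

definition generic_point ::
    "('a::euclidean_space \<times> 'a) set set \<Rightarrow> 'a set \<Rightarrow> 'a \<Rightarrow> bool" where
  "generic_point \<Delta>' \<sigma>' p \<longleftrightarrow>
     p \<in> rel_interior \<sigma>' \<and> (\<forall>\<tau>\<in>\<Delta>'. dim (fst ` \<tau>) < dim \<sigma>' \<longrightarrow> p \<notin> fst ` \<tau>)"

text \<open>The value at \<open>\<sigma>'\<close> of the pushforward along the first projection of a \<open>(dim \<sigma>')\<close>-dimensional
  weight \<open>e\<close> on \<open>\<Delta>'\<close>, computed at the point \<open>p\<close> of \<open>\<sigma>'\<close>.\<close>

definition pushforward ::
    "'a::euclidean_space set \<Rightarrow> ('a \<times> 'a) set set \<Rightarrow> (('a \<times> 'a) set \<Rightarrow> int) \<Rightarrow> 'a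
       \<Rightarrow> 'a set \<Rightarrow> int" where
  "pushforward N \<Delta>' e p \<sigma>' =
     (\<Sum>\<sigma> | \<sigma> \<in> \<Delta>' \<and> dim \<sigma> = dim \<sigma>' \<and> dim (fst ` \<sigma>) = dim \<sigma>' \<and> fst ` \<sigma> \<subseteq> \<sigma>' \<and> p \<in> fst ` \<sigma>.
        int (lattice_index (sublattice N \<sigma>') (fst ` sublattice (N \<times> N) \<sigma>)) * e \<sigma>)"

definition chi :: "(nat \<Rightarrow> 'a \<Rightarrow> real) \<Rightarrow> nat \<Rightarrow> 'a \<times> 'a \<Rightarrow> real" where
  "chi u i = (\<lambda>(x, y). min 0 (u i y - u i x))"

text \<open>The product depends on the choice of a basis \<open>u\<close> of \<open>M\<close>, of a refinement \<open>\<Delta>'\<close> and, for each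
  cone \<open>\<gamma>\<close>, of a generic point \<open>p \<gamma>\<close>, which are arguments here. The functions \<open>chi u 0\<close>, \<dots>,
  \<open>chi u (DIM('a) - 1)\<close> are applied in this order.\<close>

definition allermann_rau_product ::
    "'a::euclidean_space set \<Rightarrow> 'a set set \<Rightarrow> (nat \<Rightarrow> 'a \<Rightarrow> real) \<Rightarrow> ('a \<times> 'a) set set \<Rightarrow> ('a set \<Rightarrow> 'a)
       \<Rightarrow> nat \<Rightarrow> ('a set \<Rightarrow> int) \<Rightarrow> nat \<Rightarrow> ('a set \<Rightarrow> int) \<Rightarrow> 'a set \<Rightarrow> int" where
  "allermann_rau_product N \<Delta> u \<Delta>' p k\<^sub>1 c\<^sub>1 k\<^sub>2 c\<^sub>2 \<gamma> =
     (if \<gamma> \<in> codim_cones \<Delta> (k\<^sub>1 + k\<^sub>2)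
      then pushforward N \<Delta>'
             (kappa_iter (N \<times> N) \<Delta>' (k\<^sub>1 + k\<^sub>2)
                (refine_weight \<Delta>' (product_fan \<Delta> \<Delta>) (k\<^sub>1 + k\<^sub>2) (product_weight \<Delta> k\<^sub>1 c\<^sub>1 k\<^sub>2 c\<^sub>2))
                (chi u) DIM('a))
             (p \<gamma>) \<gamma>
      else 0)"

end

theory Submission
  imports Defs
begin

text \<open>Let \<open>\<tau>\<close> be the cone of \<open>\<Delta>'\<close> in the diagonal through \<open>(p \<gamma>, p \<gamma>)\<close>; the value of the
  Allermann--Rau product at \<open>\<gamma>\<close> is the value at \<open>\<tau>\<close> of the weight obtained after \<open>n\<close> steps.
  Write \<open>\<chi>\<^sub>i = min 0 (l i)\<close> and let \<open>K i\<close> be the common kernel of the \<open>l r\<close> with \<open>r \<ge> i\<close>, so that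
  \<open>K 0\<close> is the diagonal and \<open>K n\<close> is everything. The degree of a weight at \<open>z\<close> modulo \<open>K i\<close> sums
  the weights of the cones \<open>\<sigma> \<supseteq> \<tau>\<close> with \<open>z \<in> \<sigma> + K i\<close>, multiplied by the index of
  \<open>N\<^sub>\<sigma> + K i\<close>. For generic \<open>z\<close>, taking the divisor of \<open>\<chi>\<^sub>i\<close> and replacing \<open>K i\<close> by
  \<open>K (i + 1)\<close> does not change the degree: on moving \<open>z\<close> to the hyperplane \<open>l i = 0\<close>, the
  contributions of the walls which are crossed cancel by balancing. Hence the value at \<open>\<tau>\<close> is
  the degree of \<open>c\<^sub>1 \<times> c\<^sub>2\<close> modulo the diagonal at \<open>(q, 0)\<close> for every sufficiently generic \<open>q\<close>, and
  for \<open>q\<close> close to \<open>v\<close> this degree is the fan displacement rule for \<open>v\<close>.\<close>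

section \<open>Subgroups and their indices\<close>

text \<open>The degree is not assumed to be independent of z, so one and the same point must serve
  in all n steps: it has to be generic modulo every \<open>K i\<close> at once and lie on none of
  the hyperplanes \<open>l i = 0\<close>. The given v is generic only for the cones of \<Delta>,
  while \<open>\<Delta>'\<close> adds further walls; hence the passage to a nearby q. Points of the
  form (q, 0) suffice, because every \<open>K i\<close> contains the diagonal, so that they
  represent all classes modulo \<open>K i\<close>. Cones of \<open>\<Delta>'\<close> are replaced by
  their sets of primitive generators. Unimodularity makes these a simplicial complex in which a
  generator outside a wall is itself a normal vector of the wall, and in which adding a generator to
  a cone adds its multiples to the lattice of the cone; this is what makes the indices computable.
  Restricting the degree to the cones containing \<tau> makes it local, which is why the last degree
  is a single value of the weight. The side of the hyperplane on which z lies does not matter: by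
  balancing, max(0, l) and max(0, -l) have the same divisor.\<close>

definition add_subgroup :: "'a::real_vector set \<Rightarrow> bool" where
  "add_subgroup G \<longleftrightarrow> 0 \<in> G \<and> (\<forall>x\<in>G. \<forall>y\<in>G. x - y \<in> G)"

lemma add_subgroup_0: "add_subgroup G \<Longrightarrow> 0 \<in> G"
  and add_subgroup_diff: "add_subgroup G \<Longrightarrow> x \<in> G \<Longrightarrow> y \<in> G \<Longrightarrow> x - y \<in> G"
  by (auto simp: add_subgroup_def)

lemma add_subgroup_minus: "add_subgroup G \<Longrightarrow> x \<in> G \<Longrightarrow> - x \<in> G"
  by (metis add_subgroup_def diff_0)

lemma add_subgroup_add: "add_subgroup G \<Longrightarrow> x \<in> G \<Longrightarrow> y \<in> G \<Longrightarrow> x + y \<in> G"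
  by (metis add_subgroup_diff add_subgroup_minus diff_minus_eq_add)

lemma add_subgroup_scale_nat: "add_subgroup G \<Longrightarrow> x \<in> G \<Longrightarrow> real n *\<^sub>R x \<in> G"
  by (induction n) (auto simp: add_subgroup_0 add_subgroup_add scaleR_left_distrib)

lemma add_subgroup_scale: "add_subgroup G \<Longrightarrow> x \<in> G \<Longrightarrow> of_int j *\<^sub>R x \<in> G"
proof (cases j)
  case (neg n)
  assume "add_subgroup G" "x \<in> G"
  then have "- (real (Suc n) *\<^sub>R x) \<in> G"
    by (metis add_subgroup_minus add_subgroup_scale_nat)
  moreover have "of_int j *\<^sub>R x = - (real (Suc n) *\<^sub>R x)"
    unfolding neg by (simp flip: scaleR_minus_left)
  ultimately show ?thesis by simp
qed (simp add: add_subgroup_scale_nat)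

lemma add_subgroup_sum:
  "add_subgroup G \<Longrightarrow> (\<And>b. b \<in> B \<Longrightarrow> f b \<in> G) \<Longrightarrow> sum f B \<in> G"
  by (induction B rule: infinite_finite_induct) (auto simp: add_subgroup_0 add_subgroup_add)

lemma add_subgroup_subspace: "subspace S \<Longrightarrow> add_subgroup S"
  by (simp add: add_subgroup_def subspace_0 subspace_diff)

lemma add_subgroup_Int: "add_subgroup G \<Longrightarrow> add_subgroup H \<Longrightarrow> add_subgroup (G \<inter> H)"
  by (auto simp: add_subgroup_def)

lemma add_subgroup_plus:
  assumes "add_subgroup G" "add_subgroup H" shows "add_subgroup (G + H)"
  unfolding add_subgroup_def
proof (intro conjI ballI)
  show "0 \<in> G + H"
    using assms by (metis add.left_neutral add_subgroup_0 set_plus_intro)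
  fix x y assume "x \<in> G + H" "y \<in> G + H"
  then obtain a b c d where "x = a + b" "y = c + d" "a \<in> G" "b \<in> H" "c \<in> G" "d \<in> H"
    by (auto elim!: set_plus_elim)
  moreover have "a + b - (c + d) = (a - c) + (b - d)" by simp
  ultimately show "x - y \<in> G + H"
    using assms by (metis add_subgroup_diff set_plus_intro)
qed

definition multiples :: "'a::real_vector \<Rightarrow> 'a set" where
  "multiples w = range (\<lambda>j::int. of_int j *\<^sub>R w)"

lemma add_subgroup_multiples: "add_subgroup (multiples w)"
proof -
  have "of_int i *\<^sub>R w - of_int j *\<^sub>R w = of_int (i - j) *\<^sub>R w" for i j
    by (simp add: scaleR_diff_left)
  then show ?thesis
    unfolding add_subgroup_def multiples_def
    by (auto simp: image_iff intro: exI[of _ 0]) (metis of_int_diff)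
qed

section \<open>Counting cosets\<close>

lemma coset_eq_iff:
  assumes "add_subgroup H"
  shows "a +o H = b +o H \<longleftrightarrow> a - b \<in> H"
proof
  assume "a +o H = b +o H"
  moreover have "a \<in> a +o H"
    using add_subgroup_0[OF assms] by (metis add.right_neutral set_plus_intro2)
  ultimately show "a - b \<in> H" by (simp add: set_minus_plus)
next
  assume *: "a - b \<in> H"
  have "x \<in> a +o H \<longleftrightarrow> x \<in> b +o H" for x
  proof -
    have "x - b = (x - a) + (a - b)" "x - a = (x - b) - (a - b)" by auto
    then show ?thesis
      using * assms by (metis add_subgroup_add add_subgroup_diff set_minus_plus)
  qed
  then show "a +o H = b +o H" by blast
qed

text \<open>A coset of \<open>H + multiples w\<close> is determined by the residue of \<phi> modulo
  |m|, in units of g, and, after subtracting a fixed element with that residue, by a coset of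
  \<open>H\<close> in the kernel of \<phi>. This formula governs every change of multiplicity when a
  generator is added to a cone.\<close>

lemma lattice_index_insert:
  fixes G H :: "'a::euclidean_space set" and \<phi> :: "'a \<Rightarrow> real"
  assumes G: "add_subgroup G" and H: "add_subgroup H" and phi: "linear \<phi>"
    and HG: "H \<subseteq> {x \<in> G. \<phi> x = 0}"
    and im: "\<phi> ` G = range (\<lambda>j::int. g * of_int j)" and g: "g > 0"
    and w: "w \<in> G" "\<phi> w = g * of_int m" "m \<noteq> 0"
  shows "lattice_index G (H + multiples w) = nat \<bar>m\<bar> * lattice_index {x \<in> G. \<phi> x = 0} H"
proof -
  define K where "K = {x \<in> G. \<phi> x = 0}"
  define H' where "H' = H + multiples w"
  have H': "add_subgroup H'"
    unfolding H'_def by (intro add_subgroup_plus H add_subgroup_multiples)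
  have H'G: "H' \<subseteq> G"
    unfolding H'_def multiples_def using HG G w(1)
    by (auto elim!: set_plus_elim intro!: add_subgroup_add add_subgroup_scale)
  have "g \<in> \<phi> ` G" unfolding im by (rule image_eqI[of _ _ 1]) auto
  then obtain g1 where g1: "g1 \<in> G" "\<phi> g1 = g" by auto
  define F where "F = (\<lambda>(r::int, X). (of_int r *\<^sub>R g1) +o (X + multiples w))"
  have F: "F (r, a +o H) = (of_int r *\<^sub>R g1 + a) +o H'" for r a
    unfolding F_def H'_def by (simp add: set_plus_rearranges set_plus_rearrange3)
  \<comment> \<open>No finiteness is involved: \<open>card\<close> is 0 on infinite sets, so the
    resulting equality also covers infinite indices.\<close>
  have "bij_betw F ({0..<\<bar>m\<bar>} \<times> (\<lambda>a. a +o H) ` K) ((\<lambda>a. a +o H') ` G)"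
    unfolding bij_betw_def
  proof
    show "inj_on F ({0..<\<bar>m\<bar>} \<times> (\<lambda>a. a +o H) ` K)"
    proof (rule inj_onI, clarify)
      fix r r' :: int and a a'
      assume r: "r \<in> {0..<\<bar>m\<bar>}" "r' \<in> {0..<\<bar>m\<bar>}" and a: "a \<in> K" "a' \<in> K"
        and eq: "F (r, a +o H) = F (r', a' +o H)"
      have "(of_int r *\<^sub>R g1 + a) - (of_int r' *\<^sub>R g1 + a') \<in> H'"
        using eq unfolding F coset_eq_iff[OF H'] .
      then obtain h j where h: "h \<in> H"
        and e: "(of_int r *\<^sub>R g1 + a) - (of_int r' *\<^sub>R g1 + a') = h + of_int j *\<^sub>R w"
        unfolding H'_def multiples_def by (auto elim!: set_plus_elim)
      have "\<phi> ((of_int r *\<^sub>R g1 + a) - (of_int r' *\<^sub>R g1 + a')) = g * of_int (r - r')"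
        using a g1 by (simp add: K_def linear_diff[OF phi] linear_add[OF phi] linear_scale[OF phi] algebra_simps)
      moreover have "\<phi> (h + of_int j *\<^sub>R w) = g * of_int (j * m)"
        using h HG w by (auto simp: linear_add[OF phi] linear_scale[OF phi] algebra_simps)
      ultimately have "g * of_int (r - r') = g * of_int (j * m)" using e by metis
      then have jm: "r - r' = j * m"
        using g by (metis mult_cancel_left of_int_eq_iff less_irrefl)
      have "\<bar>r - r'\<bar> < \<bar>m\<bar>" using r by auto
      then have "\<bar>j\<bar> * \<bar>m\<bar> < 1 * \<bar>m\<bar>" unfolding jm abs_mult by simp
      then have "j = 0" using w(3) by (simp add: mult_less_cancel_right)
      then have "r = r'" using jm by simp
      moreover have "a - a' \<in> H" using e h \<open>j = 0\<close> \<open>r = r'\<close> by simp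
      ultimately show "r = r' \<and> a +o H = a' +o H" using coset_eq_iff[OF H] by blast
    qed
    show "F ` ({0..<\<bar>m\<bar>} \<times> (\<lambda>a. a +o H) ` K) = (\<lambda>a. a +o H') ` G"
    proof (intro equalityI subsetI)
      fix X assume "X \<in> F ` ({0..<\<bar>m\<bar>} \<times> (\<lambda>a. a +o H) ` K)"
      then obtain r a where "a \<in> K" "X = (of_int r *\<^sub>R g1 + a) +o H'"
        using F by auto
      then show "X \<in> (\<lambda>a. a +o H') ` G"
        using add_subgroup_add[OF G add_subgroup_scale[OF G g1(1)]] by (auto simp: K_def)
    next
      fix X assume "X \<in> (\<lambda>a. a +o H') ` G"
      then obtain x where x: "x \<in> G" "X = x +o H'" by auto
      then obtain p where p: "\<phi> x = g * of_int p" using im by blast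
      define r where "r = p mod \<bar>m\<bar>"
      \<comment> \<open>With this sign s m equals |m| (p div |m|), so division with remainder also
        works for negative m.\<close>
      define s where "s = sgn m * (p div \<bar>m\<bar>)"
      have ps: "p = r + s * m"
      proof -
      have "s * m = \<bar>m\<bar> * (p div \<bar>m\<bar>)" unfolding s_def by (simp add: abs_sgn)
      then show ?thesis unfolding r_def by simp
    qed
      define a where "a = x - of_int s *\<^sub>R w - of_int r *\<^sub>R g1"
      have "a \<in> G" unfolding a_def
        by (intro add_subgroup_diff add_subgroup_scale G x w g1)
      moreover have "\<phi> a = 0"
        unfolding a_def using p w g1
        by (simp add: linear_diff[OF phi] linear_add[OF phi] linear_scale[OF phi] ps algebra_simps)
      ultimately have "a \<in> K" by (simp add: K_def)
      have "(of_int r *\<^sub>R g1 + a) - x = of_int (- s) *\<^sub>R w" by (simp add: a_def)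
      also have "\<dots> \<in> H'"
        unfolding H'_def multiples_def using add_subgroup_0[OF H]
        by (metis add_0 rangeI set_plus_intro)
      finally have "X = F (r, a +o H)"
        using coset_eq_iff[OF H'] x(2) F by metis
      moreover have "r \<in> {0..<\<bar>m\<bar>}" using w(3) by (simp add: r_def)
      ultimately show "X \<in> F ` ({0..<\<bar>m\<bar>} \<times> (\<lambda>a. a +o H) ` K)"
        using \<open>a \<in> K\<close> by blast
    qed
  qed
  from bij_betw_same_card[OF this] show ?thesis
    unfolding lattice_index_def K_def H'_def by (simp add: card_cartesian_product)
qed

text \<open>The kernel of h on \<open>G\<close> lies in \<open>H\<close>, so h induces a bijection
  between the two sets of cosets.\<close>

lemma lattice_index_image:
  fixes G H :: "'a::euclidean_space set" and h :: "'a \<Rightarrow> 'b::euclidean_space"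
  assumes G: "add_subgroup G" and H: "add_subgroup H" and "linear h"
    and ker: "\<And>x. x \<in> G \<Longrightarrow> h x = 0 \<Longrightarrow> x \<in> H" and HG: "H \<subseteq> G"
  shows "lattice_index (h ` G) (h ` H) = lattice_index G H"
proof -
  have im: "h ` (a +o H) = h a +o (h ` H)" for a
    using linear_add[OF \<open>linear h\<close>] by (force simp: elt_set_plus_def image_iff)
  have "inj_on ((`) h) ((\<lambda>a. a +o H) ` G)"
  proof (rule inj_onI, clarify)
    fix a b assume a: "a \<in> G" "b \<in> G" and "h ` (a +o H) = h ` (b +o H)"
    moreover have "a \<in> a +o H"
      using add_subgroup_0[OF H] by (metis add.right_neutral set_plus_intro2)
    ultimately obtain k where k: "k \<in> H" "h a = h (b + k)"
      by (force simp: elt_set_plus_def)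
    then have "a - (b + k) \<in> H"
      using a HG by (intro ker add_subgroup_diff add_subgroup_add G) (auto simp: linear_diff[OF \<open>linear h\<close>])
    then have "a - b \<in> H" using add_subgroup_add[OF H _ k(1)] by force
    then show "a +o H = b +o H" by (simp add: coset_eq_iff[OF H])
  qed
  from card_image[OF this] show ?thesis
    unfolding lattice_index_def by (simp add: image_image im)
qed

lemma lattice_index_self:
  assumes "add_subgroup G" shows "lattice_index G G = 1"
proof -
  have "(\<lambda>a. a +o G) ` G = {G}"
  proof -
    have "a +o G = G" if "a \<in> G" for a
      using coset_eq_iff[OF assms, of a 0] that by simp
    then show ?thesis using add_subgroup_0[OF assms] by auto
  qed
  then show ?thesis by (simp add: lattice_index_def)
qed

text \<open>A nonzero index means a finite quotient Q. Among the multiples of a by 0, ..., |Q| two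
  lie in the same coset, so some positive multiple by at most |Q| lies in \<open>H\<close>; the
  factor |Q|! then works for all a at once.\<close>

lemma lattice_index_multiple:
  assumes G: "add_subgroup G" and H: "add_subgroup H" and "lattice_index G H \<noteq> 0"
  shows "\<exists>h::nat. h > 0 \<and> (\<forall>a\<in>G. real h *\<^sub>R a \<in> H)"
proof -
  define Q where "Q = (\<lambda>a. a +o H) ` G"
  have Q: "finite Q" using assms(3) card_ge_0_finite unfolding lattice_index_def Q_def by auto
  have "real (fact (card Q)) *\<^sub>R a \<in> H" if a: "a \<in> G" for a
  proof -
    have "(\<lambda>i. (real i *\<^sub>R a) +o H) ` {0..card Q} \<subseteq> Q"
      using a by (auto simp: Q_def intro: add_subgroup_scale_nat[OF G])
    then have "\<not> inj_on (\<lambda>i. (real i *\<^sub>R a) +o H) {0..card Q}"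
      using card_inj_on_le[OF _ _ Q] by fastforce
    then obtain i j where ij: "i < j" "j \<le> card Q" "(real i *\<^sub>R a) +o H = (real j *\<^sub>R a) +o H"
      unfolding inj_on_def by (metis atLeastAtMost_iff linorder_neqE_nat)
    have "real j *\<^sub>R a - real i *\<^sub>R a \<in> H" using ij(3) coset_eq_iff[OF H] by metis
    then have *: "real (j - i) *\<^sub>R a \<in> H"
      using ij by (simp add: of_nat_diff scaleR_diff_left)
    have "j - i dvd fact (card Q)" using ij by (intro dvd_fact) auto
    then obtain e where e: "fact (card Q) = (j - i) * e" by blast
    have "real (fact (card Q)) *\<^sub>R a = real e *\<^sub>R (real (j - i) *\<^sub>R a)"
      unfolding e by (simp add: mult.commute)
    then show ?thesis using add_subgroup_scale_nat[OF H *] by metis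
  qed
  then show ?thesis by (intro exI[of _ "fact (card Q)"]) auto
qed

lemma int_subgroup_principal:
  fixes J :: "int set"
  assumes J: "\<And>x y. x \<in> J \<Longrightarrow> y \<in> J \<Longrightarrow> x - y \<in> J" and "j \<in> J" "j \<noteq> 0"
  obtains d where "d > 0" "J = range (\<lambda>i. d * i)"
proof -
  have 0: "0 \<in> J" using J[OF assms(2) assms(2)] by simp
  have neg: "- x \<in> J" if "x \<in> J" for x using J[OF 0 that] by simp
  have add: "x + y \<in> J" if "x \<in> J" "y \<in> J" for x y using J[OF that(1) neg[OF that(2)]] by simp
  define P where "P = (\<lambda>n::nat. n > 0 \<and> int n \<in> J)"
  have "P (nat \<bar>j\<bar>)" using assms neg by (auto simp: P_def abs_if)
  define n where "n = (LEAST n. P n)"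
  have n: "P n" unfolding n_def using \<open>P (nat \<bar>j\<bar>)\<close> by (rule LeastI)
  have least: "n \<le> k" if "P k" for k unfolding n_def using that by (rule Least_le)
  have mult_nat: "int n * int i \<in> J" for i
    by (induction i) (use n 0 add in \<open>auto simp: P_def distrib_left\<close>)
  have mult: "int n * i \<in> J" for i
  proof (cases i)
    case (neg k)
    then show ?thesis using \<open>\<And>x. x \<in> J \<Longrightarrow> - x \<in> J\<close>[OF mult_nat[of "Suc k"]] neg
      by (metis mult_minus_right)
  qed (simp add: mult_nat)
  have "x \<in> range (\<lambda>i. int n * i)" if "x \<in> J" for x
  proof -
    have "x mod int n \<in> J"
      using J[OF that mult[of "x div int n"]] by (simp add: minus_mult_div_eq_mod)
    moreover have "0 \<le> x mod int n" "x mod int n < int n" using n by (auto simp: P_def)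
    ultimately have "x mod int n = 0"
      using least[of "nat (x mod int n)"] by (force simp: P_def)
    then show ?thesis by (metis mult_div_mod_eq add.right_neutral rangeI)
  qed
  then have "J = range (\<lambda>i. int n * i)" using mult by auto
  then show ?thesis using that[of "int n"] n by (auto simp: P_def)
qed

text \<open>\<phi> is only a real functional, so its image on a lattice could be dense. Finite index
  excludes this: for some h all of h G lies in \<open>H + multiples w\<close>, hence the values of
  \<phi> are integral multiples of |\<phi> w| / h, and a nonzero subgroup of these is
  cyclic.\<close>

lemma linear_image_cyclic:
  fixes G H :: "'a::euclidean_space set" and \<phi> :: "'a \<Rightarrow> real"
  assumes G: "add_subgroup G" and H: "add_subgroup H" and phi: "linear \<phi>"
    and H0: "\<And>x. x \<in> H \<Longrightarrow> \<phi> x = 0"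
    and w: "w \<in> G" "\<phi> w \<noteq> 0" and fin: "lattice_index G (H + multiples w) \<noteq> 0"
  obtains g where "g > 0" "\<phi> ` G = range (\<lambda>j::int. g * of_int j)"
proof -
  obtain h :: nat where h: "h > 0" "\<And>a. a \<in> G \<Longrightarrow> real h *\<^sub>R a \<in> H + multiples w"
    using lattice_index_multiple[OF G add_subgroup_plus[OF H add_subgroup_multiples] fin] by blast
  define e where "e = \<bar>\<phi> w\<bar> / h"
  have e: "e > 0" using w h by (simp add: e_def)
  have mul: "\<exists>i::int. \<phi> a = of_int i * e" if aG: "a \<in> G" for a
  proof -
    obtain b and i :: int where "b \<in> H" "real h *\<^sub>R a = b + of_int i *\<^sub>R w"
      using h(2)[OF aG] unfolding multiples_def by (blast elim: set_plus_elim)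
    then have "h * \<phi> a = of_int i * \<phi> w"
    proof -
      have "\<phi> (real h *\<^sub>R a) = \<phi> (b + of_int i *\<^sub>R w)" using \<open>real h *\<^sub>R a = _\<close> by simp
      then show ?thesis
        using H0[OF \<open>b \<in> H\<close>] by (simp add: linear_scale[OF phi] linear_add[OF phi])
    qed
    then have "\<phi> a = of_int i * \<phi> w / h" using h(1) by (simp add: field_simps)
    also have "\<dots> = of_int (if \<phi> w \<ge> 0 then i else - i) * e" by (simp add: e_def)
    finally show ?thesis by blast
  qed
  define J where "J = {i::int. of_int i * e \<in> \<phi> ` G}"
  obtain j where j: "\<phi> w = of_int j * e" using mul w by blast
  have "j \<in> J" "j \<noteq> 0" using j w by (auto simp: J_def image_iff) metis
  moreover have "x - y \<in> J" if "x \<in> J" "y \<in> J" for x y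
  proof -
    obtain a b where "a \<in> G" "b \<in> G" "of_int x * e = \<phi> a" "of_int y * e = \<phi> b"
      using \<open>x \<in> J\<close> \<open>y \<in> J\<close> by (auto simp: J_def)
    then have "of_int (x - y) * e = \<phi> (a - b)" "a - b \<in> G"
      by (auto simp: linear_diff[OF phi] algebra_simps add_subgroup_diff[OF G])
    then show ?thesis by (auto simp: J_def)
  qed
  ultimately obtain d where d: "d > 0" "J = range (\<lambda>i. d * i)"
    by (metis int_subgroup_principal)
  have "\<phi> ` G = range (\<lambda>j::int. (of_int d * e) * of_int j)"
  proof (intro equalityI subsetI)
    fix y assume y: "y \<in> \<phi> ` G"
    then obtain i :: int where i: "y = of_int i * e" using mul by blast
    then have "i \<in> J" using y by (simp add: J_def)
    then obtain k where "i = d * k" using d by auto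
    then show "y \<in> range (\<lambda>j::int. (of_int d * e) * of_int j)" using i by (auto simp: image_iff)
  next
    fix y assume "y \<in> range (\<lambda>j::int. (of_int d * e) * of_int j)"
    then obtain k where k: "y = (of_int d * e) * of_int k" by auto
    have "d * k \<in> J" using d by auto
    then show "y \<in> \<phi> ` G" using k by (simp add: J_def mult.commute mult.left_commute)
  qed
  moreover have "of_int d * e > 0" using d e by simp
  ultimately show ?thesis using that by blast
qed

section \<open>Crossings and cones\<close>

text \<open>The numbers \<open>\<alpha> b + \<beta> b * t\<close> are the coordinates of a point
  moving on a line. The times at which all are nonnegative form an interval, entered with \<beta> >
  0 and left with \<beta> < 0. Far to the left the point is outside, so the signed number of ends
  passed before time 0 tells whether time 0 lies inside. The hypotheses keep 0 from being an end and
  let only one coordinate vanish at an end.\<close>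

lemma signed_crossings:
  fixes \<alpha> \<beta> :: "'b \<Rightarrow> real"
  assumes fin: "finite R" and nz: "\<And>b. b \<in> R \<Longrightarrow> \<alpha> b \<noteq> 0"
    and two: "\<And>b b' t. b \<in> R \<Longrightarrow> b' \<in> R \<Longrightarrow> \<alpha> b + \<beta> b * t = 0 \<Longrightarrow> \<alpha> b' + \<beta> b' * t = 0 \<Longrightarrow> b = b'"
    and far: "\<And>t. t < t1 \<Longrightarrow> \<exists>b\<in>R. \<alpha> b + \<beta> b * t < 0"
  shows "(\<Sum>b\<in>R. sgn (\<beta> b) *
            of_bool (\<exists>t<0. \<alpha> b + \<beta> b * t = 0 \<and> (\<forall>b'\<in>R. \<alpha> b' + \<beta> b' * t \<ge> 0)))
         = of_bool (\<forall>b\<in>R. \<alpha> b \<ge> 0)"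
proof -
  define I where "I = {t. \<forall>b\<in>R. \<alpha> b + \<beta> b * t \<ge> 0}"
  define Q where "Q = (\<lambda>b. \<exists>t<0. \<alpha> b + \<beta> b * t = 0 \<and> t \<in> I)"
  define Pp where "Pp = {b\<in>R. \<beta> b > 0 \<and> Q b}"
  define Pm where "Pm = {b\<in>R. \<beta> b < 0 \<and> Q b}"
  have finP: "finite Pp" "finite Pm" using fin by (auto simp: Pp_def Pm_def)
  have "(\<Sum>b\<in>R. sgn (\<beta> b) * of_bool (Q b)) = (\<Sum>b\<in>R. of_bool (b \<in> Pp) - of_bool (b \<in> Pm))"
    by (rule sum.cong) (auto simp: Pp_def Pm_def sgn_if)
  also have "\<dots> = real (card Pp) - real (card Pm)"
  proof -
    have "(\<Sum>b\<in>R. of_bool (b \<in> Pp)) = real (card Pp)" "(\<Sum>b\<in>R. of_bool (b \<in> Pm)) = real (card Pm)"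
      using fin by (simp_all add: Pp_def Pm_def Int_def conj_commute cong: conj_cong)
    then show ?thesis by (simp add: sum_subtractf)
  qed
  finally have S: "(\<Sum>b\<in>R. sgn (\<beta> b) * of_bool (Q b)) = real (card Pp) - real (card Pm)" .
  \<comment> \<open>The left end is the largest zero of an increasing coordinate. There is such a
    coordinate, since otherwise the interval would be unbounded to the left, against
    \<open>far\<close>.\<close>
  have pos: "card Pp = 1" if x: "x \<in> I" "x \<le> 0" for x
  proof -
    define Z where "Z = {b\<in>R. \<beta> b > 0}"
    have "Z \<noteq> {}"
    proof
      assume "Z = {}"
      then have le: "\<beta> b \<le> 0" if "b \<in> R" for b using that by (force simp: Z_def)
      define t where "t = min x t1 - 1"
      obtain b where b: "b \<in> R" "\<alpha> b + \<beta> b * t < 0" using far[of t] unfolding t_def by fastforce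
      have "\<beta> b * x \<le> \<beta> b * t" using le[OF b(1)] by (intro mult_left_mono_neg) (auto simp: t_def)
      then show False using b x(1) by (force simp: I_def)
    qed
    define r where "r = (\<lambda>b. - \<alpha> b / \<beta> b)"
    define a where "a = Max (r ` Z)"
    have "a \<in> r ` Z" unfolding a_def using \<open>Z \<noteq> {}\<close> fin by (intro Max_in) (auto simp: Z_def)
    then obtain b where b: "b \<in> Z" "a = r b" by auto
    have le_a: "r b' \<le> a" if "b' \<in> Z" for b'
      unfolding a_def using that fin by (intro Max_ge) (auto simp: Z_def)
    have zero: "\<alpha> b + \<beta> b * a = 0" using b by (simp add: r_def Z_def)
    have "\<alpha> b + \<beta> b * a \<le> \<alpha> b + \<beta> b * x" using x b zero by (auto simp: I_def Z_def)
    then have "a \<le> x" using b by (auto simp: Z_def)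
    have "a \<noteq> 0" using zero nz b by (auto simp: Z_def)
    then have "a < 0" using \<open>a \<le> x\<close> x by simp
    have "a \<in> I"
      unfolding I_def
    proof safe
      fix b' assume b': "b' \<in> R"
      show "\<alpha> b' + \<beta> b' * a \<ge> 0"
      proof (cases "\<beta> b' > 0")
        case True
        then have "\<beta> b' * r b' \<le> \<beta> b' * a" using le_a[of b'] b' by (auto simp: Z_def)
        then show ?thesis using True by (simp add: r_def)
      next
        case False
        then have "\<beta> b' * x \<le> \<beta> b' * a" using \<open>a \<le> x\<close> by (intro mult_left_mono_neg) auto
        then show ?thesis using x b' by (force simp: I_def)
      qed
    qed
    then have "b \<in> Pp" using b zero \<open>a < 0\<close> by (auto simp: Pp_def Q_def Z_def)
    moreover have "b2 = b" if "b2 \<in> Pp" for b2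
    proof -
      obtain t where t: "\<alpha> b2 + \<beta> b2 * t = 0" "t \<in> I" and b2: "b2 \<in> R" "\<beta> b2 > 0"
        using \<open>b2 \<in> Pp\<close> by (auto simp: Pp_def Q_def)
      then have "\<beta> b2 * t = - \<alpha> b2" by linarith
      then have "t = r b2" unfolding r_def using b2(2) by (metis nonzero_mult_div_cancel_left less_irrefl)
      then have "t \<le> a" using le_a b2 by (auto simp: Z_def)
      have "\<alpha> b + \<beta> b * a \<le> \<alpha> b + \<beta> b * t" using t b zero by (auto simp: I_def Z_def)
      then have "a \<le> t" using b by (auto simp: Z_def)
      then have "t = a" using \<open>t \<le> a\<close> by simp
      have "b \<in> R" using b by (simp add: Z_def)
      then show "b2 = b" using two[OF b2(1) _ t(1)[unfolded \<open>t = a\<close>] zero] by blast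
    qed
    ultimately have "Pp = {b}" by blast
    then show ?thesis by simp
  qed
  \<comment> \<open>The right end is the smallest zero of a decreasing coordinate. It is negative
    because c, nonnegative at x and negative at 0, has its zero before 0.\<close>
  have neg: "card Pm = 1" if x: "x \<in> I" "x \<le> 0" and c: "c \<in> R" "\<alpha> c < 0" for x c
  proof -
    define Z where "Z = {b\<in>R. \<beta> b < 0}"
    have "\<beta> c * x > 0" using x c by (force simp: I_def)
    then have cZ: "c \<in> Z" using x c by (auto simp: Z_def zero_less_mult_iff)
    define r where "r = (\<lambda>b. - \<alpha> b / \<beta> b)"
    define a where "a = Min (r ` Z)"
    have "a \<in> r ` Z" unfolding a_def using cZ fin by (intro Min_in) (auto simp: Z_def)
    then obtain b where b: "b \<in> Z" "a = r b" by auto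
    have le_a: "a \<le> r b'" if "b' \<in> Z" for b'
      unfolding a_def using that fin by (intro Min_le) (auto simp: Z_def)
    have zero: "\<alpha> b + \<beta> b * a = 0" using b by (simp add: r_def Z_def)
    have "\<alpha> b + \<beta> b * a \<le> \<alpha> b + \<beta> b * x" using x b zero by (auto simp: I_def Z_def)
    then have "x \<le> a" using b by (auto simp: Z_def)
    have "r c < 0" using c cZ by (simp add: r_def Z_def divide_neg_neg)
    then have "a < 0" using le_a[OF cZ] by simp
    have "a \<in> I"
      unfolding I_def
    proof safe
      fix b' assume b': "b' \<in> R"
      show "\<alpha> b' + \<beta> b' * a \<ge> 0"
      proof (cases "\<beta> b' < 0")
        case True
        then have "\<beta> b' * r b' \<le> \<beta> b' * a" using le_a[of b'] b' by (auto simp: Z_def)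
        then show ?thesis using True by (simp add: r_def)
      next
        case False
        then have "\<beta> b' * x \<le> \<beta> b' * a" using \<open>x \<le> a\<close> by (intro mult_left_mono) auto
        then show ?thesis using x b' by (force simp: I_def)
      qed
    qed
    then have "b \<in> Pm" using b zero \<open>a < 0\<close> by (auto simp: Pm_def Q_def Z_def)
    moreover have "b2 = b" if "b2 \<in> Pm" for b2
    proof -
      obtain t where t: "\<alpha> b2 + \<beta> b2 * t = 0" "t \<in> I" and b2: "b2 \<in> R" "\<beta> b2 < 0"
        using \<open>b2 \<in> Pm\<close> by (auto simp: Pm_def Q_def)
      then have "\<beta> b2 * t = - \<alpha> b2" by linarith
      then have "t = r b2" unfolding r_def using b2(2) by (metis nonzero_mult_div_cancel_left less_irrefl)
      then have "a \<le> t" using le_a b2 by (auto simp: Z_def)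
      have "\<alpha> b + \<beta> b * a \<le> \<alpha> b + \<beta> b * t" using t b zero by (auto simp: I_def Z_def)
      then have "t \<le> a" using b by (auto simp: Z_def)
      then have "t = a" using \<open>a \<le> t\<close> by simp
      have "b \<in> R" using b by (simp add: Z_def)
      then show "b2 = b" using two[OF b2(1) _ t(1)[unfolded \<open>t = a\<close>] zero] by blast
    qed
    ultimately have "Pm = {b}" by blast
    then show ?thesis by simp
  qed
  have "real (card Pp) - real (card Pm) = of_bool (\<forall>b\<in>R. \<alpha> b \<ge> 0)"
  proof (cases "\<forall>b\<in>R. \<alpha> b \<ge> 0")
    case True
    then have "0 \<in> I" by (simp add: I_def)
    then have "card Pp = 1" using pos by blast
    moreover have "Pm = {}"
    proof -
      have False if bR: "b \<in> R" and bn: "\<beta> b < 0" and t: "t < 0" "\<alpha> b + \<beta> b * t = 0" for b t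
      proof -
        have "\<beta> b * t > 0" using bn t by (simp add: mult_neg_neg)
        then show False using True bR t by force
      qed
      then show ?thesis unfolding Pm_def Q_def by blast
    qed
    ultimately show ?thesis using True by simp
  next
    case False
    then obtain c where c: "c \<in> R" "\<alpha> c < 0" by force
    show ?thesis
    proof (cases "\<exists>x\<in>I. x \<le> 0")
      case True
      then obtain x where "x \<in> I" "x \<le> 0" by blast
      then have "card Pp = 1" "card Pm = 1" using pos neg c by blast+
      then show ?thesis using False by simp
    next
      case False
      then have "Pp = {}" "Pm = {}" by (force simp: Pp_def Pm_def Q_def)+
      then show ?thesis using \<open>\<not> (\<forall>b\<in>R. \<alpha> b \<ge> 0)\<close> by simp
    qed
  qed
  with S show ?thesis unfolding Q_def I_def by simp
qed

section \<open>Finitely generated cones and their images modulo a subspace\<close>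

lemma convex_cone_hull_finite:
  assumes "finite S"
  shows "x \<in> convex_cone hull S \<longleftrightarrow> (\<exists>a. (\<forall>b\<in>S. a b \<ge> 0) \<and> x = (\<Sum>b\<in>S. a b *\<^sub>R b))"
proof
  define C where "C = {\<Sum>b\<in>S. a b *\<^sub>R b | a. \<forall>b\<in>S. a b \<ge> 0}"
  have "S \<subseteq> C"
  proof
    fix x assume "x \<in> S"
    then have "x = (\<Sum>b\<in>S. (if b = x then 1 else 0) *\<^sub>R b)"
      using assms by (simp add: if_distrib[of "\<lambda>r. r *\<^sub>R _"] sum.delta cong: if_cong)
    then show "x \<in> C" unfolding C_def by (intro CollectI exI[of _ "\<lambda>b. if b = x then 1 else 0"]) auto
  qed
  moreover have "convex_cone C"
    unfolding convex_cone_iff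
  proof (intro conjI ballI allI impI)
    show "0 \<in> C" unfolding C_def by (intro CollectI exI[of _ "\<lambda>b. 0"]) auto
    fix x y assume "x \<in> C" "y \<in> C"
    then obtain a a' where "x = (\<Sum>b\<in>S. a b *\<^sub>R b)" "y = (\<Sum>b\<in>S. a' b *\<^sub>R b)"
      "\<forall>b\<in>S. a b \<ge> 0" "\<forall>b\<in>S. a' b \<ge> 0" by (auto simp: C_def)
    then show "x + y \<in> C" unfolding C_def
      by (intro CollectI exI[of _ "\<lambda>b. a b + a' b"]) (auto simp: scaleR_left_distrib sum.distrib)
  next
    fix x and c :: real assume "x \<in> C" "0 \<le> c"
    then obtain a where "x = (\<Sum>b\<in>S. a b *\<^sub>R b)" "\<forall>b\<in>S. a b \<ge> 0" by (auto simp: C_def)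
    then show "c *\<^sub>R x \<in> C" unfolding C_def using \<open>0 \<le> c\<close>
      by (intro CollectI exI[of _ "\<lambda>b. c * a b"]) (auto simp: scaleR_sum_right)
  qed
  moreover assume "x \<in> convex_cone hull S"
  ultimately have "x \<in> C" by (metis hull_minimal subsetD)
  then show "\<exists>a. (\<forall>b\<in>S. a b \<ge> 0) \<and> x = (\<Sum>b\<in>S. a b *\<^sub>R b)" by (auto simp: C_def)
next
  assume "\<exists>a. (\<forall>b\<in>S. a b \<ge> 0) \<and> x = (\<Sum>b\<in>S. a b *\<^sub>R b)"
  then obtain a where a: "\<forall>b\<in>S. a b \<ge> 0" "x = (\<Sum>b\<in>S. a b *\<^sub>R b)" by blast
  have "(\<Sum>b\<in>B. a b *\<^sub>R b) \<in> convex_cone hull S" if "B \<subseteq> S" for B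
    using finite_subset[OF that assms] that
  proof (induction B rule: finite_induct)
    case (insert b B)
    then have "a b *\<^sub>R b \<in> convex_cone hull S"
      using a(1) by (intro convex_cone_hull_mul hull_inc) auto
    then show ?case using insert by (simp add: convex_cone_hull_add)
  qed (simp add: convex_cone_hull_contains_0)
  then show "x \<in> convex_cone hull S" using a by blast
qed

lemma convex_cone_hull_subset_span: "convex_cone hull S \<subseteq> span S"
  by (simp add: convex_cone_span hull_minimal span_superset)

lemma span_convex_cone_hull [simp]: "span (convex_cone hull S) = span S"
  by (metis convex_cone_hull_subset_span hull_subset span_mono span_span subset_antisym)

lemma independent_finite_sum_eq:
  fixes S :: "'a::euclidean_space set"
  assumes "independent S" "(\<Sum>b\<in>S. a b *\<^sub>R b) = (\<Sum>b\<in>S. a' b *\<^sub>R b)" "b \<in> S"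
  shows "a b = a' b"
proof -
  have *: "(\<Sum>b\<in>S. (a b - a' b) *\<^sub>R b) = 0"
    using assms(2) by (simp add: scaleR_left_diff_distrib sum_subtractf)
  then have "a b - a' b = 0"
    using independentD[OF assms(1) finiteI_independent[OF assms(1)] order_refl *] assms(3) by simp
  then show ?thesis by simp
qed

lemma dim_plus_Int:
  fixes S T :: "'a::euclidean_space set"
  assumes "subspace S" "subspace T"
  shows "dim (S + T) + dim (S \<inter> T) = dim S + dim T"
proof -
  have "S + T = {x + y |x y. x \<in> S \<and> y \<in> T}" by (auto simp: set_plus_def)
  then show ?thesis using dim_sums_Int[OF assms] by simp
qed

lemma subspace_plus: "subspace S \<Longrightarrow> subspace T \<Longrightarrow> subspace (S + T)"
proof -
  assume "subspace S" "subspace T"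
  moreover have "S + T = {x + y |x y. x \<in> S \<and> y \<in> T}" by (auto simp: set_plus_def)
  ultimately show ?thesis using subspace_sums[of S T] by simp
qed

text \<open>Generators in \<open>T\<close> are absorbed by \<open>K\<close>, so their coefficients
  may have any sign; only the coordinates outside \<open>T\<close> are constrained.\<close>

lemma cone_plus_subspace_iff:
  assumes "finite S" "T \<subseteq> S" "T \<subseteq> K" "subspace K"
  shows "z \<in> convex_cone hull S + K \<longleftrightarrow>
           (\<exists>a. (\<forall>b\<in>S - T. a b \<ge> 0) \<and> z - (\<Sum>b\<in>S - T. a b *\<^sub>R b) \<in> K)"
proof
  assume "z \<in> convex_cone hull S + K"
  then obtain x k where x: "x \<in> convex_cone hull S" "k \<in> K" "z = x + k" by (auto elim: set_plus_elim)
  then obtain a where a: "\<forall>b\<in>S. a b \<ge> 0" "x = (\<Sum>b\<in>S. a b *\<^sub>R b)"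
    using convex_cone_hull_finite[OF assms(1)] by blast
  have "z - (\<Sum>b\<in>S - T. a b *\<^sub>R b) = (\<Sum>b\<in>T. a b *\<^sub>R b) + k"
    using x a sum.subset_diff[OF assms(2,1), of "\<lambda>b. a b *\<^sub>R b"] by (simp add: algebra_simps)
  also have "\<dots> \<in> K"
    using assms x by (intro subspace_add subspace_sum subspace_scale) auto
  finally show "\<exists>a. (\<forall>b\<in>S - T. a b \<ge> 0) \<and> z - (\<Sum>b\<in>S - T. a b *\<^sub>R b) \<in> K" using a by auto
next
  assume "\<exists>a. (\<forall>b\<in>S - T. a b \<ge> 0) \<and> z - (\<Sum>b\<in>S - T. a b *\<^sub>R b) \<in> K"
  then obtain a where a: "\<forall>b\<in>S - T. a b \<ge> 0" "z - (\<Sum>b\<in>S - T. a b *\<^sub>R b) \<in> K" by blast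
  have "(\<Sum>b\<in>S - T. a b *\<^sub>R b) \<in> convex_cone hull (S - T)"
    using a(1) convex_cone_hull_finite[of "S - T"] assms(1) by blast
  then have "(\<Sum>b\<in>S - T. a b *\<^sub>R b) \<in> convex_cone hull S"
    using hull_mono[of "S - T" S convex_cone] by blast
  then show "z \<in> convex_cone hull S + K"
    using a(2) by (metis add.commute diff_add_cancel set_plus_intro)
qed

lemma span_plus_subspace_iff:
  fixes K :: "'a::euclidean_space set"
  assumes "finite S" "T \<subseteq> S" "T \<subseteq> K" "subspace K"
  shows "z \<in> span S + K \<longleftrightarrow> (\<exists>a. z - (\<Sum>b\<in>S - T. a b *\<^sub>R b) \<in> K)"
proof
  assume "z \<in> span S + K"
  then obtain x k where x: "x \<in> span S" "k \<in> K" "z = x + k" by (auto elim: set_plus_elim)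
  then obtain a where a: "x = (\<Sum>b\<in>S. a b *\<^sub>R b)"
    using span_finite[OF assms(1)] by auto
  have "z - (\<Sum>b\<in>S - T. a b *\<^sub>R b) = (\<Sum>b\<in>T. a b *\<^sub>R b) + k"
    using x a sum.subset_diff[OF assms(2,1), of "\<lambda>b. a b *\<^sub>R b"] by (simp add: algebra_simps)
  also have "\<dots> \<in> K"
    using assms x by (intro subspace_add subspace_sum subspace_scale) auto
  finally show "\<exists>a. z - (\<Sum>b\<in>S - T. a b *\<^sub>R b) \<in> K" by auto
next
  assume "\<exists>a. z - (\<Sum>b\<in>S - T. a b *\<^sub>R b) \<in> K"
  then obtain a where a: "z - (\<Sum>b\<in>S - T. a b *\<^sub>R b) \<in> K" by blast
  have "(\<Sum>b\<in>S - T. a b *\<^sub>R b) \<in> span S" by (intro span_sum span_scale span_base) auto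
  then show "z \<in> span S + K"
    using a by (metis add.commute diff_add_cancel set_plus_intro)
qed

lemma subspace_kernel_Int:
  assumes "subspace K'" "linear \<phi>" shows "subspace {x \<in> K'. \<phi> x = 0}"
proof -
  have "{x \<in> K'. \<phi> x = 0} = K' \<inter> {x. \<phi> x = 0}" by auto
  then show ?thesis using assms by (simp add: subspace_inter linear_subspace_kernel)
qed

lemma dim_kernel_step:
  fixes K' :: "'a::euclidean_space set" and \<phi> :: "'a \<Rightarrow> real"
  assumes K': "subspace K'" and phi: "linear \<phi>" and K: "K = {x \<in> K'. \<phi> x = 0}"
    and f: "f \<in> K'" "\<phi> f = 1"
  shows "dim K' = Suc (dim K)"
proof -
  have subK: "subspace K" unfolding K by (rule subspace_kernel_Int[OF K' phi])
  have phiK: "\<phi> x = 0" if "x \<in> K" for x using that K by auto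
  have "K' = K + span {f}"
  proof (intro equalityI subsetI)
    fix x assume "x \<in> K'"
    then have "x - \<phi> x *\<^sub>R f \<in> K"
      using K f K' by (auto simp: linear_diff[OF phi] linear_scale[OF phi] intro!: subspace_diff subspace_scale)
    moreover have "\<phi> x *\<^sub>R f \<in> span {f}" by (simp add: span_base span_scale)
    ultimately show "x \<in> K + span {f}" by (metis diff_add_cancel set_plus_intro)
  next
    fix x assume "x \<in> K + span {f}"
    then show "x \<in> K'"
      using K f K' by (auto simp: span_singleton elim!: set_plus_elim intro!: subspace_add subspace_scale)
  qed
  moreover have "K \<inter> span {f} = {0}"
  proof -
    have "x = 0" if x: "x \<in> K" "x \<in> span {f}" for x
    proof -
      obtain k where "x = k *\<^sub>R f" using x by (auto simp: span_singleton)
      then show "x = 0" using phiK[OF x(1)] f(2) by (simp add: linear_scale[OF phi])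
    qed
    then show ?thesis using subspace_0[OF subK] span_zero by blast
  qed
  moreover have "f \<noteq> 0" using f(2) linear_0[OF phi] by auto
  ultimately show ?thesis
    using dim_plus_Int[OF subK subspace_span, of "{f}"] by (simp add: dim_singleton)
qed

section \<open>Weights on unimodular complexes\<close>

lemma lattice_basis_subset: "lattice_basis N B \<Longrightarrow> B \<subseteq> N"
proof
  fix x assume *: "lattice_basis N B" and x: "x \<in> B"
  then have "finite B" using finiteI_independent by (auto simp: lattice_basis_def)
  then have "x = (\<Sum>b\<in>B. real_of_int (if b = x then 1 else 0) *\<^sub>R b)"
    using x by (simp add: if_distrib[of "\<lambda>r. real_of_int r *\<^sub>R _"] sum.delta cong: if_cong)
  then have "\<exists>a. x = (\<Sum>b\<in>B. real_of_int (a b) *\<^sub>R b)"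
    by (intro exI[of _ "\<lambda>b. if b = x then 1 else 0"])
  then show "x \<in> N" using * unfolding lattice_basis_def by blast
qed

lemma add_subgroup_full_lattice: "full_lattice N \<Longrightarrow> add_subgroup N"
proof -
  assume "full_lattice N"
  then obtain B where N: "N = {(\<Sum>b\<in>B. real_of_int (a b) *\<^sub>R b) | a. True}"
    by (auto simp: full_lattice_def lattice_basis_def)
  have "0 \<in> N" unfolding N by (intro CollectI exI[of _ "\<lambda>_. 0"]) auto
  moreover have "(\<Sum>b\<in>B. real_of_int (a b) *\<^sub>R b) - (\<Sum>b\<in>B. real_of_int (a' b) *\<^sub>R b) \<in> N" for a a'
    unfolding N by (intro CollectI exI[of _ "\<lambda>b. a b - a' b"]) (auto simp: sum_subtractf scaleR_left_diff_distrib)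
  ultimately show ?thesis unfolding add_subgroup_def using N by force
qed

lemma span_full_lattice: "full_lattice N \<Longrightarrow> span N = UNIV"
  by (metis full_lattice_def lattice_basis_def lattice_basis_subset span_mono top.extremum_uniqueI)

text \<open>Coefficients in the basis \<open>B\<close> are unique, so the real coefficients of an
  element of \<open>span S\<close> coincide with its integral ones.\<close>

lemma sublattice_lattice_basis:
  fixes N :: "'a::euclidean_space set"
  assumes B: "lattice_basis N B" and S: "S \<subseteq> B" and x: "x \<in> sublattice N S"
  obtains a :: "'a \<Rightarrow> int" where "x = (\<Sum>b\<in>S. of_int (a b) *\<^sub>R b)"
proof -
  have ind: "independent B" and N: "N = {(\<Sum>b\<in>B. real_of_int (a b) *\<^sub>R b) | a. True}"
    using B by (auto simp: lattice_basis_def)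
  have fin: "finite B" by (rule finiteI_independent[OF ind])
  have finS: "finite S" using fin S finite_subset by blast
  obtain a where a: "x = (\<Sum>b\<in>B. real_of_int (a b) *\<^sub>R b)"
    using x N by (auto simp: sublattice_def)
  obtain e where e: "x = (\<Sum>b\<in>S. e b *\<^sub>R b)"
    using x span_finite[OF finS] by (auto simp: sublattice_def)
  have "(\<Sum>b\<in>S. e b *\<^sub>R b) = (\<Sum>b\<in>B. (if b \<in> S then e b else 0) *\<^sub>R b)"
    using S fin by (intro sum.mono_neutral_cong_left) auto
  then have "real_of_int (a b) = (if b \<in> S then e b else 0)" if "b \<in> B" for b
    using a e by (intro independent_finite_sum_eq[OF ind _ that]) simp
  then have "x = (\<Sum>b\<in>S. real_of_int (a b) *\<^sub>R b)"
    unfolding e using S by (intro sum.cong) auto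
  then show ?thesis by (rule that)
qed

text \<open>Cones are encoded by their sets of primitive generators: faces become subsets, dimension
  becomes cardinality, and a cone adjacent to a wall \<open>T\<close> has the form
  \<open>insert b T\<close>.\<close>

locale unimodular_complex =
  fixes \<Lambda> :: "'a::euclidean_space set" and \<S> :: "'a set set"
  assumes finite_complex: "finite \<S>"
    and subset_complex: "S \<in> \<S> \<Longrightarrow> T \<subseteq> S \<Longrightarrow> T \<in> \<S>"
    and basis_complex: "S \<in> \<S> \<Longrightarrow> \<exists>B. lattice_basis \<Lambda> B \<and> S \<subseteq> B"
    and lattice: "full_lattice \<Lambda>"
begin

lemma subgroup: "add_subgroup \<Lambda>"
  by (rule add_subgroup_full_lattice[OF lattice])

lemma subgroup_sublattice: "add_subgroup (sublattice \<Lambda> S)"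
  unfolding sublattice_def by (intro add_subgroup_Int subgroup add_subgroup_subspace subspace_span)

lemma subset_lattice: "S \<in> \<S> \<Longrightarrow> S \<subseteq> \<Lambda>"
  using basis_complex lattice_basis_subset by blast

lemma independent_complex: "S \<in> \<S> \<Longrightarrow> independent S"
  using basis_complex independent_mono unfolding lattice_basis_def by blast

lemma finite_in_complex: "S \<in> \<S> \<Longrightarrow> finite S"
  using independent_complex finiteI_independent by blast

text \<open>For b in the link, the class of b modulo \<open>span T\<close> is the primitive normal
  vector of the cone over \<open>insert b T\<close>; sums over the link are thus the sums of the
  balancing condition.\<close>

definition link :: "'a set \<Rightarrow> 'a set" where
  "link T = {b. b \<notin> T \<and> insert b T \<in> \<S>}"

lemma finite_link [simp]: "finite (link T)"
proof -
  have "link T \<subseteq> \<Union>\<S>" by (auto simp: link_def)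
  then show ?thesis
    using finite_complex finite_in_complex by (meson finite_Union finite_subset)
qed

text \<open>Unimodularity enters the index computations here: for generators that are not part of a
  lattice basis, the left side could be larger by a finite index.\<close>

lemma sublattice_insert:
  assumes "insert b T \<in> \<S>"
  shows "sublattice \<Lambda> (insert b T) = sublattice \<Lambda> T + multiples b"
proof (cases "b \<in> T")
  case True
  then have "b \<in> sublattice \<Lambda> T" using subset_lattice[OF assms] by (auto simp: sublattice_def span_base)
  then have "multiples b \<subseteq> sublattice \<Lambda> T"
    unfolding multiples_def using add_subgroup_scale[OF subgroup_sublattice] by auto
  then have "sublattice \<Lambda> T + multiples b \<subseteq> sublattice \<Lambda> T"
    using add_subgroup_add[OF subgroup_sublattice] by (auto elim!: set_plus_elim)
  moreover have "sublattice \<Lambda> T \<subseteq> sublattice \<Lambda> T + multiples b"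
    using add_subgroup_0[OF add_subgroup_multiples] by (metis add.commute set_zero_plus2)
  ultimately show ?thesis using True by (simp add: insert_absorb)
next
  case False
  show ?thesis
  proof
    show "sublattice \<Lambda> (insert b T) \<subseteq> sublattice \<Lambda> T + multiples b"
    proof
      fix x assume x: "x \<in> sublattice \<Lambda> (insert b T)"
      obtain B where B: "lattice_basis \<Lambda> B" "insert b T \<subseteq> B" using basis_complex[OF assms] by blast
      obtain a :: "'a \<Rightarrow> int" where a: "x = (\<Sum>b\<in>insert b T. of_int (a b) *\<^sub>R b)"
        using sublattice_lattice_basis[OF B x] by blast
      have fT: "finite T" using finite_in_complex[OF assms] by simp
      have "x = (\<Sum>b\<in>T. of_int (a b) *\<^sub>R b) + of_int (a b) *\<^sub>R b"
        using a fT False by simp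
      moreover have "(\<Sum>b\<in>T. of_int (a b) *\<^sub>R b) \<in> sublattice \<Lambda> T"
        using subset_lattice[OF assms]
        by (intro add_subgroup_sum subgroup_sublattice add_subgroup_scale)
           (auto simp: sublattice_def span_base)
      ultimately show "x \<in> sublattice \<Lambda> T + multiples b"
        unfolding multiples_def by blast
    qed
    have "sublattice \<Lambda> T \<subseteq> sublattice \<Lambda> (insert b T)"
      unfolding sublattice_def using span_mono[of T "insert b T"] by auto
    moreover have "multiples b \<subseteq> sublattice \<Lambda> (insert b T)"
      unfolding multiples_def using subset_lattice[OF assms]
      by (auto simp: sublattice_def span_base intro!: add_subgroup_scale[OF subgroup] span_scale)
    ultimately show "sublattice \<Lambda> T + multiples b \<subseteq> sublattice \<Lambda> (insert b T)"
      using add_subgroup_add[OF subgroup_sublattice[of "insert b T"]]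
      by (blast elim: set_plus_elim)
  qed
qed

section \<open>Balanced weights and their divisors\<close>

definition balanced :: "nat \<Rightarrow> ('a set \<Rightarrow> real) \<Rightarrow> bool" where
  "balanced m c \<longleftrightarrow>
     (\<forall>T\<in>\<S>. card T + 1 = m \<longrightarrow> (\<Sum>b\<in>link T. c (insert b T) *\<^sub>R b) \<in> span T)"

lemma balanced_linear:
  assumes "balanced m c" "T \<in> \<S>" "card T + 1 = m" "linear f" "\<And>b. b \<in> T \<Longrightarrow> f b = 0"
  shows "(\<Sum>b\<in>link T. c (insert b T) * f b) = (0::real)"
proof -
  have "f (\<Sum>b\<in>link T. c (insert b T) *\<^sub>R b) = 0"
    using assms linear_eq_0_on_span[OF assms(4), of T] by (auto simp: balanced_def)
  then show ?thesis by (simp add: linear_sum[OF assms(4)] linear_scale[OF assms(4)])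
qed

text \<open>The divisor of max(0, l). In the applications l has one sign on each cone, so if l is
  not zero on \<open>T\<close>, max(0, l) is linear on all cones around \<open>T\<close> and
  contributes nothing.\<close>

definition divisor :: "('a \<Rightarrow> real) \<Rightarrow> ('a set \<Rightarrow> real) \<Rightarrow> 'a set \<Rightarrow> real" where
  "divisor l c T =
     (if \<forall>b\<in>T. l b = 0 then \<Sum>b | b \<in> link T \<and> l b > 0. l b * c (insert b T) else 0)"

text \<open>By balancing, the values of l on the link, weighted by c, sum to 0, so the positive and
  the negative part have the same size. This leaves the sign of l free to be adapted to the
  displaced point.\<close>

lemma divisor_uminus:
  assumes "balanced m c" "T \<in> \<S>" "card T + 1 = m" "linear l"
  shows "divisor (\<lambda>x. - l x) c T = divisor l c T"
proof (cases "\<forall>b\<in>T. l b = 0")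
  case True
  have "(\<Sum>b\<in>link T. c (insert b T) * l b) =
        (\<Sum>b | b \<in> link T \<and> l b > 0. l b * c (insert b T)) +
        (\<Sum>b | b \<in> link T \<and> l b < 0. l b * c (insert b T))"
    by (subst sum.union_disjoint[symmetric]) (auto intro!: sum.mono_neutral_cong_right)
  then show ?thesis
    using True balanced_linear[OF assms(1-4)] by (simp add: divisor_def sum_negf)
qed (auto simp: divisor_def)

text \<open>Let Y b b' be the weight of the cone over T, b, b' times (l b) b' - (l b') b. For fixed
  b with l b > 0, balancing at \<open>insert b T\<close> puts the sum over b' into
  \<open>span T\<close>. Summed over these b, the pairs with l b' > 0 cancel since Y is
  antisymmetric, pairs of opposite signs span no cone, and the pairs with l b' = 0 form the
  balancing sum of the divisor.\<close>

lemma balanced_divisor: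
  assumes bal: "balanced (Suc m) c" and l: "linear l"
    and sgn: "\<And>S. S \<in> \<S> \<Longrightarrow> (\<forall>b\<in>S. l b \<ge> 0) \<or> (\<forall>b\<in>S. l b \<le> 0)"
  shows "balanced m (divisor l c)"
  unfolding balanced_def
proof (intro ballI impI)
  fix T assume T: "T \<in> \<S>" "card T + 1 = m"
  have finT: "finite T" by (rule finite_in_complex[OF T(1)])
  define X where "X = (\<lambda>b b'. b \<noteq> b' \<and> insert b (insert b' T) \<in> \<S>)"
  define C where "C = (\<lambda>b b'. if X b b' then c (insert b (insert b' T)) else 0)"
  define L where "L = link T"
  have finL: "finite L" by (simp add: L_def)
  have Xsym: "X b b' = X b' b" for b b' by (auto simp: X_def insert_commute)
  have Csym: "C b b' = C b' b" for b b' by (auto simp: C_def Xsym insert_commute)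
  have link: "link (insert b T) = {b'\<in>L. X b' b}" if "b \<in> L" for b
    using that by (auto simp: link_def L_def X_def insert_commute intro: subset_complex)
  have sum_link: "(\<Sum>b'\<in>link (insert b T). g b' (c (insert b' (insert b T)))) = (\<Sum>b'\<in>L. g b' (C b b'))"
    if "b \<in> L" "\<And>b'. g b' 0 = 0" for b and g :: "'a \<Rightarrow> real \<Rightarrow> 'b::ab_group_add"
    unfolding link[OF that(1)] using finL that
    by (intro sum.mono_neutral_cong_left) (auto simp: C_def Xsym insert_commute)
  show "(\<Sum>b\<in>link T. divisor l c (insert b T) *\<^sub>R b) \<in> span T"
  proof (cases "\<forall>b\<in>T. l b = 0")
    case False
    then have "divisor l c (insert b T) = 0" for b by (auto simp: divisor_def)
    then show ?thesis by (simp add: span_zero)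
  next
    case True
    define P where "P = {b\<in>L. l b > 0}"
    define Z where "Z = {b\<in>L. l b = 0}"
    have finPZ: "finite P" "finite Z" using finL by (auto simp: P_def Z_def)
    have nz: "C b b' = 0" if "b \<in> P" "l b' < 0" for b b'
      using sgn[of "insert b (insert b' T)"] that by (force simp: C_def X_def P_def)
    have lspan: "l x = 0" if "x \<in> span T" for x
      using linear_eq_0_on_span[OF l _ that] True by blast
    \<comment> \<open>Balancing gives the sum of the b' only up to a multiple k b modulo
      \<open>span T\<close>; applying l determines k, and the second term of the summand removes
      it.\<close>
    have step: "(\<Sum>b'\<in>L. C b b' *\<^sub>R (l b *\<^sub>R b' - l b' *\<^sub>R b)) \<in> span T" if b: "b \<in> P" for b
    proof -
      have bL: "b \<in> L" and bT: "b \<notin> T" using b by (auto simp: P_def L_def link_def)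
      have "insert b T \<in> \<S>" using bL by (simp add: L_def link_def)
      then have "(\<Sum>b'\<in>link (insert b T). c (insert b' (insert b T)) *\<^sub>R b') \<in> span (insert b T)"
        using bal T bT finT unfolding balanced_def by simp
      then have "(\<Sum>b'\<in>L. C b b' *\<^sub>R b') \<in> span (insert b T)"
        using sum_link[OF bL, of "\<lambda>b' r. r *\<^sub>R b'"] by simp
      then obtain k where k: "(\<Sum>b'\<in>L. C b b' *\<^sub>R b') - k *\<^sub>R b \<in> span T"
        by (auto simp: span_insert)
      have "l ((\<Sum>b'\<in>L. C b b' *\<^sub>R b') - k *\<^sub>R b) = 0" by (rule lspan[OF k])
      then have lk: "(\<Sum>b'\<in>L. C b b' * l b') = k * l b"
        by (simp add: linear_diff[OF l] linear_sum[OF l] linear_scale[OF l])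
      have "(\<Sum>b'\<in>L. C b b' *\<^sub>R (l b *\<^sub>R b' - l b' *\<^sub>R b)) =
            l b *\<^sub>R (\<Sum>b'\<in>L. C b b' *\<^sub>R b') - (\<Sum>b'\<in>L. C b b' * l b') *\<^sub>R b"
        by (simp add: scaleR_diff_right sum_subtractf scaleR_sum_right scaleR_sum_left mult.commute)
      also have "\<dots> = l b *\<^sub>R ((\<Sum>b'\<in>L. C b b' *\<^sub>R b') - k *\<^sub>R b)"
        unfolding lk by (simp add: scaleR_diff_right mult.commute)
      finally show ?thesis using k by (metis span_scale)
    qed
    define Y where "Y = (\<lambda>b b'. C b b' *\<^sub>R (l b *\<^sub>R b' - l b' *\<^sub>R b))"
    have Yanti: "Y b b' = - Y b' b" for b b'
      by (simp add: Y_def Csym[of b b'] algebra_simps)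
    have anti: "(\<Sum>b\<in>P. \<Sum>b'\<in>P. Y b b') = 0"
    proof -
      have "(\<Sum>b\<in>P. \<Sum>b'\<in>P. Y b b') = (\<Sum>b'\<in>P. \<Sum>b\<in>P. Y b b')" by (rule sum.swap)
      also have "\<dots> = (\<Sum>b'\<in>P. \<Sum>b\<in>P. - Y b' b)" by (intro sum.cong refl Yanti)
      also have "\<dots> = - (\<Sum>b\<in>P. \<Sum>b'\<in>P. Y b b')" by (simp add: sum_negf)
      finally have "2 *\<^sub>R (\<Sum>b\<in>P. \<Sum>b'\<in>P. Y b b') = 0"
        by (simp add: scaleR_2 eq_neg_iff_add_eq_0)
      then show ?thesis by simp
    qed
    have "(\<Sum>b\<in>P. \<Sum>b'\<in>L. Y b b') \<in> span T"
      using step unfolding Y_def by (rule span_sum)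
    also have "(\<Sum>b\<in>P. \<Sum>b'\<in>L. Y b b') = (\<Sum>b\<in>P. (\<Sum>b'\<in>P. Y b b') + (\<Sum>b'\<in>Z. Y b b'))"
    proof (rule sum.cong[OF refl])
      fix b assume b: "b \<in> P"
      have "(\<Sum>b'\<in>L. Y b b') = (\<Sum>b'\<in>P \<union> Z. Y b b')"
      proof (rule sum.mono_neutral_right[OF finL])
        show "\<forall>b'\<in>L - (P \<union> Z). Y b b' = 0"
          using nz[OF b] by (force simp: P_def Z_def Y_def)
      qed (auto simp: P_def Z_def)
      also have "\<dots> = (\<Sum>b'\<in>P. Y b b') + (\<Sum>b'\<in>Z. Y b b')"
        using finPZ by (intro sum.union_disjoint) (auto simp: P_def Z_def)
      finally show "(\<Sum>b'\<in>L. Y b b') = (\<Sum>b'\<in>P. Y b b') + (\<Sum>b'\<in>Z. Y b b')" .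
    qed
    also have "\<dots> = (\<Sum>b\<in>P. \<Sum>b'\<in>Z. Y b b')" by (simp add: sum.distrib anti)
    also have "\<dots> = (\<Sum>b'\<in>Z. \<Sum>b\<in>P. Y b b')" by (rule sum.swap)
    also have "\<dots> = (\<Sum>b'\<in>Z. divisor l c (insert b' T) *\<^sub>R b')"
    proof (rule sum.cong[OF refl])
      fix b' assume b': "b' \<in> Z"
      then have b'L: "b' \<in> L" by (simp add: Z_def)
      have "divisor l c (insert b' T) =
          (\<Sum>b\<in>link (insert b' T). if l b > 0 then l b * c (insert b (insert b' T)) else 0)"
        using True b' by (simp add: divisor_def Z_def sum.If_cases Int_def)
      also have "\<dots> = (\<Sum>b\<in>L. if l b > 0 then l b * C b' b else 0)"
        by (rule sum_link[OF b'L, of "\<lambda>b r. if l b > 0 then l b * r else 0"]) auto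
      also have "\<dots> = (\<Sum>b\<in>P. l b * C b' b)"
        using finL by (simp add: sum.If_cases Int_def P_def)
      finally have "divisor l c (insert b' T) *\<^sub>R b' = (\<Sum>b\<in>P. (l b * C b' b) *\<^sub>R b')"
        by (simp add: scaleR_sum_left)
      also have "\<dots> = (\<Sum>b\<in>P. Y b b')"
        using b' by (intro sum.cong) (auto simp: Y_def Z_def Csym mult.commute)
      finally show "(\<Sum>b\<in>P. Y b b') = divisor l c (insert b' T) *\<^sub>R b'" by simp
    qed
    also have "\<dots> = (\<Sum>b'\<in>L. divisor l c (insert b' T) *\<^sub>R b')"
      using finL by (intro sum.mono_neutral_left) (auto simp: Z_def divisor_def)
    finally show ?thesis by (simp add: L_def)
  qed
qed

text \<open>The value 0 of \<open>lattice_index\<close> for infinite index is meaningful here: if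
  \<open>span S + K\<close> is a proper subspace, the cone counts with multiplicity 0
  (\<open>mult_nonzero\<close>).\<close>

definition mult :: "'a set \<Rightarrow> 'a set \<Rightarrow> real" where
  "mult K S = real (lattice_index \<Lambda> (sublattice \<Lambda> S + (\<Lambda> \<inter> K)))"

lemma subgroup_plus: "subspace K \<Longrightarrow> add_subgroup (sublattice \<Lambda> S + (\<Lambda> \<inter> K))"
  by (intro add_subgroup_plus subgroup_sublattice add_subgroup_Int subgroup add_subgroup_subspace)

lemma sublattice_plus_insert:
  "insert b T \<in> \<S> \<Longrightarrow>
     sublattice \<Lambda> (insert b T) + (\<Lambda> \<inter> K) = (sublattice \<Lambda> T + (\<Lambda> \<inter> K)) + multiples b"
  by (simp add: sublattice_insert add_ac)

lemma mult_nonzero: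
  assumes "mult K S \<noteq> 0" "subspace K"
  shows "span S + K = UNIV"
proof -
  have "lattice_index \<Lambda> (sublattice \<Lambda> S + (\<Lambda> \<inter> K)) \<noteq> 0" using assms(1) by (simp add: mult_def)
  then obtain h :: nat where h: "h > 0" "\<forall>a\<in>\<Lambda>. real h *\<^sub>R a \<in> sublattice \<Lambda> S + (\<Lambda> \<inter> K)"
    using lattice_index_multiple[OF subgroup subgroup_plus[OF assms(2)]] by blast
  have sub: "subspace (span S + K)" by (intro subspace_plus subspace_span assms)
  have "\<Lambda> \<subseteq> span S + K"
  proof
    fix a assume "a \<in> \<Lambda>"
    then have "real h *\<^sub>R a \<in> span S + K" using h(2) set_plus_mono2[of "sublattice \<Lambda> S" "span S" "\<Lambda> \<inter> K" K]
      by (auto simp: sublattice_def)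
    from subspace_scale[OF sub this, of "1 / real h"] show "a \<in> span S + K" using h(1) by simp
  qed
  then show ?thesis using span_full_lattice[OF lattice] span_minimal[OF _ sub] by blast
qed

text \<open>Up to a common factor, \<open>mult K (insert b T)\<close> is \<open>\<bar>\<psi> b\<bar>\<close>, so balancing says that the
  cones on the two sides of the wall \<open>span T + K\<close> have the same total weight.\<close>

lemma mult_wall_balance:
  assumes bal: "balanced m c" and T: "T \<in> \<S>" "card T + 1 = m" and K: "subspace K"
    and psi: "linear \<psi>" "\<And>x. x \<in> span T + K \<Longrightarrow> \<psi> x = 0"
  shows "(\<Sum>b\<in>link T. sgn (\<psi> b) * mult K (insert b T) * c (insert b T)) = 0"
proof (cases "\<forall>b\<in>link T. \<psi> b = 0 \<or> mult K (insert b T) = 0")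
  case True
  then show ?thesis by (intro sum.neutral) auto
next
  case False
  define H where "H = sublattice \<Lambda> T + (\<Lambda> \<inter> K)"
  have H: "add_subgroup H" unfolding H_def by (rule subgroup_plus[OF K])
  have H0: "\<psi> x = 0" if "x \<in> H" for x
    using psi(2)[of x] that set_plus_mono2[of "sublattice \<Lambda> T" "span T" "\<Lambda> \<inter> K" K]
    unfolding H_def by (auto simp: sublattice_def)
  have HL: "H \<subseteq> \<Lambda>"
    unfolding H_def sublattice_def using add_subgroup_add[OF subgroup] by (auto elim!: set_plus_elim)
  have multH: "mult K (insert b T) = real (lattice_index \<Lambda> (H + multiples b))" if "b \<in> link T" for b
    using that sublattice_plus_insert[of b T K] unfolding mult_def H_def link_def by simp
  have bL: "b \<in> \<Lambda>" if "b \<in> link T" for b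
    using that subset_lattice by (auto simp: link_def)
  obtain b0 where b0: "b0 \<in> link T" "\<psi> b0 \<noteq> 0" "mult K (insert b0 T) \<noteq> 0" using False by blast
  \<comment> \<open>\<psi> need not be integral; one adjacent cone of finite index and off the wall
    suffices to make its values on the lattice cyclic.\<close>
  obtain g where g: "g > 0" "\<psi> ` \<Lambda> = range (\<lambda>j::int. g * of_int j)"
    using linear_image_cyclic[OF subgroup H psi(1) H0 bL[OF b0(1)] b0(2)] b0(3) multH[OF b0(1)]
    by (metis of_nat_eq_0_iff)
  define I where "I = real (lattice_index {x\<in>\<Lambda>. \<psi> x = 0} H)"
  have "sgn (\<psi> b) * mult K (insert b T) = \<psi> b * (I / g)" if b: "b \<in> link T" for b
  proof (cases "\<psi> b = 0")
    case False
    obtain j :: int where j: "\<psi> b = g * of_int j" using g(2) bL[OF b] by blast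
    have "j \<noteq> 0" using False j by auto
    have "lattice_index \<Lambda> (H + multiples b) = nat \<bar>j\<bar> * lattice_index {x\<in>\<Lambda>. \<psi> x = 0} H"
      using HL H0 by (intro lattice_index_insert[OF subgroup H psi(1) _ g(2,1) bL[OF b] j \<open>j \<noteq> 0\<close>]) auto
    then have "mult K (insert b T) = \<bar>of_int j\<bar> * I" unfolding multH[OF b] I_def by simp
    moreover have "sgn (\<psi> b) = sgn (of_int j)" unfolding j using g(1) by (simp add: sgn_mult)
    ultimately have "sgn (\<psi> b) * mult K (insert b T) = of_int j * I"
      by (simp add: sgn_mult_abs flip: mult.assoc del: of_int_abs)
    then show ?thesis using g(1) unfolding j by simp
  qed simp
  then have "(\<Sum>b\<in>link T. sgn (\<psi> b) * mult K (insert b T) * c (insert b T)) =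
      (\<Sum>b\<in>link T. \<psi> b * (I / g) * c (insert b T))" by (intro sum.cong refl) (simp only:)
  also have "\<dots> = (I / g) * (\<Sum>b\<in>link T. c (insert b T) * \<psi> b)"
    by (simp add: sum_distrib_left mult_ac)
  also have "(\<Sum>b\<in>link T. c (insert b T) * \<psi> b) = 0"
  proof (rule balanced_linear[OF bal T psi(1)])
    fix b assume "b \<in> T"
    then show "\<psi> b = 0"
      using psi(2)[of "b + 0"] subspace_0[OF K] by (metis add.right_neutral set_plus_intro span_base)
  qed
  finally show ?thesis by simp
qed

text \<open>Adding b or f to the group \<open>H\<close> multiplies the index of \<open>H\<close> in
  the kernel of \<phi> by \<phi> b and by 1 respectively, and adding the multiples of f turns
  \<Lambda> \<inter> K into \<Lambda> \<inter> K'. The factor \<phi> b is the coefficient in the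
  divisor.\<close>

lemma mult_insert_divisor:
  assumes T: "insert b T \<in> \<S>" and K': "subspace K'" and phi: "linear \<phi>"
    and int: "\<And>x. x \<in> \<Lambda> \<Longrightarrow> \<phi> x \<in> \<int>"
    and K: "K = {x \<in> K'. \<phi> x = 0}" and T0: "\<And>x. x \<in> T \<Longrightarrow> \<phi> x = 0"
    and f: "f \<in> \<Lambda>" "f \<in> K'" "\<phi> f = 1" and b: "\<phi> b > 0"
  shows "mult K (insert b T) = \<phi> b * mult K' T"
proof -
  have subK: "subspace K" unfolding K by (rule subspace_kernel_Int[OF K' phi])
  define H where "H = sublattice \<Lambda> T + (\<Lambda> \<inter> K)"
  have H: "add_subgroup H" unfolding H_def by (rule subgroup_plus[OF subK])
  have HG: "H \<subseteq> {x \<in> \<Lambda>. \<phi> x = 0}"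
  proof
    fix x assume "x \<in> H"
    then obtain y z where *: "x = y + z" "y \<in> \<Lambda>" "y \<in> span T" "z \<in> \<Lambda>" "z \<in> K"
      by (auto simp: H_def sublattice_def elim: set_plus_elim)
    have "\<phi> y = 0" using linear_eq_0_on_span[OF phi T0 *(3)] by blast
    then show "x \<in> {x \<in> \<Lambda>. \<phi> x = 0}"
      using * K add_subgroup_add[OF subgroup] by (auto simp: linear_add[OF phi])
  qed
  have im: "\<phi> ` \<Lambda> = range (\<lambda>j::int. 1 * of_int j)"
  proof (intro equalityI subsetI)
    fix y assume "y \<in> \<phi> ` \<Lambda>"
    then show "y \<in> range (\<lambda>j::int. 1 * of_int j)" using int by (force elim: Ints_cases)
  next
    fix y assume "y \<in> range (\<lambda>j::int. 1 * of_int j :: real)"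
    then obtain j :: int where "y = of_int j" by auto
    then have "y = \<phi> (of_int j *\<^sub>R f)" using f by (simp add: linear_scale[OF phi])
    then show "y \<in> \<phi> ` \<Lambda>" using add_subgroup_scale[OF subgroup f(1)] by blast
  qed
  have bL: "b \<in> \<Lambda>" using subset_lattice[OF T] by simp
  obtain j :: int where j: "\<phi> b = 1 * of_int j" using im bL by blast
  have "j > 0" using b j by simp
  have "lattice_index \<Lambda> (H + multiples b) = nat \<bar>j\<bar> * lattice_index {x\<in>\<Lambda>. \<phi> x = 0} H"
    using \<open>j > 0\<close> by (intro lattice_index_insert[OF subgroup H phi HG im _ bL j]) auto
  moreover have "lattice_index \<Lambda> (H + multiples f) = nat \<bar>1\<bar> * lattice_index {x\<in>\<Lambda>. \<phi> x = 0} H"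
    using f by (intro lattice_index_insert[OF subgroup H phi HG im _ f(1)]) auto
  moreover have "H + multiples f = sublattice \<Lambda> T + (\<Lambda> \<inter> K')"
  proof -
    have "(\<Lambda> \<inter> K) + multiples f = \<Lambda> \<inter> K'"
    proof (intro equalityI subsetI)
      fix x assume "x \<in> (\<Lambda> \<inter> K) + multiples f"
      then show "x \<in> \<Lambda> \<inter> K'"
        using f K K' by (auto simp: multiples_def elim!: set_plus_elim
            intro!: add_subgroup_add[OF subgroup] add_subgroup_scale[OF subgroup] subspace_add subspace_scale)
    next
      fix x assume x: "x \<in> \<Lambda> \<inter> K'"
      obtain i :: int where i: "\<phi> x = of_int i" using im x by force
      have "x - of_int i *\<^sub>R f \<in> \<Lambda> \<inter> K"
        using x f i K K' by (auto simp: linear_diff[OF phi] linear_scale[OF phi]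
            intro!: add_subgroup_diff[OF subgroup] add_subgroup_scale[OF subgroup] subspace_diff subspace_scale)
      moreover have "of_int i *\<^sub>R f \<in> multiples f" unfolding multiples_def by blast
      ultimately show "x \<in> (\<Lambda> \<inter> K) + multiples f"
        by (metis diff_add_cancel set_plus_intro)
    qed
    then show ?thesis unfolding H_def by (simp add: add.assoc)
  qed
  ultimately show ?thesis
    unfolding mult_def sublattice_plus_insert[OF T] H_def[symmetric] using j \<open>j > 0\<close> by simp
qed

text \<open>In all uses \<open>T\<^sub>0\<close> lies in \<open>K\<close>, so that
  \<open>convex_cone hull S + K\<close> already contains \<open>span T\<^sub>0\<close>: what is
  counted are preimages of the class of z in the star of \<open>T\<^sub>0\<close>, projected modulo
  \<open>K\<close>.\<close>

definition degree :: "'a set \<Rightarrow> 'a set \<Rightarrow> nat \<Rightarrow> ('a set \<Rightarrow> real) \<Rightarrow> 'a \<Rightarrow> real" where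
  "degree T\<^sub>0 K m c z =
     (\<Sum>S | S \<in> \<S> \<and> T\<^sub>0 \<subseteq> S \<and> card S = m \<and> z \<in> convex_cone hull S + K. mult K S * c S)"

text \<open>Modulo \<open>K\<close>, z avoids the span of every cone that does not span the whole
  quotient, in particular the walls, by the dimension count in
  \<open>span_plus_proper\<close>.\<close>

definition generic :: "'a \<Rightarrow> 'a set \<Rightarrow> bool" where
  "generic z K \<longleftrightarrow> (\<forall>S\<in>\<S>. z \<in> span S + K \<longrightarrow> span S + K = UNIV)"

lemma dim_span_Int:
  assumes "S \<in> \<S>" "subspace K" "span S + K = UNIV"
  shows "DIM('a) + dim (span S \<inter> K) = card S + dim K"
  using dim_plus_Int[OF subspace_span assms(2), of S] assms(3) independent_complex[OF assms(1)]
  by (simp add: dim_eq_card_independent)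

text \<open>Otherwise \<open>span S \<inter> K\<close> would have dimension less than
  \<open>card T\<^sub>0\<close>, although it contains the independent set
  \<open>T\<^sub>0\<close>.\<close>

lemma span_plus_proper:
  assumes "S \<in> \<S>" "T\<^sub>0 \<subseteq> S" "T\<^sub>0 \<subseteq> K" "subspace K" "card S + dim K < DIM('a) + card T\<^sub>0"
  shows "span S + K \<noteq> UNIV"
proof
  assume *: "span S + K = UNIV"
  have "card T\<^sub>0 = dim T\<^sub>0"
    using independent_complex[OF subset_complex[OF assms(1,2)]] by (simp add: dim_eq_card_independent)
  also have "\<dots> \<le> dim (span S \<inter> K)"
    using assms(2,3) by (intro dim_subset) (auto intro: span_base)
  finally show False using dim_span_Int[OF assms(1,4) *] assms(5) by simp
qed

text \<open>In complementary dimension the same count is sharp. Hence the generators of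
  \<open>S\<close> outside \<open>T\<^sub>0\<close> form a basis of the quotient by
  \<open>K\<close>.\<close>

lemma span_Int_eq:
  assumes "S \<in> \<S>" "T\<^sub>0 \<subseteq> S" "T\<^sub>0 \<subseteq> K" "subspace K" "card S + dim K = DIM('a) + card T\<^sub>0"
    and "span S + K = UNIV"
  shows "span S \<inter> K = span T\<^sub>0"
proof -
  have "card T\<^sub>0 = dim T\<^sub>0"
    using independent_complex[OF subset_complex[OF assms(1,2)]] by (simp add: dim_eq_card_independent)
  moreover have "span T\<^sub>0 \<subseteq> span S \<inter> K"
    using span_mono[OF assms(2)] span_minimal[OF assms(3,4)] by blast
  ultimately show ?thesis
    using dim_span_Int[OF assms(1,4,6)] assms(5)
    by (intro subspace_dim_equal[symmetric] subspace_inter assms subspace_span) auto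
qed

text \<open>Both sides are compared through the walls \<open>\<rho>\<close> which the segment from the hyperplane
  \<open>\<phi> = 0\<close> to \<open>z\<close> in direction \<open>f\<close> crosses modulo \<open>K\<close>: the walls with \<open>\<phi> > 0\<close> somewhere
  cancel by balancing, and those with \<open>\<phi> = 0\<close> make up the divisor.\<close>

lemma degree_divisor:
  assumes bal: "balanced (Suc m) c" and T0: "T\<^sub>0 \<subseteq> K"
    and K': "subspace K'" and phi: "linear \<phi>" and int: "\<And>x. x \<in> \<Lambda> \<Longrightarrow> \<phi> x \<in> \<int>"
    and K: "K = {x \<in> K'. \<phi> x = 0}" and f: "f \<in> \<Lambda>" "f \<in> K'" "\<phi> f = 1"
    and dimK: "Suc m + dim K = DIM('a) + card T\<^sub>0"
    and sgn: "\<And>S. S \<in> \<S> \<Longrightarrow> (\<forall>b\<in>S. \<phi> b \<ge> 0) \<or> (\<forall>b\<in>S. \<phi> b \<le> 0)"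
    and z: "\<phi> z > 0" and gen: "generic z K" and gen': "generic z K'"
  shows "degree T\<^sub>0 K (Suc m) c z = degree T\<^sub>0 K' m (divisor \<phi> c) z"
proof -
  have subK: "subspace K" unfolding K by (rule subspace_kernel_Int[OF K' phi])
  have T0': "T\<^sub>0 \<subseteq> K'" using T0 K by auto
  have KK': "K \<subseteq> K'" using K by auto
  have phiK: "\<phi> x = 0" if "x \<in> K" for x using that K by auto
  have dimK': "dim K' = Suc (dim K)" by (rule dim_kernel_step[OF K' phi K f(2,3)])
  \<comment> \<open>The whole half-line behind z is taken: the cones kept below have \<phi> \<ge> 0
    and are missed for t < -\<phi> z anyway (\<open>far\<close>), and walls with \<phi> = 0 are met
    exactly at t = -\<phi> z.\<close>
  define W where "W = (\<lambda>\<rho>. \<exists>t<0. z + t *\<^sub>R f \<in> convex_cone hull \<rho> + K)"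
  \<comment> \<open>An equation of the wall, normalized at f, so that its sign tells on which side a
    generator lies relative to the direction f. It depends on the wall alone and not on an adjacent
    cone, which permits regrouping by walls; walls parallel to f get 0.\<close>
  define \<psi> where "\<psi> = (\<lambda>\<rho>. if f \<in> span \<rho> + K then (\<lambda>x. 0) else
      (SOME h::'a \<Rightarrow> real. linear h \<and> (\<forall>x\<in>span \<rho> + K. h x = 0) \<and> h f = 1))"
  have psi: "linear (\<psi> \<rho>) \<and> (\<forall>x\<in>span \<rho> + K. \<psi> \<rho> x = 0) \<and> (f \<notin> span \<rho> + K \<longrightarrow> \<psi> \<rho> f = 1)" for \<rho>
  proof (cases "f \<in> span \<rho> + K")
    case True
    then show ?thesis by (simp add: \<psi>_def linear_iff)
  next
    case False
    have sub: "subspace (span \<rho> + K)" by (intro subspace_plus subspace_span subK)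
    then have "f \<notin> span (span \<rho> + K)" using False by (metis span_eq_iff)
    then obtain B where B: "B \<subseteq> span \<rho> + K" "independent B" "span \<rho> + K \<subseteq> span B"
      by (metis basis_exists)
    have "span B = span \<rho> + K" using B sub by (metis span_minimal subset_antisym)
    then have "f \<notin> span B" using False by simp
    then have "independent (insert f B)" using B(2) by (simp add: independent_insertI)
    then obtain h :: "'a \<Rightarrow> real" where h: "linear h" "\<forall>x\<in>insert f B. h x = (if x = f then 1 else 0)"
      using linear_independent_extend[of "insert f B" "\<lambda>x. if x = f then 1 else (0::real)"] by auto
    have fB: "f \<notin> B" using \<open>f \<notin> span B\<close> by (auto dest: span_base)
    have hB: "h b = 0" if "b \<in> B" for b
    proof -
      have "b \<noteq> f" using that fB by auto
      then show ?thesis using h(2) that by auto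
    qed
    have "\<forall>x\<in>span \<rho> + K. h x = 0"
      using linear_eq_0_on_span[OF h(1) hB] \<open>span B = _\<close> by blast
    moreover have "h f = 1" using h(2) by simp
    ultimately have "linear h \<and> (\<forall>x\<in>span \<rho> + K. h x = 0) \<and> h f = 1" using h(1) by blast
    then have "linear (\<psi> \<rho>) \<and> (\<forall>x\<in>span \<rho> + K. \<psi> \<rho> x = 0) \<and> \<psi> \<rho> f = 1"
      unfolding \<psi>_def if_not_P[OF False]
      by (rule someI[of "\<lambda>h. linear h \<and> (\<forall>x\<in>span \<rho> + K. h x = 0) \<and> h f = 1"])
    then show ?thesis by blast
  qed
  define A where "A = {S \<in> \<S>. T\<^sub>0 \<subseteq> S \<and> card S = Suc m}"
  define A' where "A' = {S \<in> \<S>. T\<^sub>0 \<subseteq> S \<and> card S = m}"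
  \<comment> \<open>By \<open>sgn\<close>, \<phi> is then nonnegative on the cone; all other cones
    have \<phi> \<le> 0 and miss z.\<close>
  define P where "P = (\<lambda>S. \<exists>b\<in>S. \<phi> b > 0)"
  have finA: "finite A" "finite A'" using finite_complex by (auto simp: A_def A'_def)
  \<comment> \<open>\<open>key\<close> writes the indicator of a cone as the signed count of its
    facets crossed by the half-line; \<open>key0\<close> says that through a facet on which \<phi> =
    0 the cone is always entered.\<close>
  have key: "of_bool (z \<in> convex_cone hull S + K) =
               (\<Sum>b\<in>S - T\<^sub>0. sgn (\<psi> (S - {b}) b) * of_bool (W (S - {b})))"
    and key0: "\<And>b. b \<in> S - T\<^sub>0 \<Longrightarrow> W (S - {b}) \<Longrightarrow> (\<forall>x\<in>S - {b}. \<phi> x = 0) \<Longrightarrow> sgn (\<psi> (S - {b}) b) = 1"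
    if S: "S \<in> A" and PS: "P S" and mS: "mult K S \<noteq> 0" for S
  proof -
    have SS: "S \<in> \<S>" "T\<^sub>0 \<subseteq> S" "card S = Suc m" using S by (auto simp: A_def)
    have finS: "finite S" by (rule finite_in_complex[OF SS(1)])
    have full: "span S + K = UNIV" by (rule mult_nonzero[OF mS subK])
    have int: "span S \<inter> K = span T\<^sub>0"
      using SS dimK by (intro span_Int_eq[OF SS(1,2) T0 subK _ full]) simp
    define R where "R = S - T\<^sub>0"
    have finR: "finite R" using finS by (simp add: R_def)
    have coord: "\<exists>a. y - (\<Sum>b\<in>R. a b *\<^sub>R b) \<in> K" for y
      using span_plus_subspace_iff[OF finS SS(2) T0 subK, of y] full by (simp add: R_def)
    have uniq0: "a b = 0" if "(\<Sum>b\<in>R. a b *\<^sub>R b) \<in> K" "b \<in> R" for a b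
    proof -
      have "(\<Sum>b\<in>R. a b *\<^sub>R b) \<in> span S"
        by (intro span_sum span_scale span_base) (auto simp: R_def)
      then have "(\<Sum>b\<in>R. a b *\<^sub>R b) \<in> span T\<^sub>0" using that(1) int by blast
      moreover have fT: "finite T\<^sub>0" using finS SS(2) finite_subset by blast
      ultimately obtain e where e: "(\<Sum>b\<in>R. a b *\<^sub>R b) = (\<Sum>b\<in>T\<^sub>0. e b *\<^sub>R b)"
        using span_finite[OF fT] by auto
      have "(\<Sum>b\<in>S. (if b \<in> R then a b else 0) *\<^sub>R b) = (\<Sum>b\<in>R. a b *\<^sub>R b)"
        using finS by (intro sum.mono_neutral_cong_right) (auto simp: R_def)
      moreover have "(\<Sum>b\<in>S. (if b \<in> T\<^sub>0 then e b else 0) *\<^sub>R b) = (\<Sum>b\<in>T\<^sub>0. e b *\<^sub>R b)"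
        using finS SS(2) by (intro sum.mono_neutral_cong_right) auto
      ultimately have "(\<Sum>b\<in>S. (if b \<in> R then a b else 0) *\<^sub>R b) = (\<Sum>b\<in>S. (if b \<in> T\<^sub>0 then e b else 0) *\<^sub>R b)"
        using e by simp
      from independent_finite_sum_eq[OF independent_complex[OF SS(1)] this, of b] that(2)
      show ?thesis by (auto simp: R_def)
    qed
    have uniq: "a b = a' b"
      if "y - (\<Sum>b\<in>R. a b *\<^sub>R b) \<in> K" "y - (\<Sum>b\<in>R. a' b *\<^sub>R b) \<in> K" "b \<in> R" for y a a' b
    proof -
      have "(y - (\<Sum>b\<in>R. a' b *\<^sub>R b)) - (y - (\<Sum>b\<in>R. a b *\<^sub>R b)) \<in> K"
        by (intro subspace_diff subK that)
      then have "(\<Sum>b\<in>R. (a b - a' b) *\<^sub>R b) \<in> K"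
        by (simp add: scaleR_left_diff_distrib sum_subtractf)
      from uniq0[OF this that(3)] show ?thesis by simp
    qed
    \<comment> \<open>\<alpha> and \<beta> are the coordinates of z and f in the basis
      \<open>R\<close> of the space modulo \<open>K\<close>.\<close>
    obtain \<alpha> where \<alpha>: "z - (\<Sum>b\<in>R. \<alpha> b *\<^sub>R b) \<in> K" using coord by blast
    obtain \<beta> where \<beta>: "f - (\<Sum>b\<in>R. \<beta> b *\<^sub>R b) \<in> K" using coord by blast
    have line: "z + t *\<^sub>R f - (\<Sum>b\<in>R. (\<alpha> b + \<beta> b * t) *\<^sub>R b) \<in> K" for t
    proof -
      have "(z - (\<Sum>b\<in>R. \<alpha> b *\<^sub>R b)) + t *\<^sub>R (f - (\<Sum>b\<in>R. \<beta> b *\<^sub>R b)) \<in> K"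
        by (intro subspace_add subspace_scale subK \<alpha> \<beta>)
      then show ?thesis
        by (simp add: algebra_simps sum.distrib scaleR_sum_right)
    qed
    have coneS: "z + t *\<^sub>R f \<in> convex_cone hull S + K \<longleftrightarrow> (\<forall>b\<in>R. \<alpha> b + \<beta> b * t \<ge> 0)" for t
    proof
      assume "z + t *\<^sub>R f \<in> convex_cone hull S + K"
      then obtain a where "\<forall>b\<in>R. a b \<ge> 0" "z + t *\<^sub>R f - (\<Sum>b\<in>R. a b *\<^sub>R b) \<in> K"
        using cone_plus_subspace_iff[OF finS SS(2) T0 subK] unfolding R_def by blast
      then show "\<forall>b\<in>R. \<alpha> b + \<beta> b * t \<ge> 0" using uniq[OF _ line] by metis
    next
      assume "\<forall>b\<in>R. \<alpha> b + \<beta> b * t \<ge> 0"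
      then show "z + t *\<^sub>R f \<in> convex_cone hull S + K"
        using line[of t] unfolding cone_plus_subspace_iff[OF finS SS(2) T0 subK] R_def[symmetric]
        by (intro exI[of _ "\<lambda>b. \<alpha> b + \<beta> b * t"]) simp
    qed
    have facet: "z + t *\<^sub>R f \<in> convex_cone hull (S - {b}) + K \<longleftrightarrow>
        \<alpha> b + \<beta> b * t = 0 \<and> (\<forall>b\<in>R. \<alpha> b + \<beta> b * t \<ge> 0)" if b: "b \<in> R" for b t
    proof -
      have T0b: "T\<^sub>0 \<subseteq> S - {b}" "finite (S - {b})" "S - {b} - T\<^sub>0 = R - {b}"
        using b SS(2) finS by (auto simp: R_def)
      have *: "(\<Sum>x\<in>R - {b}. a x *\<^sub>R x) = (\<Sum>x\<in>R. (if x = b then 0 else a x) *\<^sub>R x)" for a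
        using finR by (intro sum.mono_neutral_cong_left) auto
      have **: "(\<Sum>x\<in>R - {b}. a x *\<^sub>R x) = (\<Sum>x\<in>R. a x *\<^sub>R x)" if "a b = 0" for a
        using finR that by (intro sum.mono_neutral_left) auto
      show ?thesis
      proof
        assume "z + t *\<^sub>R f \<in> convex_cone hull (S - {b}) + K"
        then obtain a where a: "\<forall>x\<in>R - {b}. a x \<ge> 0" "z + t *\<^sub>R f - (\<Sum>x\<in>R - {b}. a x *\<^sub>R x) \<in> K"
          using cone_plus_subspace_iff[OF T0b(2,1) T0 subK] unfolding T0b(3) by blast
        have "\<alpha> x + \<beta> x * t = (if x = b then 0 else a x)" if "x \<in> R" for x
          using a(2) unfolding * by (rule uniq[OF line _ that])
        then show "\<alpha> b + \<beta> b * t = 0 \<and> (\<forall>b\<in>R. \<alpha> b + \<beta> b * t \<ge> 0)" using a(1) b by auto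
      next
        assume *: "\<alpha> b + \<beta> b * t = 0 \<and> (\<forall>b\<in>R. \<alpha> b + \<beta> b * t \<ge> 0)"
        then have "z + t *\<^sub>R f - (\<Sum>x\<in>R - {b}. (\<alpha> x + \<beta> x * t) *\<^sub>R x) \<in> K"
          using line[of t] **[of "\<lambda>x. \<alpha> x + \<beta> x * t"] by simp
        then show "z + t *\<^sub>R f \<in> convex_cone hull (S - {b}) + K"
          using * unfolding cone_plus_subspace_iff[OF T0b(2,1) T0 subK] T0b(3)
          by (intro exI[of _ "\<lambda>x. \<alpha> x + \<beta> x * t"]) simp
      qed
    qed
    have \<alpha>_nz: "\<alpha> b \<noteq> 0" if b: "b \<in> R" for b
    proof
      assume "\<alpha> b = 0"
      then have "(\<Sum>x\<in>R. \<alpha> x *\<^sub>R x) = (\<Sum>x\<in>S - {b} - T\<^sub>0. \<alpha> x *\<^sub>R x)"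
        using finR by (intro sum.mono_neutral_right) (auto simp: R_def)
      then have "z \<in> span (S - {b}) + K"
        using span_plus_subspace_iff[of "S - {b}" T\<^sub>0 K z] finS SS(2) b T0 subK \<alpha>
        unfolding R_def by auto
      moreover have Sb: "S - {b} \<in> \<S>" using subset_complex[OF SS(1)] by auto
      ultimately have "span (S - {b}) + K = UNIV" using gen unfolding generic_def by blast
      moreover have "card (S - {b}) = m" using SS(3) finS b by (auto simp: R_def)
      ultimately show False
        using span_plus_proper[OF Sb _ T0 subK] dimK SS(2) b by (auto simp: R_def)
    qed
    \<comment> \<open>Here genericity modulo K' is used. Moving along f does not change the class
      modulo K', so two coordinates vanishing together would put z into the span of a cone with two
      generators fewer, which is proper modulo K'.\<close>
    have two: "b = b'"
      if b: "b \<in> R" "b' \<in> R" and eq: "\<alpha> b + \<beta> b * t = 0" "\<alpha> b' + \<beta> b' * t = 0" for b b' t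
    proof (rule ccontr)
      assume ne: "b \<noteq> b'"
      define S2 where "S2 = S - {b, b'}"
      have S2: "S2 \<in> \<S>" "T\<^sub>0 \<subseteq> S2" "finite S2"
        using subset_complex[OF SS(1)] SS(2) b finS by (auto simp: S2_def R_def)
      have "card S2 + 2 = card S" using b ne finS card_Diff_subset[of "{b,b'}" S] card_mono[of S "{b,b'}"]
        by (auto simp: S2_def R_def)
      then have cS2: "Suc (card S2) = m" using SS(3) by simp
      have "(\<Sum>x\<in>R. (\<alpha> x + \<beta> x * t) *\<^sub>R x) = (\<Sum>x\<in>S2 - T\<^sub>0. (\<alpha> x + \<beta> x * t) *\<^sub>R x)"
        using finR eq by (intro sum.mono_neutral_right) (auto simp: R_def S2_def)
      then have "z + t *\<^sub>R f - (\<Sum>x\<in>S2 - T\<^sub>0. (\<alpha> x + \<beta> x * t) *\<^sub>R x) \<in> K"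
        using line[of t] by simp
      then have "z + t *\<^sub>R f - (\<Sum>x\<in>S2 - T\<^sub>0. (\<alpha> x + \<beta> x * t) *\<^sub>R x) - t *\<^sub>R f \<in> K'"
        using KK' f by (intro subspace_diff[OF K' _ subspace_scale[OF K' f(2)]]) auto
      then have "z - (\<Sum>x\<in>S2 - T\<^sub>0. (\<alpha> x + \<beta> x * t) *\<^sub>R x) \<in> K'" by (simp add: algebra_simps)
      then have "z \<in> span S2 + K'"
        unfolding span_plus_subspace_iff[OF S2(3,2) T0' K']
        by (intro exI[of _ "\<lambda>x. \<alpha> x + \<beta> x * t"])
      then have "span S2 + K' = UNIV" using gen' S2(1) unfolding generic_def by blast
      then show False
        using span_plus_proper[OF S2(1,2) T0' K'] dimK dimK' cS2 by simp
    qed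
    have far: "\<exists>b\<in>R. \<alpha> b + \<beta> b * t < 0" if t: "t < - \<phi> z" for t
    proof (rule ccontr)
      assume "\<not> ?thesis"
      then have "\<forall>b\<in>R. \<alpha> b + \<beta> b * t \<ge> 0" by force
      moreover have "\<phi> b \<ge> 0" if "b \<in> R" for b
        using sgn[OF SS(1)] PS that unfolding P_def R_def by force
      ultimately have "0 \<le> (\<Sum>b\<in>R. (\<alpha> b + \<beta> b * t) * \<phi> b)" by (intro sum_nonneg) auto
      also have "\<dots> = \<phi> (\<Sum>b\<in>R. (\<alpha> b + \<beta> b * t) *\<^sub>R b)"
        by (simp add: linear_sum[OF phi] linear_scale[OF phi])
      also have "\<dots> = \<phi> (z + t *\<^sub>R f)"
        using phiK[OF line[of t]] by (simp add: linear_diff[OF phi])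
      also have "\<dots> = \<phi> z + t" using f by (simp add: linear_add[OF phi] linear_scale[OF phi])
      finally show False using t by simp
    qed
    have W: "W (S - {b}) \<longleftrightarrow> (\<exists>t<0. \<alpha> b + \<beta> b * t = 0 \<and> (\<forall>b'\<in>R. \<alpha> b' + \<beta> b' * t \<ge> 0))"
      if "b \<in> R" for b unfolding W_def facet[OF that] ..
    \<comment> \<open>Apply the wall functional to f, expanded in \<open>R\<close> modulo
      \<open>K\<close>: all generators except b lie on the wall.\<close>
    have psib: "\<psi> (S - {b}) b * \<beta> b = 1" if b: "b \<in> R" and Wb: "W (S - {b})" for b
    proof -
      obtain t where "\<alpha> b + \<beta> b * t = 0" using Wb W[OF b] by blast
      then have "\<beta> b \<noteq> 0" using \<alpha>_nz[OF b] by auto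
      have "f \<notin> span (S - {b}) + K"
      proof
        assume "f \<in> span (S - {b}) + K"
        moreover have T0b: "T\<^sub>0 \<subseteq> S - {b}" "finite (S - {b})" "S - {b} - T\<^sub>0 = R - {b}"
          using b SS(2) finS by (auto simp: R_def)
        ultimately obtain a where "f - (\<Sum>x\<in>R - {b}. a x *\<^sub>R x) \<in> K"
          using span_plus_subspace_iff[OF T0b(2,1) T0 subK] unfolding T0b(3) by blast
        moreover have "(\<Sum>x\<in>R - {b}. a x *\<^sub>R x) = (\<Sum>x\<in>R. (if x = b then 0 else a x) *\<^sub>R x)"
          using finR by (intro sum.mono_neutral_cong_left) auto
        ultimately have "f - (\<Sum>x\<in>R. (if x = b then 0 else a x) *\<^sub>R x) \<in> K" by simp
        from uniq[OF \<beta> this b] show False using \<open>\<beta> b \<noteq> 0\<close> by simp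
      qed
      then have p: "linear (\<psi> (S - {b}))" "\<forall>x\<in>span (S - {b}) + K. \<psi> (S - {b}) x = 0" "\<psi> (S - {b}) f = 1"
        using psi by blast+
      have "\<psi> (S - {b}) x = 0" if "x \<in> R - {b}" for x
      proof -
        have "x + 0 \<in> span (S - {b}) + K"
          using that subspace_0[OF subK] by (intro set_plus_intro span_base) (auto simp: R_def)
        then show ?thesis using p(2) by simp
      qed
      then have "(\<Sum>x\<in>R. \<beta> x * \<psi> (S - {b}) x) = (\<Sum>x\<in>{b}. \<beta> x * \<psi> (S - {b}) x)"
        using finR b by (intro sum.mono_neutral_right) auto
      moreover have "\<psi> (S - {b}) (f - (\<Sum>x\<in>R. \<beta> x *\<^sub>R x)) = 0"
      proof -
        have "0 + (f - (\<Sum>x\<in>R. \<beta> x *\<^sub>R x)) \<in> span (S - {b}) + K"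
          using \<beta> by (intro set_plus_intro span_zero)
        then show ?thesis using p(2) by simp
      qed
      ultimately show ?thesis
        using p(3) by (simp add: linear_diff[OF p(1)] linear_sum[OF p(1)] linear_scale[OF p(1)] mult.commute)
    qed
    have sgnb: "sgn (\<psi> (S - {b}) b) = sgn (\<beta> b)" if b: "b \<in> R" and Wb: "W (S - {b})" for b
    proof -
      have "sgn (\<psi> (S - {b}) b) * sgn (\<beta> b) = 1" using psib[OF that] by (metis sgn_mult sgn_one)
      then show ?thesis by (auto simp: sgn_if split: if_splits)
    qed
    have "(\<Sum>b\<in>R. sgn (\<psi> (S - {b}) b) * of_bool (W (S - {b}))) =
          (\<Sum>b\<in>R. sgn (\<beta> b) * of_bool (\<exists>t<0. \<alpha> b + \<beta> b * t = 0 \<and> (\<forall>b'\<in>R. \<alpha> b' + \<beta> b' * t \<ge> 0)))"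
    proof (rule sum.cong[OF refl])
      fix b assume b: "b \<in> R"
      show "sgn (\<psi> (S - {b}) b) * of_bool (W (S - {b})) =
          sgn (\<beta> b) * of_bool (\<exists>t<0. \<alpha> b + \<beta> b * t = 0 \<and> (\<forall>b'\<in>R. \<alpha> b' + \<beta> b' * t \<ge> 0))"
        unfolding W[OF b, symmetric] using sgnb[OF b] by (cases "W (S - {b})") auto
    qed
    also have "\<dots> = of_bool (\<forall>b\<in>R. \<alpha> b \<ge> 0)"
      by (rule signed_crossings[OF finR \<alpha>_nz two far])
    also have "(\<forall>b\<in>R. \<alpha> b \<ge> 0) \<longleftrightarrow> z \<in> convex_cone hull S + K"
      using coneS[of 0] by simp
    finally show "of_bool (z \<in> convex_cone hull S + K) =
               (\<Sum>b\<in>S - T\<^sub>0. sgn (\<psi> (S - {b}) b) * of_bool (W (S - {b})))"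
      by (simp add: R_def)
    fix b assume b: "b \<in> S - T\<^sub>0" and Wb: "W (S - {b})" and zero: "\<forall>x\<in>S - {b}. \<phi> x = 0"
    have bR: "b \<in> R" using b by (simp add: R_def)
    have "\<phi> b > 0" using PS zero b unfolding P_def by (metis DiffI less_irrefl singletonD)
    have "(\<Sum>x\<in>R. \<beta> x * \<phi> x) = (\<Sum>x\<in>{b}. \<beta> x * \<phi> x)"
      using finR bR zero by (intro sum.mono_neutral_right) (auto simp: R_def)
    then have "\<beta> b * \<phi> b = 1"
      using phiK[OF \<beta>] f(3) by (simp add: linear_diff[OF phi] linear_sum[OF phi] linear_scale[OF phi])
    then have "\<beta> b > 0" using \<open>\<phi> b > 0\<close> by (metis zero_less_mult_pos2 zero_less_one)
    then show "sgn (\<psi> (S - {b}) b) = 1" using sgnb[OF bR Wb] by simp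
  qed
  \<comment> \<open>If \<phi> > 0 somewhere on the wall, all adjacent cones satisfy \<open>P\<close>
    and the sum over the full link vanishes by balancing. If \<phi> < 0 somewhere, no adjacent cone
    satisfies \<open>P\<close>. If \<phi> = 0 on the wall, the generators with \<phi> b > 0 remain,
    and these define the divisor.\<close>
  have wall: "(\<Sum>b | b \<in> link \<rho> \<and> P (insert b \<rho>).
       sgn (\<psi> \<rho> b) * of_bool (W \<rho>) * (mult K (insert b \<rho>) * c (insert b \<rho>)))
     = of_bool (z \<in> convex_cone hull \<rho> + K') * (mult K' \<rho> * divisor \<phi> c \<rho>)" if \<rho>: "\<rho> \<in> A'" for \<rho>
  proof -
    have RS: "\<rho> \<in> \<S>" "T\<^sub>0 \<subseteq> \<rho>" "card \<rho> = m" using \<rho> by (auto simp: A'_def)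
    have finr: "finite \<rho>" by (rule finite_in_complex[OF RS(1)])
    consider (pos) "\<exists>x\<in>\<rho>. \<phi> x > 0" | (neg) "\<exists>x\<in>\<rho>. \<phi> x < 0" | (zero) "\<forall>x\<in>\<rho>. \<phi> x = 0"
      by (metis linorder_neqE_linordered_idom)
    then show ?thesis
    proof cases
      case pos
      then have "(\<Sum>b | b \<in> link \<rho> \<and> P (insert b \<rho>).
          sgn (\<psi> \<rho> b) * of_bool (W \<rho>) * (mult K (insert b \<rho>) * c (insert b \<rho>))) =
        of_bool (W \<rho>) * (\<Sum>b\<in>link \<rho>. sgn (\<psi> \<rho> b) * mult K (insert b \<rho>) * c (insert b \<rho>))"
        unfolding sum_distrib_left by (intro sum.cong) (auto simp: P_def)
      also have "\<dots> = 0"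
        using mult_wall_balance[OF bal RS(1) _ subK, of "\<psi> \<rho>"] psi RS(3) by auto
      finally show ?thesis using pos by (auto simp: divisor_def)
    next
      case neg
      then have "\<not> P (insert b \<rho>)" if "b \<in> link \<rho>" for b
        using sgn[of "insert b \<rho>"] that unfolding P_def link_def by force
      then have empty: "{b. b \<in> link \<rho> \<and> P (insert b \<rho>)} = {}" by blast
      have "divisor \<phi> c \<rho> = 0" using neg by (auto simp: divisor_def)
      then show ?thesis unfolding empty by simp
    next
      case zero
      \<comment> \<open>f lies in K', so the direction of motion disappears modulo K'; conversely
        \<phi> = 0 on the wall and on \<open>K\<close> forces the crossing time -\<phi> z.\<close>
      have Weq: "W \<rho> \<longleftrightarrow> z \<in> convex_cone hull \<rho> + K'"
      proof
        assume "W \<rho>"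
        then obtain t x k where "x \<in> convex_cone hull \<rho>" "k \<in> K" "z + t *\<^sub>R f = x + k"
          unfolding W_def by (blast elim: set_plus_elim)
        then have "z = x + (k - t *\<^sub>R f)" by (simp add: algebra_simps)
        moreover have "k - t *\<^sub>R f \<in> K'"
          using \<open>k \<in> K\<close> KK' f K' by (intro subspace_diff subspace_scale) auto
        ultimately show "z \<in> convex_cone hull \<rho> + K'"
          using \<open>x \<in> convex_cone hull \<rho>\<close> by blast
      next
        assume "z \<in> convex_cone hull \<rho> + K'"
        then obtain x k where x: "x \<in> convex_cone hull \<rho>" "k \<in> K'" "z = x + k"
          by (blast elim: set_plus_elim)
        have "\<phi> x = 0"
          using linear_eq_0_on_span[OF phi, of \<rho> x] zero x(1) convex_cone_hull_subset_span by blast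
        then have "k - \<phi> z *\<^sub>R f \<in> K"
          using x f K K' by (auto simp: linear_add[OF phi] linear_diff[OF phi] linear_scale[OF phi]
              intro!: subspace_diff subspace_scale)
        then have "x + (k - \<phi> z *\<^sub>R f) \<in> convex_cone hull \<rho> + K" using x by blast
        then have "z + (- \<phi> z) *\<^sub>R f \<in> convex_cone hull \<rho> + K" using x(3) by (simp add: algebra_simps)
        then show "W \<rho>" using z unfolding W_def by (intro exI[of _ "- \<phi> z"]) auto
      qed
      have PP: "P (insert b \<rho>) \<longleftrightarrow> \<phi> b > 0" for b using zero by (auto simp: P_def)
      have "sgn (\<psi> \<rho> b) * of_bool (W \<rho>) * (mult K (insert b \<rho>) * c (insert b \<rho>)) =
          of_bool (W \<rho>) * (mult K' \<rho> * (\<phi> b * c (insert b \<rho>)))"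
        if b: "b \<in> link \<rho>" "\<phi> b > 0" for b
      proof -
        have bS: "insert b \<rho> \<in> \<S>" "b \<notin> \<rho>" using b by (auto simp: link_def)
        have me: "mult K (insert b \<rho>) = \<phi> b * mult K' \<rho>"
          using zero by (intro mult_insert_divisor[OF bS(1) K' phi int K _ f b(2)]) auto
        show ?thesis
        proof (cases "W \<rho> \<and> mult K (insert b \<rho>) \<noteq> 0")
          case True
          have "insert b \<rho> \<in> A" using bS RS finr by (auto simp: A_def)
          moreover have "insert b \<rho> - {b} = \<rho>" using bS(2) by auto
          moreover have "P (insert b \<rho>)" using b(2) by (simp add: P_def)
          ultimately have "sgn (\<psi> \<rho> b) = 1"
            using key0[of "insert b \<rho>" b] True zero RS(2) bS(2) by auto
          then show ?thesis using me by simp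
        next
          case False
          then show ?thesis using me b(2) by auto
        qed
      qed
      then have "(\<Sum>b | b \<in> link \<rho> \<and> P (insert b \<rho>).
          sgn (\<psi> \<rho> b) * of_bool (W \<rho>) * (mult K (insert b \<rho>) * c (insert b \<rho>))) =
        (\<Sum>b | b \<in> link \<rho> \<and> \<phi> b > 0. of_bool (W \<rho>) * (mult K' \<rho> * (\<phi> b * c (insert b \<rho>))))"
        unfolding PP by (intro sum.cong) auto
      also have "\<dots> = of_bool (W \<rho>) * (mult K' \<rho> * divisor \<phi> c \<rho>)"
        using zero by (simp add: divisor_def sum_distrib_left)
      finally show ?thesis unfolding Weq .
    qed
  qed
  have "degree T\<^sub>0 K (Suc m) c z = (\<Sum>S\<in>A. of_bool (z \<in> convex_cone hull S + K) * (mult K S * c S))"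
    unfolding degree_def using finA
    by (intro sum.mono_neutral_cong_left) (auto simp: A_def)
  also have "\<dots> = (\<Sum>S | S \<in> A \<and> P S. of_bool (z \<in> convex_cone hull S + K) * (mult K S * c S))"
  proof (rule sum.mono_neutral_right)
    show "\<forall>S\<in>A - {S. S \<in> A \<and> P S}. of_bool (z \<in> convex_cone hull S + K) * (mult K S * c S) = 0"
    proof
      fix S assume S: "S \<in> A - {S. S \<in> A \<and> P S}"
      have "z \<notin> convex_cone hull S + K"
      proof
        assume "z \<in> convex_cone hull S + K"
        then obtain x k where x: "x \<in> convex_cone hull S" "k \<in> K" "z = x + k"
          by (blast elim: set_plus_elim)
        have "finite S" using S finite_in_complex by (auto simp: A_def)
        then obtain a where a: "\<forall>b\<in>S. a b \<ge> 0" "x = (\<Sum>b\<in>S. a b *\<^sub>R b)"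
          using x(1) convex_cone_hull_finite by blast
        have "\<phi> b \<le> 0" if "b \<in> S" for b using S that by (force simp: P_def)
        then have "(\<Sum>b\<in>S. a b * \<phi> b) \<le> 0"
          using a(1) by (intro sum_nonpos) (auto intro: mult_nonneg_nonpos)
        then have "\<phi> z \<le> 0" using x a phiK[OF x(2)]
          by (simp add: linear_add[OF phi] linear_sum[OF phi] linear_scale[OF phi])
        then show False using z by simp
      qed
      then show "of_bool (z \<in> convex_cone hull S + K) * (mult K S * c S) = 0" by simp
    qed
  qed (use finA in auto)
  also have "\<dots> = (\<Sum>S | S \<in> A \<and> P S. \<Sum>b\<in>S - T\<^sub>0.
      sgn (\<psi> (S - {b}) b) * of_bool (W (S - {b})) * (mult K S * c S))"
  proof (rule sum.cong[OF refl])
    fix S assume S: "S \<in> {S. S \<in> A \<and> P S}"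
    show "of_bool (z \<in> convex_cone hull S + K) * (mult K S * c S) =
        (\<Sum>b\<in>S - T\<^sub>0. sgn (\<psi> (S - {b}) b) * of_bool (W (S - {b})) * (mult K S * c S))"
    proof (cases "mult K S = 0")
      case False
      then show ?thesis using key[of S] S by (simp flip: sum_distrib_right)
    qed simp
  qed
  also have "\<dots> = (\<Sum>(S, b)\<in>Sigma {S. S \<in> A \<and> P S} (\<lambda>S. S - T\<^sub>0).
      sgn (\<psi> (S - {b}) b) * of_bool (W (S - {b})) * (mult K S * c S))"
  proof (rule sum.Sigma)
    show "\<forall>S\<in>{S. S \<in> A \<and> P S}. finite (S - T\<^sub>0)"
      using finite_in_complex by (auto simp: A_def)
  qed (use finA in simp)
  \<comment> \<open>Regrouping: a cone with a marked generator outside \<open>T\<^sub>0\<close> is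
    the same as a wall containing \<open>T\<^sub>0\<close> with a generator from its link.\<close>
  also have "\<dots> = (\<Sum>(\<rho>, b)\<in>Sigma A' (\<lambda>\<rho>. {b. b \<in> link \<rho> \<and> P (insert b \<rho>)}).
      sgn (\<psi> \<rho> b) * of_bool (W \<rho>) * (mult K (insert b \<rho>) * c (insert b \<rho>)))"
  proof (rule sum.reindex_bij_witness[of _ "\<lambda>(\<rho>, b). (insert b \<rho>, b)" "\<lambda>(S, b). (S - {b}, b)"])
    fix x assume x: "x \<in> Sigma {S. S \<in> A \<and> P S} (\<lambda>S. S - T\<^sub>0)"
    obtain S b where xS: "x = (S, b)" by (cases x)
    then have S: "S \<in> \<S>" "T\<^sub>0 \<subseteq> S" "card S = Suc m" "P S" "b \<in> S" "b \<notin> T\<^sub>0"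
      using x by (auto simp: A_def)
    have "insert b (S - {b}) = S" using S by auto
    then show "(case case x of (S, b) \<Rightarrow> (S - {b}, b) of (\<rho>, b) \<Rightarrow> (insert b \<rho>, b)) = x"
      and "(case x of (S, b) \<Rightarrow> (S - {b}, b)) \<in> Sigma A' (\<lambda>\<rho>. {b. b \<in> link \<rho> \<and> P (insert b \<rho>)})"
      using S finite_in_complex[OF S(1)] subset_complex[OF S(1), of "S - {b}"]
      unfolding xS by (auto simp: A'_def link_def)
    show "(case case x of (S, b) \<Rightarrow> (S - {b}, b) of
           (\<rho>, b) \<Rightarrow> sgn (\<psi> \<rho> b) * of_bool (W \<rho>) * (mult K (insert b \<rho>) * c (insert b \<rho>))) =
         (case x of (S, b) \<Rightarrow> sgn (\<psi> (S - {b}) b) * of_bool (W (S - {b})) * (mult K S * c S))"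
      unfolding xS using \<open>insert b (S - {b}) = S\<close> by simp
  next
    fix y assume y: "y \<in> Sigma A' (\<lambda>\<rho>. {b. b \<in> link \<rho> \<and> P (insert b \<rho>)})"
    obtain \<rho> b where yr: "y = (\<rho>, b)" by (cases y)
    then have r: "\<rho> \<in> \<S>" "T\<^sub>0 \<subseteq> \<rho>" "card \<rho> = m" "b \<notin> \<rho>" "insert b \<rho> \<in> \<S>" "P (insert b \<rho>)"
      using y by (auto simp: A'_def link_def)
    then show "(case case y of (\<rho>, b) \<Rightarrow> (insert b \<rho>, b) of (S, b) \<Rightarrow> (S - {b}, b)) = y"
      and "(case y of (\<rho>, b) \<Rightarrow> (insert b \<rho>, b)) \<in> Sigma {S. S \<in> A \<and> P S} (\<lambda>S. S - T\<^sub>0)"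
      using finite_in_complex[OF r(1)] unfolding yr by (auto simp: A_def)
  qed
  also have "\<dots> = (\<Sum>\<rho>\<in>A'. \<Sum>b | b \<in> link \<rho> \<and> P (insert b \<rho>).
      sgn (\<psi> \<rho> b) * of_bool (W \<rho>) * (mult K (insert b \<rho>) * c (insert b \<rho>)))"
    using finA by (intro sum.Sigma[symmetric]) auto
  also have "\<dots> = (\<Sum>\<rho>\<in>A'. of_bool (z \<in> convex_cone hull \<rho> + K') * (mult K' \<rho> * divisor \<phi> c \<rho>))"
    by (intro sum.cong refl wall)
  also have "\<dots> = degree T\<^sub>0 K' m (divisor \<phi> c) z"
    unfolding degree_def using finA
    by (intro sum.mono_neutral_cong_right) (auto simp: A'_def)
  finally show ?thesis .
qed

end

section \<open>Unimodular fans\<close>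

text \<open>The sum is the midpoint of 2 y and 2 w, so the face contains 2 y. For y = w, where the
  open segment is empty, rescaling the sum is enough.\<close>

lemma face_of_cone_add:
  assumes "convex_cone Q" "F face_of Q" "y \<in> Q" "w \<in> Q" "y + w \<in> F"
  shows "y \<in> F"
proof -
  have conF: "conic F" using assms(1,2) face_of_conic by (auto simp: convex_cone_def)
  show ?thesis
  proof (cases "y = w")
    case True
    then show ?thesis
      using conicD[OF conF assms(5), of "1/2"] by (simp flip: scaleR_2)
  next
    case False
    have Q2: "2 *\<^sub>R y \<in> Q" "2 *\<^sub>R w \<in> Q" using assms by (auto intro: convex_cone_scaleR)
    have "y + w \<in> open_segment (2 *\<^sub>R y) (2 *\<^sub>R w)"
      unfolding in_segment using False by (intro conjI exI[of _ "1/2"]) auto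
    then have "2 *\<^sub>R y \<in> F" using face_ofD[OF assms(2) _ Q2 assms(5)] by blast
    then show ?thesis using conicD[OF conF, of "2 *\<^sub>R y" "1/2"] by simp
  qed
qed

lemma face_of_convex_cone:
  "convex_cone Q \<Longrightarrow> F face_of Q \<Longrightarrow> F \<noteq> {} \<Longrightarrow> convex_cone F"
  unfolding convex_cone_def by (meson face_of_conic face_of_imp_convex)

text \<open>The linear function equal to 0 on \<open>T\<close> and 1 on the rest of \<open>S\<close>
  is nonnegative on the large cone and vanishes there exactly on the small one.\<close>

lemma face_of_convex_cone_hull_independent:
  fixes S :: "'a::euclidean_space set"
  assumes "independent S" "T \<subseteq> S"
  shows "(convex_cone hull T) face_of (convex_cone hull S)"
proof -
  have finS: "finite S" by (rule finiteI_independent[OF assms(1)])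
  have finT: "finite T" using finS assms(2) finite_subset by blast
  obtain h :: "'a \<Rightarrow> real" where h: "linear h" "\<forall>x\<in>S. h x = (if x \<in> T then 0 else 1)"
    using linear_independent_extend[OF assms(1), of "\<lambda>x. if x \<in> T then 0 else (1::real)"] by auto
  have hval: "h (\<Sum>b\<in>S. a b *\<^sub>R b) = (\<Sum>b\<in>S - T. a b)" for a
  proof -
    have "h (\<Sum>b\<in>S. a b *\<^sub>R b) = (\<Sum>b\<in>S. a b * h b)"
      by (simp add: linear_sum[OF h(1)] linear_scale[OF h(1)])
    also have "\<dots> = (\<Sum>b\<in>S - T. a b)"
      using h(2) finS by (intro sum.mono_neutral_cong_right) auto
    finally show ?thesis .
  qed
  have pos: "h x \<ge> 0" if x: "x \<in> convex_cone hull S" for x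
  proof -
    obtain a where a: "\<forall>b\<in>S. a b \<ge> 0" "x = (\<Sum>b\<in>S. a b *\<^sub>R b)"
      using x convex_cone_hull_finite[OF finS] by blast
    then show ?thesis unfolding a(2) hval by (auto intro: sum_nonneg)
  qed
  have eq: "convex_cone hull T = {x \<in> convex_cone hull S. h x = 0}"
  proof (intro equalityI subsetI)
    fix x assume x: "x \<in> convex_cone hull T"
    have "h x = 0"
    proof (rule linear_eq_0_on_span[OF h(1)])
      show "x \<in> span T" using x convex_cone_hull_subset_span by blast
      show "h y = 0" if "y \<in> T" for y using h(2) assms(2) that by auto
    qed
    then show "x \<in> {x \<in> convex_cone hull S. h x = 0}"
      using x hull_mono[OF assms(2)] by blast
  next
    fix x assume x: "x \<in> {x \<in> convex_cone hull S. h x = 0}"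
    then obtain a where a: "\<forall>b\<in>S. a b \<ge> 0" "x = (\<Sum>b\<in>S. a b *\<^sub>R b)"
      using convex_cone_hull_finite[OF finS] by blast
    have "(\<Sum>b\<in>S - T. a b) = 0" using x hval a(2) by simp
    then have "\<forall>b\<in>S - T. a b = 0"
      using a(1) finS by (subst (asm) sum_nonneg_eq_0_iff) auto
    then have "x = (\<Sum>b\<in>T. a b *\<^sub>R b)"
      unfolding a(2) using assms(2) finS by (intro sum.mono_neutral_right) auto
    then show "x \<in> convex_cone hull T"
      using a(1) assms(2) convex_cone_hull_finite[OF finT] by blast
  qed
  show ?thesis
    unfolding face_of_def
  proof (intro conjI ballI impI)
    show "convex_cone hull T \<subseteq> convex_cone hull S" by (rule hull_mono[OF assms(2)])
    show "convex (convex_cone hull T)" by (rule convex_convex_cone_hull)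
    fix a b x assume ab: "a \<in> convex_cone hull S" "b \<in> convex_cone hull S"
      and x: "x \<in> convex_cone hull T" "x \<in> open_segment a b"
    obtain u where u: "0 < u" "u < 1" "x = (1 - u) *\<^sub>R a + u *\<^sub>R b" using x(2) by (auto simp: in_segment)
    have "(1 - u) * h a + u * h b = 0"
      using x(1) u unfolding eq by (simp add: linear_add[OF h(1)] linear_scale[OF h(1)])
    moreover have "(1 - u) * h a \<ge> 0" "u * h b \<ge> 0" using pos ab u by auto
    ultimately have "(1 - u) * h a = 0" "u * h b = 0" by linarith+
    then have "h a = 0" "h b = 0" using u by auto
    then show "a \<in> convex_cone hull T" "b \<in> convex_cone hull T" using ab unfolding eq by auto
  qed
qed

text \<open>For independent \<open>T\<close> this is membership in the relative interior of the
  cone, expressed by coefficients.\<close>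

definition positive_combination :: "'a::real_vector set \<Rightarrow> 'a \<Rightarrow> bool" where
  "positive_combination T z \<longleftrightarrow> (\<exists>a. (\<forall>b\<in>T. a b > 0) \<and> z = (\<Sum>b\<in>T. a b *\<^sub>R b))"

lemma positive_combination_in_cone:
  "finite T \<Longrightarrow> positive_combination T z \<Longrightarrow> z \<in> convex_cone hull T"
proof -
  assume fin: "finite T" and "positive_combination T z"
  then obtain a where "\<forall>b\<in>T. a b > 0" "z = (\<Sum>b\<in>T. a b *\<^sub>R b)"
    by (auto simp: positive_combination_def)
  then show ?thesis
    unfolding convex_cone_hull_finite[OF fin] by (intro exI[of _ a]) (auto intro: less_imp_le)
qed

lemma positive_combination_ex:
  assumes "finite S" "z \<in> convex_cone hull S"
  obtains T where "T \<subseteq> S" "positive_combination T z"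
proof -
  obtain a where a: "\<forall>b\<in>S. a b \<ge> 0" "z = (\<Sum>b\<in>S. a b *\<^sub>R b)"
    using assms convex_cone_hull_finite by blast
  have "z = (\<Sum>b\<in>{b\<in>S. a b > 0}. a b *\<^sub>R b)"
    unfolding a(2) using a(1) assms(1) by (intro sum.mono_neutral_right) (auto simp: less_le)
  then have "positive_combination {b\<in>S. a b > 0} z" unfolding positive_combination_def by auto
  then show ?thesis using that[of "{b\<in>S. a b > 0}"] by auto
qed

text \<open>Each summand lies in the face by \<open>face_of_cone_add\<close>, and since its
  coefficient is positive, so does its generator.\<close>

lemma positive_combination_face:
  assumes fin: "finite T" and z: "positive_combination T z" "z \<in> F" and Q: "convex_cone Q" "F face_of Q"
    and T: "convex_cone hull T \<subseteq> Q"
  shows "convex_cone hull T \<subseteq> F"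
proof -
  have F: "convex_cone F" using face_of_convex_cone[OF Q] z(2) by blast
  obtain a where a: "\<forall>b\<in>T. a b > 0" "z = (\<Sum>b\<in>T. a b *\<^sub>R b)"
    using z(1) by (auto simp: positive_combination_def)
  have "b \<in> F" if b: "b \<in> T" for b
  proof -
    have "z = a b *\<^sub>R b + (\<Sum>x\<in>T - {b}. a x *\<^sub>R x)" unfolding a(2) using fin b by (rule sum.remove)
    moreover have "a b *\<^sub>R b \<in> Q" using T b a(1)
      by (intro convex_cone_scaleR[OF Q(1)]) (auto intro: hull_inc less_imp_le)
    moreover have "(\<Sum>x\<in>T - {b}. a x *\<^sub>R x) \<in> Q"
    proof -
      have "(\<Sum>x\<in>T - {b}. a x *\<^sub>R x) \<in> convex_cone hull (T - {b})"
        using convex_cone_hull_finite[of "T - {b}"] fin a(1) less_imp_le by blast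
      then show ?thesis using T hull_mono[of "T - {b}" T convex_cone] by blast
    qed
    ultimately have "a b *\<^sub>R b \<in> F" using face_of_cone_add[OF Q] z(2) by metis
    moreover have ab: "a b > 0" using a(1) b by blast
    ultimately have "(1 / a b) *\<^sub>R (a b *\<^sub>R b) \<in> F" by (intro convex_cone_scaleR[OF F, of "1 / a b"]) auto
    moreover have "(1 / a b) *\<^sub>R (a b *\<^sub>R b) = b" using ab by simp
    ultimately show ?thesis by simp
  qed
  then show ?thesis using F by (intro hull_minimal) auto
qed

section \<open>Integral functionals and primitive normal vectors\<close>

lemma lattice_basis_functional:
  fixes N :: "'a::euclidean_space set"
  assumes B: "lattice_basis N B" and b: "b \<in> B"
  shows "\<exists>h :: 'a \<Rightarrow> real. linear h \<and> h b = 1 \<and> (\<forall>x\<in>B - {b}. h x = 0) \<and> (\<forall>x\<in>N. h x \<in> \<int>)"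
proof -
  have ind: "independent B" and N: "N = {(\<Sum>b\<in>B. real_of_int (a b) *\<^sub>R b) | a. True}"
    using B by (auto simp: lattice_basis_def)
  obtain h :: "'a \<Rightarrow> real" where h: "linear h" "\<forall>x\<in>B. h x = (if x = b then 1 else 0)"
    using linear_independent_extend[OF ind, of "\<lambda>x. if x = b then 1 else (0::real)"] by auto
  have "h x \<in> \<int>" if x: "x \<in> N" for x
  proof -
    obtain a where a: "x = (\<Sum>b\<in>B. real_of_int (a b) *\<^sub>R b)" using x N by auto
    have "h x = (\<Sum>x\<in>B. real_of_int (a x) * h x)"
      unfolding a by (simp add: linear_sum[OF h(1)] linear_scale[OF h(1)])
    also have "\<dots> \<in> \<int>" using h(2) by (intro Ints_sum Ints_mult) auto
    finally show ?thesis .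
  qed
  then show ?thesis using h b by (intro exI[of _ h]) auto
qed

text \<open>\<open>normal_vector\<close> is an arbitrary choice and has to be pinned down by its
  properties. Modulo \<open>span \<tau>\<close> it is h u times \<open>u\<^sub>0\<close>; h u is a
  nonnegative integer, and primitivity of u forces it to be 1.\<close>

lemma normal_vector_eq:
  assumes N: "add_subgroup N" and u0: "represents_normal N \<sigma> \<tau> u\<^sub>0" and "\<tau> \<subseteq> \<sigma>"
    and h: "linear h" "h u\<^sub>0 = (1::real)" "\<And>x. x \<in> N \<Longrightarrow> h x \<in> \<int>" "\<And>x. x \<in> \<sigma> \<Longrightarrow> h x \<ge> 0"
    and ker: "\<And>x. x \<in> span \<tau> \<Longrightarrow> h x = 0"
    and rank1: "\<And>x. x \<in> N \<Longrightarrow> x \<in> span \<sigma> \<Longrightarrow> x - h x *\<^sub>R u\<^sub>0 \<in> span \<tau>"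
  shows "normal_vector N \<sigma> \<tau> - u\<^sub>0 \<in> sublattice N \<tau>"
proof -
  define u where "u = normal_vector N \<sigma> \<tau>"
  have u: "represents_normal N \<sigma> \<tau> u"
    unfolding u_def normal_vector_def using u0 by (rule someI)
  have uN: "u \<in> N" "u\<^sub>0 \<in> N" using u u0 by (auto simp: represents_normal_def)
  obtain s t where st: "u = s + t" "s \<in> \<sigma>" "t \<in> span \<tau>"
    using u by (auto simp: represents_normal_def elim: set_plus_elim)
  have "u \<in> span \<sigma>" using st span_mono[OF assms(3)] by (auto intro: span_add span_base)
  then have r: "u - h u *\<^sub>R u\<^sub>0 \<in> span \<tau>" using rank1 uN by blast
  have "h u \<ge> 0" using st h(4) ker by (simp add: linear_add[OF h(1)])
  then obtain j :: nat where j: "h u = real j"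
    using h(3)[OF uN(1)] by (metis Ints_cases of_int_0_le_iff of_int_of_nat_eq nonneg_int_cases)
  have "u - real j *\<^sub>R u\<^sub>0 \<in> sublattice N \<tau>"
    using r j uN add_subgroup_diff[OF N uN(1) add_subgroup_scale_nat[OF N uN(2)]] by (simp add: sublattice_def)
  moreover from this have "j = 1" using u uN by (auto simp: represents_normal_def)
  ultimately show ?thesis by (simp add: u_def)
qed

lemma linear_nonneg_on_cone:
  assumes "linear l" "\<forall>b\<in>S. l b \<ge> (0::real)" "x \<in> convex_cone hull S"
  shows "l x \<ge> 0"
proof -
  have "convex_cone {x. l x \<ge> 0}"
    unfolding convex_cone_iff using assms(1) by (simp add: linear_0 linear_add linear_scale)
  then have "convex_cone hull S \<subseteq> {x. l x \<ge> 0}" using assms(2) by (intro hull_minimal) auto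
  then show ?thesis using assms(3) by blast
qed

locale unimodular_fan_lattice =
  fixes \<Lambda> :: "'a::euclidean_space set" and \<Delta> :: "'a set set"
  assumes unimodular: "unimodular_fan \<Lambda> \<Delta>" and full: "full_lattice \<Lambda>"
begin

lemma fan: "fan \<Lambda> \<Delta>"
  using unimodular by (simp add: unimodular_fan_def)

text \<open>Rescaled generators give the same cone; requiring that they extend to a lattice basis
  leaves one generating set per cone (\<open>cone_eq_iff\<close>).\<close>

definition complex :: "'a set set" where
  "complex = {S. (\<exists>B. lattice_basis \<Lambda> B \<and> S \<subseteq> B) \<and> convex_cone hull S \<in> \<Delta>}"

lemma complex_independent: "S \<in> complex \<Longrightarrow> independent S"
  unfolding complex_def lattice_basis_def by (auto dest: independent_mono)

lemma complex_finite: "S \<in> complex \<Longrightarrow> finite S"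
  by (rule finiteI_independent[OF complex_independent])

text \<open>Inclusion makes the smaller cone a face of the larger one. A generator b in
  \<open>T\<close> is a positive combination of elements of \<open>S\<close>, which then lie in this
  face, and independence of \<open>T\<close> makes each of them a multiple of b. Both vectors being
  primitive, the factor is 1.\<close>

lemma cone_mono_iff:
  assumes S: "S \<in> complex" and T: "T \<in> complex"
  shows "convex_cone hull T \<subseteq> convex_cone hull S \<longleftrightarrow> T \<subseteq> S"
proof
  assume sub: "convex_cone hull T \<subseteq> convex_cone hull S"
  have finS: "finite S" and finT: "finite T" using S T complex_finite by auto
  have face: "convex_cone hull T face_of convex_cone hull S"
  proof -
    have "convex_cone hull T \<in> \<Delta>" "convex_cone hull S \<in> \<Delta>" using S T by (auto simp: complex_def)
    then have "convex_cone hull T \<inter> convex_cone hull S face_of convex_cone hull S"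
      using fan unfolding fan_def by blast
    then show ?thesis using sub by (simp add: Int_absorb2)
  qed
  show "T \<subseteq> S"
  proof
    fix b assume b: "b \<in> T"
    have b0: "b \<noteq> 0" using complex_independent[OF T] b dependent_zero by blast
    have "b \<in> convex_cone hull S" using b sub by (auto intro: hull_inc)
    then obtain S' where S': "S' \<subseteq> S" "positive_combination S' b"
      using positive_combination_ex[OF finS] by blast
    obtain a where a: "\<forall>s\<in>S'. a s > 0" "b = (\<Sum>s\<in>S'. a s *\<^sub>R s)"
      using S'(2) by (auto simp: positive_combination_def)
    have finS': "finite S'" using S' finS finite_subset by blast
    have "convex_cone hull S' \<subseteq> convex_cone hull T"
      by (rule positive_combination_face[OF finS' S'(2) _ convex_cone_convex_cone_hull face])
        (use b hull_mono[OF S'(1), of convex_cone] in \<open>simp_all add: hull_inc\<close>)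
    then have "\<forall>s\<in>S'. \<exists>e. (\<forall>t\<in>T. e t \<ge> 0) \<and> s = (\<Sum>t\<in>T. e t *\<^sub>R t)"
      using convex_cone_hull_finite[OF finT] by (metis hull_inc subsetD)
    then obtain e where e: "\<And>s. s \<in> S' \<Longrightarrow> (\<forall>t\<in>T. e s t \<ge> 0) \<and> s = (\<Sum>t\<in>T. e s t *\<^sub>R t)"
      by metis
    have "(\<Sum>t\<in>T. (if t = b then 1 else 0) *\<^sub>R t) = b"
      using b finT by (simp add: if_distrib[of "\<lambda>r. r *\<^sub>R _"] sum.delta cong: if_cong)
    also have "b = (\<Sum>s\<in>S'. a s *\<^sub>R (\<Sum>t\<in>T. e s t *\<^sub>R t))"
      unfolding a(2) using e by (intro sum.cong refl) auto
    also have "\<dots> = (\<Sum>t\<in>T. (\<Sum>s\<in>S'. a s * e s t) *\<^sub>R t)"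
      by (simp add: scaleR_sum_right scaleR_sum_left sum.swap[of _ T])
    finally have eq: "(\<Sum>t\<in>T. (if t = b then 1 else 0) *\<^sub>R t) = (\<Sum>t\<in>T. (\<Sum>s\<in>S'. a s * e s t) *\<^sub>R t)" .
    obtain s where s: "s \<in> S'" using a(2) b0 by fastforce
    have es0: "e s t = 0" if t: "t \<in> T" "t \<noteq> b" for t
    proof -
      have "(\<Sum>s\<in>S'. a s * e s t) = 0"
        using independent_finite_sum_eq[OF complex_independent[OF T] eq t(1)] t(2) by simp
      then have "\<forall>s\<in>S'. a s * e s t = 0"
        using finS' a(1) e t(1) by (subst (asm) sum_nonneg_eq_0_iff) (auto intro: mult_nonneg_nonneg less_imp_le)
      then show ?thesis using s a(1) by force
    qed
    have sb: "s = e s b *\<^sub>R b"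
    proof -
      have "s = (\<Sum>t\<in>T. e s t *\<^sub>R t)" using e[OF s] by blast
      also have "\<dots> = (\<Sum>t\<in>{b}. e s t *\<^sub>R t)"
        using finT b es0 by (intro sum.mono_neutral_right) auto
      finally show ?thesis by simp
    qed
    have sS: "s \<in> S" using s S' by auto
    have s0: "s \<noteq> 0" using complex_independent[OF S] sS dependent_zero by blast
    obtain B where B: "lattice_basis \<Lambda> B" "S \<subseteq> B" using S by (auto simp: complex_def)
    obtain B' where B': "lattice_basis \<Lambda> B'" "T \<subseteq> B'" using T by (auto simp: complex_def)
    have "b \<in> B'" "s \<in> B" using B B' b sS by auto
    \<comment> \<open>Integral functionals with value 1 at b and at s show that the factor
      \<open>e s b\<close> and its inverse are integers.\<close>
    obtain h :: "'a \<Rightarrow> real" where h: "linear h" "h b = 1" "\<forall>x\<in>\<Lambda>. h x \<in> \<int>"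
      using lattice_basis_functional[OF B'(1) \<open>b \<in> B'\<close>] by blast
    obtain h' :: "'a \<Rightarrow> real" where h': "linear h'" "h' s = 1" "\<forall>x\<in>\<Lambda>. h' x \<in> \<int>"
      using lattice_basis_functional[OF B(1) \<open>s \<in> B\<close>] by blast
    have "s \<in> \<Lambda>" "b \<in> \<Lambda>" using lattice_basis_subset B B' sS b by blast+
    have "h s = e s b * h b" by (subst sb) (simp add: linear_scale[OF h(1)])
    then have "e s b = h s" using h(2) by simp
    then have "e s b \<in> \<int>" using h(3) \<open>s \<in> \<Lambda>\<close> by simp
    moreover have "h' s = e s b * h' b" by (subst sb) (simp add: linear_scale[OF h'(1)])
    ultimately obtain i j :: int where ij: "e s b = of_int i" "1 = e s b * of_int j"
      using h'(2,3) \<open>b \<in> \<Lambda>\<close> by (metis Ints_cases)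
    then have "i * j = 1" by (metis of_int_eq_1_iff of_int_mult)
    moreover have "i \<ge> 0" using e[OF s] b ij by auto
    ultimately have "i = 1" by (metis pos_zmult_eq_1_iff mult_zero_left order_le_less zero_neq_one)
    then show "b \<in> S" using sb ij sS by simp
  qed
qed (rule hull_mono)

lemma cone_eq_iff:
  assumes "S \<in> complex" "T \<in> complex"
  shows "convex_cone hull T = convex_cone hull S \<longleftrightarrow> T = S"
  using cone_mono_iff[OF assms] cone_mono_iff[OF assms(2,1)] unfolding set_eq_subset by simp

lemma complex_subset:
  assumes "S \<in> complex" "T \<subseteq> S" shows "T \<in> complex"
proof -
  have "convex_cone hull T face_of convex_cone hull S"
    by (rule face_of_convex_cone_hull_independent[OF complex_independent[OF assms(1)] assms(2)])
  moreover have "convex_cone hull T \<noteq> {}" by (rule convex_cone_hull_nonempty)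
  ultimately have "convex_cone hull T \<in> \<Delta>"
    using fan assms(1) unfolding fan_def complex_def by blast
  then show ?thesis using assms by (auto simp: complex_def)
qed

lemma finite_complex': "finite complex"
proof (rule finite_imageD)
  show "finite ((hull) convex_cone ` complex)"
    using fan by (auto simp: fan_def complex_def intro: finite_subset[of _ \<Delta>])
  show "inj_on ((hull) convex_cone) complex" using cone_eq_iff by (auto simp: inj_on_def)
qed

sublocale unimodular_complex \<Lambda> complex
proof
  show "finite complex" by (rule finite_complex')
  show "T \<in> complex" if "S \<in> complex" "T \<subseteq> S" for S T using that by (rule complex_subset)
  show "\<exists>B. lattice_basis \<Lambda> B \<and> S \<subseteq> B" if "S \<in> complex" for S using that by (simp add: complex_def)
  show "full_lattice \<Lambda>" by (rule full)
qed

lemma cone_ex: "\<sigma> \<in> \<Delta> \<Longrightarrow> \<exists>S\<in>complex. \<sigma> = convex_cone hull S"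
  using unimodular unfolding unimodular_fan_def complex_def by (metis (mono_tags, lifting) mem_Collect_eq)

lemma cone_in_fan: "S \<in> complex \<Longrightarrow> convex_cone hull S \<in> \<Delta>"
  by (simp add: complex_def)

lemma dim_cone: "S \<in> complex \<Longrightarrow> dim (convex_cone hull S) = card S"
proof -
  assume "S \<in> complex"
  then have "card S = dim S" by (simp add: complex_independent dim_eq_card_independent)
  also have "\<dots> = dim (span (convex_cone hull S))" unfolding span_convex_cone_hull by (rule dim_span[symmetric])
  finally show ?thesis by (simp only: dim_span)
qed

lemma cone_Int:
  assumes S: "S \<in> complex" and T: "T \<in> complex"
  shows "convex_cone hull S \<inter> convex_cone hull T = convex_cone hull (S \<inter> T)"
proof
  have "convex_cone hull S \<inter> convex_cone hull T face_of convex_cone hull S"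
    using fan S T unfolding fan_def complex_def by blast
  moreover have "0 \<in> convex_cone hull S \<inter> convex_cone hull T" by (simp add: convex_cone_hull_contains_0)
  ultimately have "convex_cone hull S \<inter> convex_cone hull T \<in> \<Delta>"
    using fan S unfolding fan_def complex_def by blast
  then obtain U where U: "U \<in> complex" "convex_cone hull S \<inter> convex_cone hull T = convex_cone hull U"
    using cone_ex by blast
  then have "U \<subseteq> S \<inter> T" using cone_mono_iff S T by blast
  then show "convex_cone hull S \<inter> convex_cone hull T \<subseteq> convex_cone hull (S \<inter> T)"
    unfolding U(2) by (rule hull_mono)
  show "convex_cone hull (S \<inter> T) \<subseteq> convex_cone hull S \<inter> convex_cone hull T"
    by (simp add: hull_mono)
qed

section \<open>Sums over cones and the map \<open>kappa\<close>, expressed in the complex\<close>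

lemma codim_cones_eq:
  "codim_cones \<Delta> k = (\<lambda>S. convex_cone hull S) ` {S \<in> complex. card S + k = DIM('a)}"
proof (intro equalityI subsetI)
  fix \<sigma> assume *: "\<sigma> \<in> codim_cones \<Delta> k"
  then obtain S where "S \<in> complex" "\<sigma> = convex_cone hull S" using cone_ex by (auto simp: codim_cones_def)
  then show "\<sigma> \<in> (\<lambda>S. convex_cone hull S) ` {S \<in> complex. card S + k = DIM('a)}"
    using * dim_cone by (auto simp: codim_cones_def)
next
  fix \<sigma> assume "\<sigma> \<in> (\<lambda>S. convex_cone hull S) ` {S \<in> complex. card S + k = DIM('a)}"
  then show "\<sigma> \<in> codim_cones \<Delta> k" using dim_cone cone_in_fan by (auto simp: codim_cones_def)
qed

lemma sum_codim_cones_link: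
  assumes T: "T \<in> complex" "Suc (card T) + k = DIM('a)"
  shows "(\<Sum>\<sigma> | \<sigma> \<in> codim_cones \<Delta> k \<and> convex_cone hull T \<subseteq> \<sigma>. g \<sigma>) =
         (\<Sum>b\<in>link T. g (convex_cone hull (insert b T)))"
proof (rule sum.reindex_cong[of "\<lambda>b. convex_cone hull (insert b T)"])
  show "inj_on (\<lambda>b. convex_cone hull (insert b T)) (link T)"
  proof (rule inj_onI)
    fix b b' assume *: "b \<in> link T" "b' \<in> link T" "convex_cone hull (insert b T) = convex_cone hull (insert b' T)"
    then have "insert b T = insert b' T"
      using cone_eq_iff[of "insert b' T" "insert b T"] by (simp add: link_def)
    then have "b \<in> insert b' T" by blast
    then show "b = b'" using * by (simp add: link_def)
  qed
  show "{\<sigma>. \<sigma> \<in> codim_cones \<Delta> k \<and> convex_cone hull T \<subseteq> \<sigma>} = (\<lambda>b. convex_cone hull (insert b T)) ` link T"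
  proof (intro equalityI subsetI)
    fix \<sigma> assume "\<sigma> \<in> {\<sigma>. \<sigma> \<in> codim_cones \<Delta> k \<and> convex_cone hull T \<subseteq> \<sigma>}"
    then obtain S where S: "S \<in> complex" "card S + k = DIM('a)" "\<sigma> = convex_cone hull S" "T \<subseteq> S"
      unfolding codim_cones_eq by (auto simp: cone_mono_iff[OF _ T(1)])
    have "card (S - T) = 1"
      using S T complex_finite by (simp add: card_Diff_subset finite_subset)
    then obtain b where "S - T = {b}" by (auto simp: card_1_singleton_iff)
    then have "S = insert b T" "b \<notin> T" using S(4) by auto
    then show "\<sigma> \<in> (\<lambda>b. convex_cone hull (insert b T)) ` link T" using S by (auto simp: link_def)
  next
    fix \<sigma> assume "\<sigma> \<in> (\<lambda>b. convex_cone hull (insert b T)) ` link T"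
    then obtain b where b: "b \<notin> T" "insert b T \<in> complex" "\<sigma> = convex_cone hull (insert b T)"
      by (auto simp: link_def)
    then show "\<sigma> \<in> {\<sigma>. \<sigma> \<in> codim_cones \<Delta> k \<and> convex_cone hull T \<subseteq> \<sigma>}"
      using T complex_finite[OF T(1)] hull_mono[of T "insert b T" convex_cone]
      unfolding codim_cones_eq by auto
  qed
qed auto

text \<open>h is the coordinate of b in a lattice basis containing
  \<open>insert b T\<close>.\<close>

lemma link_functional:
  assumes b: "b \<in> link T"
  shows "\<exists>h :: 'a \<Rightarrow> real. linear h \<and> h b = 1 \<and> (\<forall>x\<in>span T. h x = 0) \<and> (\<forall>x\<in>\<Lambda>. h x \<in> \<int>) \<and>
    (\<forall>x\<in>convex_cone hull (insert b T). h x \<ge> 0) \<and>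
    (\<forall>x\<in>span (insert b T). x - h x *\<^sub>R b \<in> span T)"
proof -
  have bT: "b \<notin> T" "insert b T \<in> complex" using b by (auto simp: link_def)
  obtain B where B: "lattice_basis \<Lambda> B" "insert b T \<subseteq> B" using bT(2) by (auto simp: complex_def)
  have "b \<in> B" using B(2) by simp
  then obtain h :: "'a \<Rightarrow> real" where h: "linear h" "h b = 1" "\<forall>x\<in>B - {b}. h x = 0" "\<forall>x\<in>\<Lambda>. h x \<in> \<int>"
    using lattice_basis_functional[OF B(1)] by blast
  have h0: "h x = 0" if "x \<in> span T" for x
    using linear_eq_0_on_span[OF h(1) _ that] h(3) B(2) bT(1) by blast
  have hpos: "h x \<ge> 0" if x: "x \<in> convex_cone hull (insert b T)" for x
  proof -
    have fin: "finite (insert b T)" by (rule complex_finite[OF bT(2)])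
    obtain a where a: "\<forall>t\<in>insert b T. a t \<ge> 0" "x = (\<Sum>t\<in>insert b T. a t *\<^sub>R t)"
      using x convex_cone_hull_finite[OF fin] by blast
    have "h t \<ge> 0" if "t \<in> insert b T" for t
      using that h(2) h0[of t] span_base[of t T] by auto
    then show ?thesis
      unfolding a(2) using a(1)
      by (simp only: linear_sum[OF h(1)] linear_scale[OF h(1)]) (auto intro!: sum_nonneg mult_nonneg_nonneg)
  qed
  have "x - h x *\<^sub>R b \<in> span T" if x: "x \<in> span (insert b T)" for x
  proof -
    obtain k where k: "x - k *\<^sub>R b \<in> span T" using x by (auto simp: span_insert)
    have "h (x - k *\<^sub>R b) = 0" by (rule h0[OF k])
    then have "h x = k" using h(2) by (simp add: linear_diff[OF h(1)] linear_scale[OF h(1)])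
    then show ?thesis using k by simp
  qed
  then show ?thesis using h h0 hpos by (intro exI[of _ h]) blast
qed

lemma represents_normal_link:
  assumes b: "b \<in> link T"
  shows "represents_normal \<Lambda> (convex_cone hull (insert b T)) (convex_cone hull T) b"
proof -
  obtain h :: "'a \<Rightarrow> real" where h: "linear h" "h b = 1" "\<forall>x\<in>span T. h x = 0" "\<forall>x\<in>\<Lambda>. h x \<in> \<int>"
    "\<forall>x\<in>convex_cone hull (insert b T). h x \<ge> 0"
    "\<forall>x\<in>span (insert b T). x - h x *\<^sub>R b \<in> span T"
    using link_functional[OF b] by blast
  have bL: "b \<in> \<Lambda>" using b subset_lattice by (auto simp: link_def)
  have "b + 0 \<in> convex_cone hull (insert b T) + span T"
    by (intro set_plus_intro hull_inc span_zero) simp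
  moreover have "b \<notin> span T" using h by force
  moreover have "j = 1" if w: "w \<in> \<Lambda>" "b - real j *\<^sub>R w \<in> sublattice \<Lambda> (convex_cone hull T)" for w and j :: nat
  proof -
    have "h (b - real j *\<^sub>R w) = 0" using w(2) h(3) by (simp add: sublattice_def)
    then have "1 = real j * h w" using h(2) by (simp add: linear_diff[OF h(1)] linear_scale[OF h(1)])
    moreover obtain i where "h w = of_int i" using h(4) w(1) by (auto elim: Ints_cases)
    ultimately have "int j * i = 1" by (metis of_int_eq_1_iff of_int_mult of_int_of_nat_eq)
    then show "j = 1" by (simp add: zmult_eq_1_iff)
  qed
  ultimately show ?thesis using bL by (simp add: represents_normal_def)
qed

lemma normal_vector_link:
  assumes b: "b \<in> link T"
  shows "normal_vector \<Lambda> (convex_cone hull (insert b T)) (convex_cone hull T) - b \<in> span T"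
proof -
  obtain h :: "'a \<Rightarrow> real" where h: "linear h" "h b = 1" "\<forall>x\<in>span T. h x = 0" "\<forall>x\<in>\<Lambda>. h x \<in> \<int>"
    "\<forall>x\<in>convex_cone hull (insert b T). h x \<ge> 0"
    "\<forall>x\<in>span (insert b T). x - h x *\<^sub>R b \<in> span T"
    using link_functional[OF b] by blast
  have "normal_vector \<Lambda> (convex_cone hull (insert b T)) (convex_cone hull T) - b
      \<in> sublattice \<Lambda> (convex_cone hull T)"
    by (rule normal_vector_eq[OF subgroup represents_normal_link[OF b] _ h(1,2)])
      (use h(3-6) hull_mono[of T "insert b T" convex_cone] in auto)
  then show ?thesis by (simp add: sublattice_def)
qed

text \<open>If l took both signs on generators, some positive combination x of b and b' would have l
  x = 0. Linearity would give min(0, l) the value l b' * l b at x, which is not 0.\<close>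

lemma linear_on_cones_sign:
  assumes l: "linear l" and lin: "linear_on_cones \<Delta> (\<lambda>x. min 0 (l x))" and S: "S \<in> complex"
  shows "(\<forall>b\<in>S. l b \<ge> 0) \<or> (\<forall>b\<in>S. l b \<le> 0)"
proof (rule ccontr)
  assume "\<not> ?thesis"
  then obtain b b' where b: "b \<in> S" "l b < 0" "b' \<in> S" "l b' > 0"
    by (auto simp: not_le)
  obtain g where g: "linear g" "\<forall>x\<in>convex_cone hull S. min 0 (l x) = g x"
    using lin cone_in_fan[OF S] by (auto simp: linear_on_cones_def)
  define x where "x = l b' *\<^sub>R b + (- l b) *\<^sub>R b'"
  have bc: "b \<in> convex_cone hull S" "b' \<in> convex_cone hull S" using b by (simp_all add: hull_inc)
  then have "x \<in> convex_cone hull S"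
    unfolding x_def using b by (intro convex_cone_hull_add convex_cone_hull_mul) auto
  note this bc
  then have gx: "g x = min 0 (l x)" "g b = min 0 (l b)" "g b' = min 0 (l b')" using g(2) by auto
  have "l x = 0" by (simp only: x_def linear_add[OF l] linear_scale[OF l]) simp
  moreover have "g x = l b' * g b + (- l b) * g b'"
    by (simp only: x_def linear_add[OF g(1)] linear_scale[OF g(1)]) simp
  ultimately have "l b' * l b = 0" using gx b by simp
  then show False using b by simp
qed

text \<open>min(0, l) = -max(0, -l), so the sign in \<open>kappa\<close> yields the divisor of -l.
  If l is nonzero somewhere on \<open>T\<close>, then min(0, l) is 0 or l on all cones around
  \<open>T\<close>, and balancing gives 0. If l vanishes on \<open>T\<close>, so does m; its sum is
  0 by balancing, and the generators with l b < 0 remain.\<close>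

lemma kappa_divisor:
  assumes T: "T \<in> complex" "Suc (card T) + k = DIM('a)"
    and l: "l \<in> dual_lattice \<Lambda>"
    and sgn: "\<And>S. S \<in> complex \<Longrightarrow> (\<forall>b\<in>S. l b \<ge> 0) \<or> (\<forall>b\<in>S. l b \<le> 0)"
    and bal: "balanced (Suc (card T)) (\<lambda>S. real_of_int (c (convex_cone hull S)))"
  shows "real_of_int (kappa \<Lambda> \<Delta> k c (\<lambda>x. min 0 (l x)) (convex_cone hull T)) =
         divisor (\<lambda>x. - l x) (\<lambda>S. real_of_int (c (convex_cone hull S))) T"
proof -
  define f where "f = (\<lambda>x. min 0 (l x))"
  define C where "C = (\<lambda>S. real_of_int (c (convex_cone hull S)))"
  have ll: "linear l" using l by (auto simp: dual_lattice_def)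
  have cone_sign: "\<forall>b\<in>S. l b \<ge> 0 \<Longrightarrow> x \<in> convex_cone hull S \<Longrightarrow> l x \<ge> 0"
    "\<forall>b\<in>S. l b \<le> 0 \<Longrightarrow> x \<in> convex_cone hull S \<Longrightarrow> l x \<le> 0" for S x
    using linear_nonneg_on_cone[OF ll] linear_nonneg_on_cone[OF linear_compose_neg[OF ll], of S x]
    by auto
  \<comment> \<open>The choice in \<open>integral_extension\<close> is realized: on each cone min(0,
    l) is either 0 or l, both integral.\<close>
  have ext: "integral_extension \<Lambda> f (convex_cone hull S) \<in> dual_lattice \<Lambda> \<and>
      (\<forall>x\<in>convex_cone hull S. integral_extension \<Lambda> f (convex_cone hull S) x = f x)"
    if S: "S \<in> complex" for S
  proof -
    have "(\<lambda>x. 0) \<in> dual_lattice \<Lambda>" by (simp add: dual_lattice_def linear_iff)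
    then have "\<exists>m. m \<in> dual_lattice \<Lambda> \<and> (\<forall>x\<in>convex_cone hull S. m x = f x)"
    proof (cases "\<forall>b\<in>S. l b \<ge> 0")
      case True
      then show ?thesis
        using \<open>(\<lambda>x. 0) \<in> dual_lattice \<Lambda>\<close> cone_sign(1)[of S]
        by (intro exI[of _ "\<lambda>x. 0"]) (simp add: f_def)
    next
      case False
      then show ?thesis
        using sgn[OF S] l cone_sign(2)[of S] by (intro exI[of _ l]) (auto simp: f_def)
    qed
    then show ?thesis unfolding integral_extension_def by (rule someI_ex)
  qed
  define m where "m = integral_extension \<Lambda> f (convex_cone hull T)"
  have m: "linear m" "\<And>x. x \<in> \<Lambda> \<Longrightarrow> m x \<in> \<int>" "\<And>x. x \<in> convex_cone hull T \<Longrightarrow> m x = f x"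
    using ext[OF T(1)] by (auto simp: m_def dual_lattice_def)
  have summand: "real_of_int \<lfloor>integral_extension \<Lambda> f (convex_cone hull (insert b T)) (normal_vector \<Lambda> (convex_cone hull (insert b T)) (convex_cone hull T))
       - m (normal_vector \<Lambda> (convex_cone hull (insert b T)) (convex_cone hull T))\<rfloor> = f b - m b"
    if b: "b \<in> link T" for b
  proof -
    define e where "e = integral_extension \<Lambda> f (convex_cone hull (insert b T))"
    define nv where "nv = normal_vector \<Lambda> (convex_cone hull (insert b T)) (convex_cone hull T)"
    have bT: "b \<notin> T" "insert b T \<in> complex" using b by (auto simp: link_def)
    have e: "linear e" "\<And>x. x \<in> \<Lambda> \<Longrightarrow> e x \<in> \<int>" "\<And>x. x \<in> convex_cone hull (insert b T) \<Longrightarrow> e x = f x"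
      using ext[OF bT(2)] by (auto simp: e_def dual_lattice_def)
    have bL: "b \<in> \<Lambda>" using subset_lattice[OF bT(2)] by auto
    have "e x - m x = 0" if "x \<in> span T" for x
    proof (rule linear_eq_0_on_span[OF linear_compose_sub[OF e(1) m(1)] _ that])
      fix x assume "x \<in> T"
      then have "x \<in> convex_cone hull T" "x \<in> convex_cone hull (insert b T)" by (auto intro: hull_inc)
      then show "e x - m x = 0" using e(3) m(3) by simp
    qed
    from this[OF normal_vector_link[OF b]] have "e nv - m nv = e b - m b"
      unfolding nv_def[symmetric] by (simp add: linear_diff[OF e(1)] linear_diff[OF m(1)])
    also have "e b = f b" by (intro e(3) hull_inc) simp
    finally have "e nv - m nv = f b - m b" .
    moreover have "f b - m b \<in> \<int>" using m(2)[OF bL] e(2)[OF bL] \<open>e b = f b\<close> by (metis Ints_diff)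
    ultimately show ?thesis unfolding e_def[symmetric] nv_def[symmetric] by (auto elim: Ints_cases)
  qed
  have "real_of_int (kappa \<Lambda> \<Delta> k c f (convex_cone hull T)) =
     - (\<Sum>b\<in>link T. (f b - m b) * C (insert b T))"
  proof -
    have "convex_cone hull T \<in> codim_cones \<Delta> (k + 1)" using T by (auto simp: codim_cones_eq)
    then have "real_of_int (kappa \<Lambda> \<Delta> k c f (convex_cone hull T)) =
      - (\<Sum>b\<in>link T. real_of_int \<lfloor>integral_extension \<Lambda> f (convex_cone hull (insert b T)) (normal_vector \<Lambda> (convex_cone hull (insert b T)) (convex_cone hull T))
       - m (normal_vector \<Lambda> (convex_cone hull (insert b T)) (convex_cone hull T))\<rfloor> * C (insert b T))"
      unfolding kappa_def sum_codim_cones_link[OF T] m_def C_def by simp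
    also have "(\<Sum>b\<in>link T. real_of_int \<lfloor>integral_extension \<Lambda> f (convex_cone hull (insert b T)) (normal_vector \<Lambda> (convex_cone hull (insert b T)) (convex_cone hull T))
       - m (normal_vector \<Lambda> (convex_cone hull (insert b T)) (convex_cone hull T))\<rfloor> * C (insert b T)) =
       (\<Sum>b\<in>link T. (f b - m b) * C (insert b T))"
      by (intro sum.cong refl) (simp only: summand)
    finally show ?thesis .
  qed
  also have "\<dots> = (\<Sum>b\<in>link T. C (insert b T) * m b) - (\<Sum>b\<in>link T. C (insert b T) * f b)"
    by (simp add: right_diff_distrib sum_subtractf mult.commute[of _ "C _"])
  also have "\<dots> = divisor (\<lambda>x. - l x) C T"
  proof -
    have fT: "m b = f b" if "b \<in> T" for b using m(3) that by (simp add: hull_inc)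
    consider (pos) "\<exists>x\<in>T. l x > 0" | (neg) "\<exists>x\<in>T. l x < 0" | (zero) "\<forall>x\<in>T. l x = 0"
      by (metis linorder_neqE_linordered_idom)
    then show ?thesis
    proof cases
      case pos
      have nn: "\<forall>x\<in>insert b T. l x \<ge> 0" if "b \<in> link T" for b
        using sgn[of "insert b T"] that pos unfolding link_def by force
      have nnT: "\<forall>x\<in>T. l x \<ge> 0" using sgn[OF T(1)] pos by force
      have "(\<Sum>b\<in>link T. C (insert b T) * m b) = 0"
        using fT nnT by (intro balanced_linear[OF bal[folded C_def] T(1) _ m(1)]) (auto simp: f_def)
      moreover have "(\<Sum>b\<in>link T. C (insert b T) * f b) = 0"
        using nn by (intro sum.neutral) (auto simp: f_def)
      moreover have "divisor (\<lambda>x. - l x) C T = 0" using pos by (auto simp: divisor_def)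
      ultimately show ?thesis by simp
    next
      case neg
      have nn: "\<forall>x\<in>insert b T. l x \<le> 0" if "b \<in> link T" for b
        using sgn[of "insert b T"] that neg unfolding link_def by force
      have nnT: "\<forall>x\<in>T. l x \<le> 0" using sgn[OF T(1)] neg by force
      have "(\<Sum>b\<in>link T. C (insert b T) * (m b - l b)) = 0"
        using fT nnT by (intro balanced_linear[OF bal[folded C_def] T(1) _ linear_compose_sub[OF m(1) ll]])
          (auto simp: f_def)
      moreover have "(\<Sum>b\<in>link T. C (insert b T) * f b) = (\<Sum>b\<in>link T. C (insert b T) * l b)"
        using nn by (intro sum.cong) (auto simp: f_def)
      moreover have "divisor (\<lambda>x. - l x) C T = 0" using neg by (auto simp: divisor_def)
      ultimately show ?thesis by (simp add: right_diff_distrib sum_subtractf)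
    next
      case zero
      have "(\<Sum>b\<in>link T. C (insert b T) * m b) = 0"
        using fT zero by (intro balanced_linear[OF bal[folded C_def] T(1) _ m(1)]) (auto simp: f_def)
      moreover have "(\<Sum>b\<in>link T. C (insert b T) * f b) =
          (\<Sum>b | b \<in> link T \<and> - l b > 0. C (insert b T) * l b)"
        by (intro sum.mono_neutral_cong_right) (auto simp: f_def)
      ultimately show ?thesis using zero by (simp add: divisor_def sum_negf mult.commute)
    qed
  qed
  finally show ?thesis unfolding f_def C_def .
qed

end

section \<open>Refinements of a product fan\<close>

text \<open>A proper face has smaller affine dimension, which is the linear dimension for sets
  containing 0.\<close>

lemma face_of_cone_dim_eq:
  fixes P :: "'a::euclidean_space set"
  assumes "convex_cone P" "F face_of P" "F \<noteq> {}" "dim P \<le> dim F"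
  shows "F = P"
proof (rule ccontr)
  assume "F \<noteq> P"
  have "convex P" using assms(1) by (simp add: convex_cone_def)
  then have "aff_dim F < aff_dim P" using face_of_aff_dim_lt[OF _ assms(2) \<open>F \<noteq> P\<close>] by blast
  moreover have "0 \<in> F" "0 \<in> P"
    using face_of_convex_cone[OF assms(1,2,3)] assms(1) convex_cone_contains_0 by blast+
  ultimately show False using assms(4) by (simp add: aff_dim_zero hull_inc)
qed

lemma rel_interior_cone_move:
  fixes P :: "'a::euclidean_space set"
  assumes "convex_cone P" "z \<in> rel_interior P" "w \<in> span P"
  obtains e where "e > 0" "z + e *\<^sub>R w \<in> P"
proof -
  have P: "convex P" "0 \<in> P" using assms(1) convex_cone_contains_0 by (auto simp: convex_cone_def)
  have aff: "affine hull P = span P" using P(2) by (simp add: affine_hull_span_0 hull_inc)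
  have "z \<in> span P" using assms(2) rel_interior_subset span_superset by blast
  then have "z - w \<in> affine hull P" unfolding aff using assms(3) by (rule span_diff)
  \<comment> \<open>Prolong the segment from z - w beyond z.\<close>
  then obtain e where e: "e > 1" "(1 - e) *\<^sub>R (z - w) + e *\<^sub>R z \<in> P"
    using convex_rel_interior_if2[OF P(1) assms(2)] by blast
  have "(1 - e) *\<^sub>R (z - w) + e *\<^sub>R z = z + (e - 1) *\<^sub>R w" by (simp add: algebra_simps)
  then show ?thesis using that[of "e - 1"] e by simp
qed

lemma convex_segment_from:
  fixes P :: "'a::real_vector set"
  assumes "convex P" "z \<in> P" "z + e\<^sub>0 *\<^sub>R w \<in> P" "0 < e\<^sub>0" "0 \<le> e" "e \<le> e\<^sub>0"
  shows "z + e *\<^sub>R w \<in> P"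
proof -
  have "(1 - e / e\<^sub>0) *\<^sub>R z + (e / e\<^sub>0) *\<^sub>R (z + e\<^sub>0 *\<^sub>R w) \<in> P"
    using assms by (intro convexD) auto
  moreover have "(1 - e / e\<^sub>0) *\<^sub>R z + (e / e\<^sub>0) *\<^sub>R (z + e\<^sub>0 *\<^sub>R w) = z + e *\<^sub>R w"
    using assms(4) by (simp add: algebra_simps)
  ultimately show ?thesis by simp
qed

section \<open>Cones of a fan around a point\<close>

lemma fan_convex_cone: "fan N \<Delta> \<Longrightarrow> \<sigma> \<in> \<Delta> \<Longrightarrow> convex_cone \<sigma>"
  unfolding fan_def rational_cone_def using convex_cone_convex_cone_hull by metis

lemma fan_polyhedron:
  fixes N :: "'a::euclidean_space set" shows "fan N \<Delta> \<Longrightarrow> \<sigma> \<in> \<Delta> \<Longrightarrow> polyhedron \<sigma>"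
  unfolding fan_def rational_cone_def using polyhedron_convex_cone_hull by metis

lemma fan_Int_face: "fan N \<Delta> \<Longrightarrow> \<sigma> \<in> \<Delta> \<Longrightarrow> \<rho> \<in> \<Delta> \<Longrightarrow> \<sigma> \<inter> \<rho> face_of \<sigma>"
  by (simp add: fan_def)

lemma fan_Int_face': "fan N \<Delta> \<Longrightarrow> \<sigma> \<in> \<Delta> \<Longrightarrow> \<rho> \<in> \<Delta> \<Longrightarrow> \<rho> \<inter> \<sigma> face_of \<sigma>"
  by (simp add: fan_def)

lemma fan_face_in: "fan N \<Delta> \<Longrightarrow> \<sigma> \<in> \<Delta> \<Longrightarrow> \<rho> face_of \<sigma> \<Longrightarrow> \<rho> \<noteq> {} \<Longrightarrow> \<rho> \<in> \<Delta>"
  by (simp add: fan_def)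

text \<open>Take a cone of least dimension containing x. Its intersection with another cone through
  x is a face of it that belongs to the fan, so by minimality it is the whole cone. If x were on the
  relative boundary, a facet through x would contradict this.\<close>

lemma fan_carrier_cone:
  fixes N :: "'a::euclidean_space set"
  assumes fan: "fan N \<Delta>" and x: "x \<in> \<Union>\<Delta>"
  obtains \<rho> where "\<rho> \<in> \<Delta>" "x \<in> rel_interior \<rho>" "\<And>\<sigma>. \<sigma> \<in> \<Delta> \<Longrightarrow> x \<in> \<sigma> \<Longrightarrow> \<rho> face_of \<sigma>"
proof -
  obtain \<rho> where \<rho>: "\<rho> \<in> \<Delta>" "x \<in> \<rho>" and least: "\<And>\<sigma>. \<sigma> \<in> \<Delta> \<Longrightarrow> x \<in> \<sigma> \<Longrightarrow> dim \<rho> \<le> dim \<sigma>"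
  proof -
    define D where "D = {\<sigma> \<in> \<Delta>. x \<in> \<sigma>}"
    have "D \<noteq> {}" using x by (auto simp: D_def)
    then have "\<exists>\<rho>. \<rho> \<in> D \<and> (\<forall>\<sigma>. \<sigma> \<in> D \<longrightarrow> dim \<rho> \<le> dim \<sigma>)"
      using ex_has_least_nat[of "\<lambda>\<sigma>. \<sigma> \<in> D"] by blast
    then show ?thesis using that by (auto simp: D_def)
  qed
  have face: "\<rho> face_of \<sigma>" if \<sigma>: "\<sigma> \<in> \<Delta>" "x \<in> \<sigma>" for \<sigma>
  proof -
    have ne: "\<rho> \<inter> \<sigma> \<noteq> {}" using \<rho> \<sigma> by blast
    have f: "\<rho> \<inter> \<sigma> face_of \<rho>" using fan_Int_face[OF fan \<rho>(1) \<sigma>(1)] .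
    then have "\<rho> \<inter> \<sigma> \<in> \<Delta>" using fan_face_in[OF fan \<rho>(1)] ne by blast
    then have "dim \<rho> \<le> dim (\<rho> \<inter> \<sigma>)" using least \<rho> \<sigma> by blast
    then have "\<rho> \<inter> \<sigma> = \<rho>" by (rule face_of_cone_dim_eq[OF fan_convex_cone[OF fan \<rho>(1)] f ne])
    then show ?thesis using fan_Int_face'[OF fan \<sigma>(1) \<rho>(1)] by simp
  qed
  have "x \<in> rel_interior \<rho>"
  proof (rule ccontr)
    assume "x \<notin> rel_interior \<rho>"
    then obtain F where F: "F facet_of \<rho>" "x \<in> F"
      using rel_boundary_of_polyhedron[OF fan_polyhedron[OF fan \<rho>(1)]] \<rho>(2) by blast
    then have Ff: "F face_of \<rho>" "F \<noteq> \<rho>" by (auto simp: facet_of_def)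
    have "F \<in> \<Delta>" using fan_face_in[OF fan \<rho>(1) Ff(1)] F(2) by blast
    then have "\<rho> \<subseteq> F" using face F(2) face_of_imp_subset by blast
    then show False using Ff face_of_imp_subset by blast
  qed
  then show ?thesis using that \<rho>(1) face by blast
qed

lemma span_Times_0:
  assumes "0 \<in> S" "0 \<in> T"
  shows "span (S \<times> T) = span S \<times> span T"
proof
  show "span (S \<times> T) \<subseteq> span S \<times> span T"
    by (intro span_minimal subspace_Times subspace_span) (auto intro: span_base)
  have l1: "linear (\<lambda>x. (x, 0))" and l2: "linear (\<lambda>y. (0, y))" by (simp_all add: linear_iff)
  have 1: "(x, 0) \<in> span (S \<times> T)" if "x \<in> span S" for x
  proof -
    have "(x, 0) \<in> span ((\<lambda>x. (x, 0)) ` S)" using linear_span_image[OF l1, of S] that by blast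
    then show ?thesis using span_mono[of "(\<lambda>x. (x, 0)) ` S" "S \<times> T"] assms by blast
  qed
  have 2: "(0, y) \<in> span (S \<times> T)" if "y \<in> span T" for y
  proof -
    have "(0, y) \<in> span ((\<lambda>y. (0, y)) ` T)" using linear_span_image[OF l2, of T] that by blast
    then show ?thesis using span_mono[of "(\<lambda>y. (0, y)) ` T" "S \<times> T"] assms by blast
  qed
  show "span S \<times> span T \<subseteq> span (S \<times> T)"
  proof clarify
    fix x y assume "x \<in> span S" "y \<in> span T"
    then have "(x, 0) + (0, y) \<in> span (S \<times> T)" by (intro span_add 1 2)
    then show "(x, y) \<in> span (S \<times> T)" by simp
  qed
qed

lemma dim_Times_0:
  fixes S :: "'a::euclidean_space set" and T :: "'b::euclidean_space set"
  assumes "0 \<in> S" "0 \<in> T"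
  shows "dim (S \<times> T) = dim S + dim T"
proof -
  have "dim (S \<times> T) = dim (span S \<times> span T)" using span_Times_0[OF assms] by (metis dim_span)
  then show ?thesis by (simp add: dim_Times)
qed

locale refined_square =
  fixes N :: "'a::euclidean_space set" and \<Delta> :: "'a set set" and \<Delta>' :: "('a \<times> 'a) set set"
  assumes full_N: "full_lattice N" and complete: "complete_fan N \<Delta>"
    and unimodular': "unimodular_fan (N \<times> N) \<Delta>'"
    and refines: "fan_refines \<Delta>' (product_fan \<Delta> \<Delta>)"
begin

lemma fan_N: "fan N \<Delta>" and Union_N: "\<Union>\<Delta> = UNIV"
  using complete by (auto simp: complete_fan_def)

sublocale unimodular_fan_lattice "N \<times> N" \<Delta>'
proof
  show "unimodular_fan (N \<times> N) \<Delta>'" by (rule unimodular')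
  then show "full_lattice (N \<times> N)"
    unfolding unimodular_fan_def fan_def full_lattice_def by (metis ex_in_conv)
qed

lemma product_cone:
  assumes "P \<in> product_fan \<Delta> \<Delta>"
  shows "convex_cone P" "0 \<in> P" "convex P"
proof -
  obtain a b where "P = a \<times> b" "a \<in> \<Delta>" "b \<in> \<Delta>" using assms by (auto simp: product_fan_def)
  then show *: "convex_cone P" using convex_cone_Times fan_convex_cone[OF fan_N] by blast
  show "0 \<in> P" by (rule convex_cone_contains_0[OF *])
  show "convex P" using * by (simp add: convex_cone_def)
qed

lemma product_Int_face:
  assumes "P \<in> product_fan \<Delta> \<Delta>" "Q \<in> product_fan \<Delta> \<Delta>"
  shows "P \<inter> Q face_of P"
proof -
  obtain a b c d where *: "P = a \<times> b" "Q = c \<times> d" "a \<in> \<Delta>" "b \<in> \<Delta>" "c \<in> \<Delta>" "d \<in> \<Delta>"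
    using assms by (auto simp: product_fan_def)
  have "(a \<inter> c) \<times> (b \<inter> d) face_of a \<times> b"
    by (intro face_of_Times fan_Int_face[OF fan_N] *)
  then show ?thesis unfolding * by (simp add: Times_Int_Times)
qed

lemma cone_in_product: "S \<in> complex \<Longrightarrow> \<exists>P\<in>product_fan \<Delta> \<Delta>. convex_cone hull S \<subseteq> P"
  using refines cone_in_fan[of S] by (simp add: fan_refines_def)

lemma point_in_cone: "\<exists>T\<in>complex. positive_combination T z"
proof -
  have "\<Union>(product_fan \<Delta> \<Delta>) = UNIV"
  proof -
    have "(x, y) \<in> \<Union>(product_fan \<Delta> \<Delta>)" for x y
    proof -
      obtain a b where "a \<in> \<Delta>" "b \<in> \<Delta>" "x \<in> a" "y \<in> b" using Union_N by (metis UNIV_I UnionE)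
      then have "a \<times> b \<in> product_fan \<Delta> \<Delta>" "(x, y) \<in> a \<times> b" by (auto simp: product_fan_def)
      then show ?thesis by (rule UnionI)
    qed
    then show ?thesis by auto
  qed
  then have "\<Union>\<Delta>' = UNIV" using refines by (simp add: fan_refines_def)
  then obtain \<sigma> where "\<sigma> \<in> \<Delta>'" "z \<in> \<sigma>" by blast
  then obtain S where S: "S \<in> complex" "z \<in> convex_cone hull S" using cone_ex by blast
  obtain T where "T \<subseteq> S" "positive_combination T z"
    using positive_combination_ex[OF complex_finite[OF S(1)] S(2)] by blast
  then show ?thesis using complex_subset[OF S(1)] by blast
qed

text \<open>Intersections of product cones are faces, so \<open>P\<close> meets a product cone
  containing the cone over \<open>T\<close> in a face; this face contains an interior point of the
  cone over \<open>T\<close>, hence all of it.\<close>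

lemma cone_subset_product:
  assumes T: "T \<in> complex" and z: "positive_combination T z" "z \<in> P" and P: "P \<in> product_fan \<Delta> \<Delta>"
  shows "convex_cone hull T \<subseteq> P"
proof -
  obtain Q where Q: "Q \<in> product_fan \<Delta> \<Delta>" "convex_cone hull T \<subseteq> Q"
    using cone_in_product[OF T] by blast
  have "z \<in> Q" using positive_combination_in_cone[OF complex_finite[OF T] z(1)] Q(2) by blast
  then have "convex_cone hull T \<subseteq> Q \<inter> P"
    using positive_combination_face[OF complex_finite[OF T] z(1) _ product_cone(1)[OF Q(1)]
        product_Int_face[OF Q(1) P] Q(2)] z(2) by blast
  then show ?thesis by blast
qed

lemma subset_complexI:
  assumes T: "T \<in> complex" and S: "S \<in> complex" and z: "positive_combination T z" "z \<in> convex_cone hull S"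
  shows "T \<subseteq> S"
proof -
  have "convex_cone hull T \<inter> convex_cone hull S face_of convex_cone hull T"
    by (rule fan_Int_face[OF fan cone_in_fan[OF T] cone_in_fan[OF S]])
  moreover have "z \<in> convex_cone hull T \<inter> convex_cone hull S"
    using positive_combination_in_cone[OF complex_finite[OF T] z(1)] z(2) by blast
  ultimately have "convex_cone hull T \<subseteq> convex_cone hull T \<inter> convex_cone hull S"
    using positive_combination_face[OF complex_finite[OF T] z(1) _ convex_cone_convex_cone_hull] by blast
  then show ?thesis using cone_mono_iff[OF S T] by blast
qed

lemma finite_fan': "finite \<Delta>'"
  using fan by (simp add: fan_def)

text \<open>The cones that miss z form a closed set, so a point close to z lies only in cones
  through z. Such a cone contains \<open>T\<close>, because z is interior to the cone over
  \<open>T\<close>.\<close>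

lemma local_cone:
  assumes T: "T \<in> complex" "positive_combination T z" and P: "P \<in> product_fan \<Delta> \<Delta>" "z \<in> P"
    and e0: "e\<^sub>0 > 0" "z + e\<^sub>0 *\<^sub>R w \<in> P"
  obtains e S where "e > 0" "S \<in> complex" "T \<subseteq> S" "convex_cone hull S \<subseteq> P"
    "positive_combination S (z + e *\<^sub>R w)"
proof -
  define U where "U = \<Union>{\<sigma> \<in> \<Delta>'. z \<notin> \<sigma>}"
  have "closed U" unfolding U_def
    using finite_fan' fan_polyhedron[OF fan] polyhedron_imp_closed by (intro closed_Union) auto
  moreover have "z \<notin> U" by (auto simp: U_def)
  ultimately obtain d where d: "d > 0" "ball z d \<inter> U = {}"
    using open_contains_ball[of "- U"] unfolding closed_def by blast
  \<comment> \<open>The second bound keeps the moved point within distance d of z; the summand 1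
    covers w = 0.\<close>
  define e where "e = min e\<^sub>0 (d / (2 * (norm w + 1)))"
  have n1: "norm w + 1 > 0" by (simp add: add_nonneg_pos)
  have e: "e > 0" "e \<le> e\<^sub>0" using e0 d n1 by (auto simp: e_def)
  have "norm (e *\<^sub>R w) < d"
  proof -
    have "norm (e *\<^sub>R w) \<le> d / (2 * (norm w + 1)) * norm w"
    proof -
      have "e * norm w \<le> d / (2 * (norm w + 1)) * norm w"
        by (rule mult_right_mono) (auto simp: e_def)
      then show ?thesis using e(1) by simp
    qed
    also have "\<dots> \<le> d / (2 * (norm w + 1)) * (norm w + 1)"
      using d n1 by (intro mult_left_mono) auto
    also have "\<dots> = d / 2" using n1 by (simp add: field_simps)
    finally show ?thesis using d by simp
  qed
  then have "z + e *\<^sub>R w \<in> ball z d" by (simp add: dist_norm)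
  then have nU: "z + e *\<^sub>R w \<notin> U" using d by blast
  obtain S where S: "S \<in> complex" "positive_combination S (z + e *\<^sub>R w)" using point_in_cone by blast
  have "z + e *\<^sub>R w \<in> convex_cone hull S"
    by (rule positive_combination_in_cone[OF complex_finite[OF S(1)] S(2)])
  then have "z \<in> convex_cone hull S" using nU cone_in_fan[OF S(1)] unfolding U_def by blast
  then have "T \<subseteq> S" by (rule subset_complexI[OF T(1) S(1) T(2)])
  moreover have "z + e *\<^sub>R w \<in> P"
    using e by (intro convex_segment_from[OF product_cone(3)[OF P(1)] P(2) e0(2,1)]) auto
  then have "convex_cone hull S \<subseteq> P" by (rule cone_subset_product[OF S _ P(1)])
  ultimately show ?thesis using that e(1) S by blast
qed

section \<open>The cones around \<open>T\<close> inside one product cone\<close>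

lemma card_le_dim: "S \<in> complex \<Longrightarrow> convex_cone hull S \<subseteq> P \<Longrightarrow> card S \<le> dim P"
  using dim_cone dim_subset by metis

text \<open>As \<open>P\<close> has only one dimension more than the cone over \<open>T\<close>, the
  nearby cone supplied by \<open>local_cone\<close> has exactly one further generator b, and w is a
  positive multiple of b modulo \<open>span T\<close>.\<close>

lemma link_direction:
  assumes T: "T \<in> complex" "positive_combination T z" and P: "P \<in> product_fan \<Delta> \<Delta>" "z \<in> P" "dim P = Suc (card T)"
    and e0: "e\<^sub>0 > 0" "z + e\<^sub>0 *\<^sub>R w \<in> P" and w: "w \<notin> span T"
  obtains b x where "b \<in> link T" "convex_cone hull (insert b T) \<subseteq> P" "x > 0" "w - x *\<^sub>R b \<in> span T"
proof -
  obtain e S where S: "e > 0" "S \<in> complex" "T \<subseteq> S" "convex_cone hull S \<subseteq> P"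
    "positive_combination S (z + e *\<^sub>R w)"
    using local_cone[OF T P(1,2) e0] by blast
  have zT: "z \<in> span T"
    using positive_combination_in_cone[OF complex_finite[OF T(1)] T(2)] convex_cone_hull_subset_span by blast
  have finS: "finite S" by (rule complex_finite[OF S(2)])
  have "S \<noteq> T"
  proof
    assume "S = T"
    then have "z + e *\<^sub>R w \<in> span T"
      using positive_combination_in_cone[OF finS S(5)] convex_cone_hull_subset_span by blast
    then have "(z + e *\<^sub>R w) - z \<in> span T" using zT by (rule span_diff)
    then have "e *\<^sub>R w \<in> span T" by simp
    then have "(1 / e) *\<^sub>R (e *\<^sub>R w) \<in> span T" by (rule span_scale)
    then show False using w S(1) by simp
  qed
  then have "card T < card S" using S(3) finS by (intro psubset_card_mono) auto
  moreover have "card S \<le> Suc (card T)" using card_le_dim[OF S(2,4)] P(3) by simp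
  ultimately have "card (S - T) = 1" using S(3) finS by (simp add: card_Diff_subset finite_subset)
  then obtain b where "S - T = {b}" by (auto simp: card_1_singleton_iff)
  then have Sb: "S = insert b T" "b \<notin> T" using S(3) by auto
  have bl: "b \<in> link T" using Sb S(2) by (simp add: link_def)
  obtain a where a: "\<forall>s\<in>S. a s > 0" "z + e *\<^sub>R w = (\<Sum>s\<in>S. a s *\<^sub>R s)"
    using S(5) by (auto simp: positive_combination_def)
  have "z + e *\<^sub>R w = a b *\<^sub>R b + (\<Sum>s\<in>T. a s *\<^sub>R s)"
    unfolding a(2) Sb(1) using Sb(2) finS Sb(1) by simp
  then have eq: "e *\<^sub>R w - a b *\<^sub>R b = (\<Sum>s\<in>T. a s *\<^sub>R s) - z" by (simp add: algebra_simps)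
  have "e *\<^sub>R w - a b *\<^sub>R b \<in> span T"
    unfolding eq by (rule span_diff[OF _ zT]) (intro span_sum span_scale span_base)
  then have "(1 / e) *\<^sub>R (e *\<^sub>R w - a b *\<^sub>R b) \<in> span T" by (rule span_scale)
  moreover have "(1 / e) *\<^sub>R (e *\<^sub>R w - a b *\<^sub>R b) = w - (a b / e) *\<^sub>R b"
    using S(1) by (simp add: scaleR_diff_right)
  ultimately have "w - (a b / e) *\<^sub>R b \<in> span T" by simp
  moreover have "a b / e > 0" using a(1) Sb(1) S(1) by simp
  ultimately show ?thesis using that[OF bl] S(4) Sb(1) by blast
qed

text \<open>Adding the absolute values of the coefficients makes all of them nonnegative. This lifts
  relations modulo \<open>span T\<close> to relations between points of actual cones.\<close>

lemma span_shift_cone: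
  assumes "finite T" "t \<in> span T"
  obtains g where "g \<in> convex_cone hull T" "t + g \<in> convex_cone hull T"
proof -
  obtain a where a: "t = (\<Sum>s\<in>T. a s *\<^sub>R s)" using span_finite[OF assms(1)] assms(2) by auto
  define g where "g = (\<Sum>s\<in>T. \<bar>a s\<bar> *\<^sub>R s)"
  have "g \<in> convex_cone hull T"
    unfolding convex_cone_hull_finite[OF assms(1)] g_def by (intro exI[of _ "\<lambda>s. \<bar>a s\<bar>"]) auto
  moreover have "t + g \<in> convex_cone hull T"
    unfolding convex_cone_hull_finite[OF assms(1)]
  proof (intro exI[of _ "\<lambda>s. a s + \<bar>a s\<bar>"] conjI ballI)
    show "t + g = (\<Sum>s\<in>T. (a s + \<bar>a s\<bar>) *\<^sub>R s)"
      unfolding a g_def by (simp add: scaleR_left_distrib sum.distrib)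
  qed linarith
  ultimately show ?thesis using that by blast
qed

text \<open>Shifting by a suitable g in the cone over \<open>T\<close> makes b' + g a common point
  of both cones. If b and b' differ, the cones meet only in the cone over \<open>T\<close>, and b'
  would lie in \<open>span T\<close>.\<close>

lemma link_direction_unique:
  assumes b: "b \<in> link T" "b' \<in> link T" and x: "x > 0" "b' - x *\<^sub>R b \<in> span T"
  shows "b' = b"
proof (rule ccontr)
  assume ne: "b' \<noteq> b"
  have bS: "insert b T \<in> complex" "insert b' T \<in> complex" "b \<notin> T" "b' \<notin> T" using b by (auto simp: link_def)
  have finT: "finite T" using complex_finite[OF bS(1)] by simp
  obtain g where g: "g \<in> convex_cone hull T" "(b' - x *\<^sub>R b) + g \<in> convex_cone hull T"
    using span_shift_cone[OF finT x(2)] by blast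
  have sub: "convex_cone hull T \<subseteq> convex_cone hull (insert b T)" "convex_cone hull T \<subseteq> convex_cone hull (insert b' T)"
    by (rule hull_mono, blast)+
  have "b' + g \<in> convex_cone hull (insert b' T)"
    using g(1) sub by (intro convex_cone_hull_add[OF hull_inc]) auto
  moreover have "x *\<^sub>R b + ((b' - x *\<^sub>R b) + g) \<in> convex_cone hull (insert b T)"
  proof (rule convex_cone_hull_add)
    show "x *\<^sub>R b \<in> convex_cone hull (insert b T)" using x(1) by (intro convex_cone_hull_mul hull_inc) auto
  qed (use g(2) sub in auto)
  ultimately have "b' + g \<in> convex_cone hull (insert b T) \<inter> convex_cone hull (insert b' T)"
    by (simp add: algebra_simps)
  then have "b' + g \<in> convex_cone hull (insert b T \<inter> insert b' T)" using cone_Int[OF bS(1,2)] by simp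
  moreover have "insert b T \<inter> insert b' T = T" using ne bS by auto
  ultimately have "b' + g \<in> span T" using convex_cone_hull_subset_span by fastforce
  then have "(b' + g) - g \<in> span T" using g(1) convex_cone_hull_subset_span by (blast intro: span_diff)
  then have "b' \<in> span T" by simp
  then show False
    using complex_independent[OF bS(2)] bS(4) by (simp add: independent_insert)
qed

lemma link_notin_span: "b \<in> link T \<Longrightarrow> b \<notin> span T"
  using complex_independent[of "insert b T"] by (auto simp: link_def independent_insert)

text \<open>The integral coordinates h of b and h' of b' satisfy h b' = -x and h' b = -1/x; both are
  integers, so x = 1.\<close>

lemma link_opposite:
  assumes b: "b \<in> link T" "b' \<in> link T" and x: "x > 0" "b' + x *\<^sub>R b \<in> span T"
  shows "b' + b \<in> span T"
proof -
  have bL: "b \<in> N \<times> N" "b' \<in> N \<times> N" using b subset_lattice by (auto simp: link_def)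
  obtain h :: "'a \<times> 'a \<Rightarrow> real" where h: "linear h" "h b = 1" "\<forall>x\<in>span T. h x = 0" "\<forall>x\<in>N \<times> N. h x \<in> \<int>"
    using link_functional[OF b(1)] by blast
  obtain h' :: "'a \<times> 'a \<Rightarrow> real" where h': "linear h'" "h' b' = 1" "\<forall>x\<in>span T. h' x = 0" "\<forall>x\<in>N \<times> N. h' x \<in> \<int>"
    using link_functional[OF b(2)] by blast
  have "h b' + x = 0" using h(3) x(2) h(2) by (auto simp: linear_add[OF h(1)] linear_scale[OF h(1)])
  moreover have "1 + x * h' b = 0" using h'(3) x(2) h'(2) by (auto simp: linear_add[OF h'(1)] linear_scale[OF h'(1)])
  moreover obtain i where "h b' = of_int i" using bspec[OF h(4) bL(2)] by (elim Ints_cases)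
  moreover obtain j where "h' b = of_int j" using bspec[OF h'(4) bL(1)] by (elim Ints_cases)
  ultimately have xi: "x = of_int (- i)" and xj: "1 + x * of_int j = 0" by auto
  from xj have "of_int (i * j) = (1::real)" unfolding xi by simp
  then have "i * j = 1" unfolding of_int_eq_1_iff .
  moreover have "i < 0" using x(1) xi by simp
  ultimately have "i = - 1" by (auto simp: zmult_eq_1_iff)
  then show ?thesis using x(2) xi by simp
qed

lemma product_fan_iff: "P \<in> product_fan A B \<longleftrightarrow> (\<exists>a\<in>A. \<exists>b\<in>B. P = a \<times> b)"
  by (auto simp: product_fan_def)

lemma fan_0: "\<sigma> \<in> \<Delta> \<Longrightarrow> 0 \<in> \<sigma>"
  by (rule convex_cone_contains_0[OF fan_convex_cone[OF fan_N]])

lemma subgroup_N: "add_subgroup N"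
  by (rule add_subgroup_full_lattice[OF full_N])

lemma N_0: "0 \<in> N"
  by (rule add_subgroup_0[OF subgroup_N])

lemma dim_product: "\<sigma> \<in> \<Delta> \<Longrightarrow> \<tau> \<in> \<Delta> \<Longrightarrow> dim (\<sigma> \<times> \<tau>) = dim \<sigma> + dim \<tau>"
  by (intro dim_Times_0 fan_0)

lemma finite_product: "finite (product_fan \<Delta> \<Delta>)"
proof -
  have "product_fan \<Delta> \<Delta> = (\<lambda>(a, b). a \<times> b) ` (\<Delta> \<times> \<Delta>)" by (auto simp: product_fan_def)
  then show ?thesis using fan_N by (simp add: fan_def)
qed

lemma span_cone_eq:
  assumes S: "S \<in> complex" "convex_cone hull S \<subseteq> P" "dim P = card S"
  shows "span P = span S"
proof -
  have "span S \<subseteq> span P" using span_mono[OF S(2)] by simp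
  moreover have "dim (span P) \<le> dim (span S)"
    using S(3) complex_independent[OF S(1)] by (simp add: dim_eq_card_independent)
  ultimately show ?thesis by (intro subspace_dim_equal[symmetric]) auto
qed

text \<open>If the facet \<open>\<rho>\<close> of \<open>P\<close> spans the same space as \<open>T\<close>, then \<open>P\<close> lies on the side of
  \<open>span T\<close> which contains \<open>b\<close>.\<close>

lemma facet_side:
  assumes P: "P \<in> product_fan \<Delta> \<Delta>" "dim P = Suc (card T)" and \<rho>: "\<rho> face_of P" "span \<rho> = span T" "convex_cone hull T \<subseteq> \<rho>"
    and b: "b \<in> link T" "convex_cone hull (insert b T) \<subseteq> P"
    and h: "linear h" "h b = (1::real)" "\<forall>x\<in>span T. h x = 0" "\<forall>x\<in>span (insert b T). x - h x *\<^sub>R b \<in> span T"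
  shows "x \<in> P \<Longrightarrow> h x \<ge> 0" and "x \<in> span P \<Longrightarrow> x - h x *\<^sub>R b \<in> span T"
proof -
  have bS: "insert b T \<in> complex" "b \<notin> T" using b by (auto simp: link_def)
  have finT: "finite T" using complex_finite[OF bS(1)] by simp
  have spanP: "span P = span (insert b T)"
    using bS finT P(2) by (intro span_cone_eq[OF bS(1) b(2)]) simp
  then show *: "x - h x *\<^sub>R b \<in> span T" if "x \<in> span P" for x using that h(4) by simp
  assume x: "x \<in> P"
  show "h x \<ge> 0"
  proof (rule ccontr)
    assume neg: "\<not> h x \<ge> 0"
    have "x - h x *\<^sub>R b \<in> span T" using x by (intro * span_base)
    then obtain g where g: "g \<in> convex_cone hull T" "(x - h x *\<^sub>R b) + g \<in> convex_cone hull T"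
      using span_shift_cone[OF finT] by blast
    have "b \<in> P" using b(2) hull_inc[of b "insert b T" convex_cone] by blast
    then have "(- h x) *\<^sub>R b \<in> P" using neg by (intro convex_cone_scaleR[OF product_cone(1)[OF P(1)]]) auto
    moreover have "g \<in> P" using g(1) \<rho>(1,3) face_of_imp_subset by blast
    ultimately have "(- h x) *\<^sub>R b + g \<in> P" by (rule convex_cone_add[OF product_cone(1)[OF P(1)]])
    moreover have "x + ((- h x) *\<^sub>R b + g) \<in> \<rho>"
    proof -
      have "(x - h x *\<^sub>R b) + g \<in> \<rho>" using g(2) \<rho>(3) by blast
      then show ?thesis by (simp add: algebra_simps)
    qed
    ultimately have "x \<in> \<rho>" by (rule face_of_cone_add[OF product_cone(1)[OF P(1)] \<rho>(1) x])
    then have "x \<in> span T" using \<rho>(2) span_base by blast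
    then show False using h(3) neg by simp
  qed
qed

text \<open>For \<open>P = \<sigma> \<times> \<rho>\<^sub>2\<close> and \<open>\<tau> = \<rho>\<^sub>1\<close>, the maps \<open>pr\<close> and \<open>em\<close> are the projection to
  and the inclusion of the first factor; for \<open>P = \<rho>\<^sub>1 \<times> \<sigma>\<close> those of the second.\<close>

lemma facet_normal:
  assumes em: "linear em" "\<And>x. x \<in> N \<Longrightarrow> em x \<in> N \<times> N" "\<And>x. x \<in> \<sigma> \<Longrightarrow> em x \<in> P"
      "\<And>x. x \<in> span \<tau> \<Longrightarrow> em x \<in> span T"
    and pr: "linear pr" "\<And>x. pr (em x) = x" "\<And>z. z \<in> N \<times> N \<Longrightarrow> pr z \<in> N" "\<And>z. z \<in> P \<Longrightarrow> pr z \<in> \<sigma>"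
      "\<And>z. z \<in> span T \<Longrightarrow> pr z \<in> span \<tau>" "\<And>z. z \<in> P \<Longrightarrow> z - em (pr z) \<in> span T"
    and P: "P \<in> product_fan \<Delta> \<Delta>" "dim P = Suc (card T)"
    and \<rho>: "\<rho> face_of P" "span \<rho> = span T" "convex_cone hull T \<subseteq> \<rho>" and "\<tau> \<subseteq> \<sigma>"
    and b: "b \<in> link T" "convex_cone hull (insert b T) \<subseteq> P"
  shows "b - em (normal_vector N \<sigma> \<tau>) \<in> span T"
proof -
  have bP: "b \<in> P" using b(2) hull_inc[of b "insert b T" convex_cone] by auto
  have bN: "b \<in> N \<times> N" using b(1) subset_lattice by (auto simp: link_def)
  note rest = pr(6)[OF bP]
  obtain h :: "'a \<times> 'a \<Rightarrow> real" where h: "linear h" "h b = 1" "\<forall>x\<in>span T. h x = 0" "\<forall>x\<in>N \<times> N. h x \<in> \<int>"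
    "\<forall>x\<in>convex_cone hull (insert b T). h x \<ge> 0"
    "\<forall>x\<in>span (insert b T). x - h x *\<^sub>R b \<in> span T"
    using link_functional[OF b(1)] by blast
  note side = facet_side[OF P \<rho> b h(1,2,3,6)]
  have rep: "represents_normal N \<sigma> \<tau> (pr b)"
    unfolding represents_normal_def
  proof (intro conjI ballI allI impI)
    show "pr b \<in> N" by (rule pr(3)[OF bN])
    have "pr b + 0 \<in> \<sigma> + span \<tau>" using pr(4)[OF bP] span_zero by (rule set_plus_intro)
    then show "pr b \<in> \<sigma> + span \<tau>" by simp
    show "pr b \<notin> span \<tau>"
    proof
      assume "pr b \<in> span \<tau>"
      then have "em (pr b) + (b - em (pr b)) \<in> span T" by (intro span_add em(4) rest)
      then show False using link_notin_span[OF b(1)] by simp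
    qed
    fix w and j :: nat assume w: "w \<in> N" "pr b - real j *\<^sub>R w \<in> sublattice N \<tau>"
    have "em (pr b - real j *\<^sub>R w) + (b - em (pr b)) \<in> span T"
      using w(2) by (intro span_add em(4) rest) (simp add: sublattice_def)
    then have "b - real j *\<^sub>R em w \<in> span T" by (simp add: linear_diff[OF em(1)] linear_scale[OF em(1)])
    moreover have "b - real j *\<^sub>R em w \<in> N \<times> N"
      by (intro add_subgroup_diff[OF subgroup bN] add_subgroup_scale_nat[OF subgroup] em(2) w(1))
    ultimately have "b - real j *\<^sub>R em w \<in> sublattice (N \<times> N) (convex_cone hull T)"
      by (simp add: sublattice_def)
    then show "j = 1"
      by (rule represents_normal_link[OF b(1), unfolded represents_normal_def, THEN conjunct2, THEN conjunct2,
            THEN conjunct2, rule_format, OF em(2)[OF w(1)]])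
  qed
  have l1: "linear (\<lambda>x. h (em x))" using linear_compose[OF em(1) h(1)] by (simp add: o_def)
  have "h (b - em (pr b)) = 0" by (rule bspec[OF h(3) rest])
  then have h1: "h (em (pr b)) = 1" using h(2) by (simp add: linear_diff[OF h(1)])
  have "normal_vector N \<sigma> \<tau> - pr b \<in> sublattice N \<tau>"
  proof (rule normal_vector_eq[OF subgroup_N rep \<open>\<tau> \<subseteq> \<sigma>\<close> l1 h1])
    show "h (em x) \<in> \<int>" if "x \<in> N" for x by (rule bspec[OF h(4) em(2)[OF that]])
    show "h (em x) \<ge> 0" if "x \<in> \<sigma>" for x by (rule side(1)[OF em(3)[OF that]])
    show "h (em x) = 0" if "x \<in> span \<tau>" for x by (rule bspec[OF h(3) em(4)[OF that]])
    show "x - h (em x) *\<^sub>R pr b \<in> span \<tau>" if "x \<in> span \<sigma>" for x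
    proof -
      have "em x \<in> span (em ` \<sigma>)" using that linear_span_image[OF em(1), of \<sigma>] by blast
      then have "em x \<in> span P" using span_mono[of "em ` \<sigma>" P] em(3) by blast
      from pr(5)[OF side(2)[OF this]] show ?thesis
        by (simp add: linear_diff[OF pr(1)] linear_scale[OF pr(1)] pr(2))
    qed
  qed
  then have "em (normal_vector N \<sigma> \<tau> - pr b) \<in> span T" by (intro em(4)) (simp add: sublattice_def)
  then have "(b - em (pr b)) - em (normal_vector N \<sigma> \<tau> - pr b) \<in> span T" by (rule span_diff[OF rest])
  then show ?thesis by (simp add: linear_diff[OF em(1)])
qed

lemma product_cone_unique:
  assumes S: "S \<in> complex" "card S = m"
    and P: "P \<in> product_fan \<Delta> \<Delta>" "dim P = m" "convex_cone hull S \<subseteq> P"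
    and Q: "Q \<in> product_fan \<Delta> \<Delta>" "dim Q = m" "convex_cone hull S \<subseteq> Q"
  shows "P = Q"
proof -
  have sub: "convex_cone hull S \<subseteq> P \<inter> Q" using P Q by blast
  then have ne: "P \<inter> Q \<noteq> {}" using convex_cone_hull_nonempty by blast
  have d: "m \<le> dim (P \<inter> Q)" using card_le_dim[OF S(1) sub] S(2) by simp
  have "P \<inter> Q = P"
    using d P(2) by (intro face_of_cone_dim_eq[OF product_cone(1)[OF P(1)] product_Int_face[OF P(1) Q(1)] ne]) simp
  moreover have "Q \<inter> P = Q"
    using d Q(2) ne by (intro face_of_cone_dim_eq[OF product_cone(1)[OF Q(1)] product_Int_face[OF Q(1) P(1)]])
      (simp_all add: Int_commute)
  ultimately show ?thesis by blast
qed

text \<open>At most one summand is nonzero. Written as a sum, the refined weight is linear in w, so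
  that summation over cones and over product cones can be interchanged.\<close>

lemma refine_weight_eq_sum:
  assumes S: "S \<in> complex" "card S + k = DIM('a \<times> 'a)"
  shows "real_of_int (refine_weight \<Delta>' (product_fan \<Delta> \<Delta>) k w (convex_cone hull S)) =
    (\<Sum>P | P \<in> product_fan \<Delta> \<Delta> \<and> dim P = card S. of_bool (convex_cone hull S \<subseteq> P) * real_of_int (w P))"
proof -
  define \<Q> where "\<Q> = {P \<in> product_fan \<Delta> \<Delta>. dim P = card S}"
  have finQ: "finite \<Q>" using finite_product by (simp add: \<Q>_def)
  have codim: "codim_cones (product_fan \<Delta> \<Delta>) k = \<Q>"
    using S(2) by (auto simp: codim_cones_def \<Q>_def)
  have inS: "convex_cone hull S \<in> codim_cones \<Delta>' k" using S by (auto simp: codim_cones_eq)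
  show ?thesis
  proof (cases "\<exists>P\<in>\<Q>. convex_cone hull S \<subseteq> P")
    case True
    then obtain P where P: "P \<in> \<Q>" "convex_cone hull S \<subseteq> P" by blast
    have uniq: "Q = P" if "Q \<in> \<Q>" "convex_cone hull S \<subseteq> Q" for Q
      by (rule product_cone_unique[OF S(1) refl]) (use that P in \<open>simp_all add: \<Q>_def\<close>)
    have "(THE \<sigma>. \<sigma> \<in> codim_cones (product_fan \<Delta> \<Delta>) k \<and> convex_cone hull S \<subseteq> \<sigma>) = P"
      unfolding codim by (rule the_equality) (use P uniq in blast)+
    then have "refine_weight \<Delta>' (product_fan \<Delta> \<Delta>) k w (convex_cone hull S) = w P"
      unfolding refine_weight_def codim using inS True by simp
    moreover have "(\<Sum>Q\<in>\<Q>. of_bool (convex_cone hull S \<subseteq> Q) * real_of_int (w Q)) =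
        (\<Sum>Q\<in>{P}. of_bool (convex_cone hull S \<subseteq> Q) * real_of_int (w Q))"
    proof (rule sum.mono_neutral_right[OF finQ])
      show "\<forall>Q\<in>\<Q> - {P}. of_bool (convex_cone hull S \<subseteq> Q) * real_of_int (w Q) = 0"
        using uniq by fastforce
    qed (use P in auto)
    ultimately show ?thesis using P(2) by (simp add: \<Q>_def)
  next
    case False
    then have "refine_weight \<Delta>' (product_fan \<Delta> \<Delta>) k w (convex_cone hull S) = 0"
      unfolding refine_weight_def codim by auto
    moreover have "(\<Sum>Q\<in>\<Q>. of_bool (convex_cone hull S \<subseteq> Q) * real_of_int (w Q)) = 0"
      using False by (intro sum.neutral) auto
    ultimately show ?thesis by (simp add: \<Q>_def)
  qed
qed

lemma positive_combination_sum: "positive_combination T (\<Sum>T)"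
  unfolding positive_combination_def by (intro exI[of _ "\<lambda>_. 1"]) simp

text \<open>Here \<open>T\<close> cuts through the interior of \<open>P\<close>. Moving from z along
  w and along -w gives one adjacent cone on each side; there are no others, and their generators are
  opposite modulo \<open>span T\<close>.\<close>

lemma link_cones_span:
  assumes T: "T \<in> complex" "positive_combination T z" and P: "P \<in> product_fan \<Delta> \<Delta>" "dim P = Suc (card T)"
    and z: "z \<in> rel_interior P"
  shows "(\<Sum>b | b \<in> link T \<and> convex_cone hull (insert b T) \<subseteq> P. b) \<in> span T"
proof -
  have zP: "z \<in> P" using z rel_interior_subset by blast
  have TP: "convex_cone hull T \<subseteq> P" by (rule cone_subset_product[OF T zP P(1)])
  have "\<not> P \<subseteq> span T"
  proof
    assume "P \<subseteq> span T"
    then have "dim P \<le> card T"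
      using complex_independent[OF T(1)] dim_subset[of P "span T"] by (simp add: dim_eq_card_independent)
    then show False using P(2) by simp
  qed
  then obtain w where w: "w \<in> P" "w \<notin> span T" by blast
  have wS: "w \<in> span P" "- w \<in> span P" using w(1) by (simp_all add: span_base span_neg)
  have nw: "- w \<notin> span T" using w(2) span_neg by fastforce
  obtain e\<^sub>1 where e1: "e\<^sub>1 > 0" "z + e\<^sub>1 *\<^sub>R w \<in> P"
    using rel_interior_cone_move[OF product_cone(1)[OF P(1)] z wS(1)] by blast
  obtain e\<^sub>2 where e2: "e\<^sub>2 > 0" "z + e\<^sub>2 *\<^sub>R (- w) \<in> P"
    using rel_interior_cone_move[OF product_cone(1)[OF P(1)] z wS(2)] by blast
  obtain b x where b: "b \<in> link T" "convex_cone hull (insert b T) \<subseteq> P" "x > 0" "w - x *\<^sub>R b \<in> span T"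
    using link_direction[OF T P(1) zP P(2) e1 w(2)] by blast
  obtain b' x' where b': "b' \<in> link T" "convex_cone hull (insert b' T) \<subseteq> P" "x' > 0" "- w - x' *\<^sub>R b' \<in> span T"
    using link_direction[OF T P(1) zP P(2) e2 nw] by blast
  have finT: "finite T" by (rule complex_finite[OF T(1)])
  have spanP: "span P = span (insert b T)"
    using b(1) finT P(2) by (intro span_cone_eq[OF _ b(2)]) (auto simp: link_def)
  have opp: "b' + (x / x') *\<^sub>R b \<in> span T"
  proof -
    have "(w - x *\<^sub>R b) + (- w - x' *\<^sub>R b') \<in> span T" by (intro span_add b b')
    then have "(- (1 / x')) *\<^sub>R ((w - x *\<^sub>R b) + (- w - x' *\<^sub>R b')) \<in> span T" by (rule span_scale)
    moreover have "(- (1 / x')) *\<^sub>R ((w - x *\<^sub>R b) + (- w - x' *\<^sub>R b')) = b' + (x / x') *\<^sub>R b"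
      using b'(3) by (simp add: algebra_simps)
    ultimately show ?thesis by simp
  qed
  have bb: "b' + b \<in> span T"
    using b(3) b'(3) by (intro link_opposite[OF b(1) b'(1) _ opp]) simp
  have ne: "b \<noteq> b'"
  proof
    assume "b = b'"
    then have "(1/2) *\<^sub>R (b' + b) \<in> span T" using bb span_scale by blast
    then show False using link_notin_span[OF b(1)] \<open>b = b'\<close> by (simp flip: scaleR_2)
  qed
  have "y = b \<or> y = b'" if y: "y \<in> link T" "convex_cone hull (insert y T) \<subseteq> P" for y
  proof -
    have "y \<in> P" using y(2) hull_inc[of y "insert y T" convex_cone] by blast
    then have "y \<in> span (insert b T)" using spanP span_base by blast
    then obtain k where k: "y - k *\<^sub>R b \<in> span T" by (auto simp: span_insert)
    have "k \<noteq> 0" using k link_notin_span[OF y(1)] by auto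
    then consider "k > 0" | "k < 0" by linarith
    then show ?thesis
    proof cases
      case 1
      then show ?thesis using link_direction_unique[OF b(1) y(1) _ k] by blast
    next
      case 2
      have "(y - k *\<^sub>R b) + k *\<^sub>R (b' + b) \<in> span T" by (rule span_add[OF k span_scale[OF bb]])
      then have "y - (- k) *\<^sub>R b' \<in> span T" by (simp add: algebra_simps)
      then show ?thesis using 2 link_direction_unique[OF b'(1) y(1), of "- k"] by auto
    qed
  qed
  then have "{b. b \<in> link T \<and> convex_cone hull (insert b T) \<subseteq> P} = {b, b'}" using b b' by blast
  then show ?thesis using ne bb by (simp add: add.commute)
qed

text \<open>Here \<open>T\<close> lies on a face that it spans, so all of \<open>P\<close> is on one
  side of \<open>span T\<close> and only one adjacent cone fits.\<close>

lemma link_cone_facet: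
  assumes T: "T \<in> complex" "positive_combination T z" and P: "P \<in> product_fan \<Delta> \<Delta>" "dim P = Suc (card T)"
    and \<rho>: "\<rho> face_of P" "span \<rho> = span T" "convex_cone hull T \<subseteq> \<rho>" "z \<in> \<rho>"
  shows "\<exists>b. b \<in> link T \<and> convex_cone hull (insert b T) \<subseteq> P \<and>
    {b. b \<in> link T \<and> convex_cone hull (insert b T) \<subseteq> P} = {b}"
proof -
  have zP: "z \<in> P" using \<rho>(1,4) face_of_imp_subset by blast
  have "\<not> P \<subseteq> span T"
  proof
    assume "P \<subseteq> span T"
    then have "dim P \<le> card T"
      using complex_independent[OF T(1)] dim_subset[of P "span T"] by (simp add: dim_eq_card_independent)
    then show False using P(2) by simp
  qed
  then obtain w where w: "w \<in> P" "w \<notin> span T" by blast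
  have "z + 1 *\<^sub>R w \<in> P" using convex_cone_add[OF product_cone(1)[OF P(1)] zP w(1)] by simp
  then obtain b where b: "b \<in> link T" "convex_cone hull (insert b T) \<subseteq> P"
    using link_direction[OF T P(1) zP P(2) zero_less_one _ w(2)] by blast
  obtain h :: "'a \<times> 'a \<Rightarrow> real" where h: "linear h" "h b = 1" "\<forall>x\<in>span T. h x = 0"
    "\<forall>x\<in>span (insert b T). x - h x *\<^sub>R b \<in> span T"
    using link_functional[OF b(1)] by blast
  note side = facet_side[OF P \<rho>(1-3) b h]
  have "y = b" if y: "y \<in> link T" "convex_cone hull (insert y T) \<subseteq> P" for y
  proof -
    have yP: "y \<in> P" using y(2) hull_inc[of y "insert y T" convex_cone] by blast
    have k: "y - h y *\<^sub>R b \<in> span T" "h y \<ge> 0" using side yP span_base by blast+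
    have "h y \<noteq> 0" using k(1) link_notin_span[OF y(1)] by auto
    then show ?thesis using k link_direction_unique[OF b(1) y(1) _ k(1)] by simp
  qed
  then have "{b. b \<in> link T \<and> convex_cone hull (insert b T) \<subseteq> P} = {b}" using b by blast
  then show ?thesis using b by blast
qed

section \<open>Balancing of the refined product weight\<close>

lemma minkowski_weight_span:
  assumes "minkowski_weight N \<Delta> k c" "\<rho> \<in> codim_cones \<Delta> (k + 1)"
  shows "(\<Sum>\<sigma> | \<sigma> \<in> codim_cones \<Delta> k \<and> \<rho> \<subseteq> \<sigma>. real_of_int (c \<sigma>) *\<^sub>R normal_vector N \<sigma> \<rho>) \<in> span \<rho>"
  using assms by (simp add: minkowski_weight_def sublattice_def)

lemma codim_face_eq:
  assumes "\<rho> \<in> \<Delta>" "\<sigma> \<in> \<Delta>" "\<rho> face_of \<sigma>" "dim \<sigma> \<le> dim \<rho>"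
  shows "\<rho> = \<sigma>"
proof -
  have "\<rho> \<noteq> {}" using fan_0[OF assms(1)] by blast
  then show ?thesis
    by (rule face_of_cone_dim_eq[OF fan_convex_cone[OF fan_N assms(2)] assms(3) _ assms(4)])
qed

text \<open>Group the cones around \<open>T\<close> by the product cone P containing them, and let
  \<open>\<rho>\<^sub>1 \<times> \<rho>\<^sub>2\<close> be the product cone with an interior point
  of the cone over \<open>T\<close> in its relative interior. If it has dimension at least m, each P
  contributes an opposite pair or nothing. Otherwise it spans the same space as \<open>T\<close>,
  each P through z has one adjacent cone, and dimensions let only one factor of P vary; the
  generator is a normal vector in that factor, and balancing of \<open>c\<^sub>1\<close> or
  \<open>c\<^sub>2\<close> applies.\<close>

lemma balanced_refine_weight:
  assumes c1: "minkowski_weight N \<Delta> k\<^sub>1 c\<^sub>1" and c2: "minkowski_weight N \<Delta> k\<^sub>2 c\<^sub>2"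
    and m: "m + (k\<^sub>1 + k\<^sub>2) = DIM('a \<times> 'a)"
  shows "balanced m (\<lambda>S. real_of_int (refine_weight \<Delta>' (product_fan \<Delta> \<Delta>) (k\<^sub>1 + k\<^sub>2)
            (product_weight \<Delta> k\<^sub>1 c\<^sub>1 k\<^sub>2 c\<^sub>2) (convex_cone hull S)))"
  unfolding balanced_def
proof (intro ballI impI)
  fix T assume T: "T \<in> complex" "card T + 1 = m"
  define w where "w = (\<lambda>P. real_of_int (product_weight \<Delta> k\<^sub>1 c\<^sub>1 k\<^sub>2 c\<^sub>2 P))"
  define \<Q> where "\<Q> = {P \<in> product_fan \<Delta> \<Delta>. dim P = m}"
  define L where "L = (\<lambda>P. {b. b \<in> link T \<and> convex_cone hull (insert b T) \<subseteq> P})"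
  have finQ: "finite \<Q>" using finite_product by (simp add: \<Q>_def)
  have finT: "finite T" by (rule complex_finite[OF T(1)])
  have finL: "finite (L P)" for P by (simp add: L_def)
  define z where "z = \<Sum>T"
  have z: "positive_combination T z" unfolding z_def by (rule positive_combination_sum)
  obtain \<rho>\<^sub>1 where r1: "\<rho>\<^sub>1 \<in> \<Delta>" "fst z \<in> rel_interior \<rho>\<^sub>1" "\<And>\<sigma>. \<sigma> \<in> \<Delta> \<Longrightarrow> fst z \<in> \<sigma> \<Longrightarrow> \<rho>\<^sub>1 face_of \<sigma>"
    using fan_carrier_cone[OF fan_N, of "fst z"] Union_N by blast
  obtain \<rho>\<^sub>2 where r2: "\<rho>\<^sub>2 \<in> \<Delta>" "snd z \<in> rel_interior \<rho>\<^sub>2" "\<And>\<sigma>. \<sigma> \<in> \<Delta> \<Longrightarrow> snd z \<in> \<sigma> \<Longrightarrow> \<rho>\<^sub>2 face_of \<sigma>"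
    using fan_carrier_cone[OF fan_N, of "snd z"] Union_N by blast
  have conv: "convex \<rho>\<^sub>1" "convex \<rho>\<^sub>2"
    using fan_convex_cone[OF fan_N r1(1)] fan_convex_cone[OF fan_N r2(1)] by (simp_all add: convex_cone_def)
  have \<rho>: "\<rho>\<^sub>1 \<times> \<rho>\<^sub>2 \<in> product_fan \<Delta> \<Delta>" using r1 r2 by (auto simp: product_fan_iff)
  have zr: "z \<in> rel_interior (\<rho>\<^sub>1 \<times> \<rho>\<^sub>2)"
    using rel_interior_Times[OF conv] r1(2) r2(2) by (simp add: mem_Times_iff)
  then have z\<rho>: "z \<in> \<rho>\<^sub>1 \<times> \<rho>\<^sub>2" using rel_interior_subset by blast
  have T\<rho>: "convex_cone hull T \<subseteq> \<rho>\<^sub>1 \<times> \<rho>\<^sub>2" by (rule cone_subset_product[OF T(1) z z\<rho> \<rho>])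
  have zT: "z \<in> convex_cone hull T" by (rule positive_combination_in_cone[OF finT z])
  have mem: "z \<in> P" if "b \<in> L P" for b P
  proof -
    have "convex_cone hull T \<subseteq> convex_cone hull (insert b T)" by (rule hull_mono) blast
    then show ?thesis using that zT unfolding L_def by blast
  qed
  have faces: "\<rho>\<^sub>1 face_of a \<and> \<rho>\<^sub>2 face_of b" if "a \<times> b \<in> product_fan \<Delta> \<Delta>" "z \<in> a \<times> b" for a b
  proof -
    have "a \<in> \<Delta>" "b \<in> \<Delta>" using that by (auto simp: product_fan_iff times_eq_iff)
    then show ?thesis using r1(3) r2(3) that(2) by (auto simp: mem_Times_iff)
  qed
  have faceP: "\<rho>\<^sub>1 \<times> \<rho>\<^sub>2 face_of P" if P: "P \<in> product_fan \<Delta> \<Delta>" "z \<in> P" for P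
  proof -
    obtain a b where "P = a \<times> b" using P(1) by (auto simp: product_fan_iff)
    then show ?thesis using faces[of a b] P by (auto intro: face_of_Times)
  qed
  have "(\<Sum>b\<in>link T. real_of_int (refine_weight \<Delta>' (product_fan \<Delta> \<Delta>) (k\<^sub>1 + k\<^sub>2)
            (product_weight \<Delta> k\<^sub>1 c\<^sub>1 k\<^sub>2 c\<^sub>2) (convex_cone hull (insert b T))) *\<^sub>R b) =
        (\<Sum>b\<in>link T. (\<Sum>P\<in>\<Q>. of_bool (convex_cone hull (insert b T) \<subseteq> P) * w P) *\<^sub>R b)"
  proof (rule sum.cong[OF refl])
    fix b assume "b \<in> link T"
    then have bS: "insert b T \<in> complex" "card (insert b T) = m" using T finT by (auto simp: link_def)
    show "real_of_int (refine_weight \<Delta>' (product_fan \<Delta> \<Delta>) (k\<^sub>1 + k\<^sub>2)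
            (product_weight \<Delta> k\<^sub>1 c\<^sub>1 k\<^sub>2 c\<^sub>2) (convex_cone hull (insert b T))) *\<^sub>R b =
        (\<Sum>P\<in>\<Q>. of_bool (convex_cone hull (insert b T) \<subseteq> P) * w P) *\<^sub>R b"
      using bS m by (subst refine_weight_eq_sum[OF bS(1)]) (simp_all add: \<Q>_def w_def)
  qed
  also have "\<dots> = (\<Sum>P\<in>\<Q>. \<Sum>b\<in>link T. (of_bool (convex_cone hull (insert b T) \<subseteq> P) * w P) *\<^sub>R b)"
    unfolding scaleR_sum_left by (rule sum.swap)
  also have "\<dots> = (\<Sum>P\<in>\<Q>. w P *\<^sub>R \<Sum>(L P))"
  proof (rule sum.cong[OF refl])
    fix P
    have "(\<Sum>b\<in>link T. (of_bool (convex_cone hull (insert b T) \<subseteq> P) * w P) *\<^sub>R b) = (\<Sum>b\<in>L P. w P *\<^sub>R b)"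
      by (rule sum.mono_neutral_cong_right) (auto simp: L_def)
    then show "(\<Sum>b\<in>link T. (of_bool (convex_cone hull (insert b T) \<subseteq> P) * w P) *\<^sub>R b) = w P *\<^sub>R \<Sum>(L P)"
      by (simp add: scaleR_sum_right)
  qed
  also have "\<dots> \<in> span T"
  proof (cases "dim (\<rho>\<^sub>1 \<times> \<rho>\<^sub>2) \<ge> m")
    case True
    have "\<Sum>(L P) \<in> span T" if P: "P \<in> \<Q>" for P
    proof (cases "L P = {}")
      case False
      then have zP: "z \<in> P" using mem by blast
      have PP: "P \<in> product_fan \<Delta> \<Delta>" "dim P = m" using P by (auto simp: \<Q>_def)
      have "\<rho>\<^sub>1 \<times> \<rho>\<^sub>2 = P"
        using z\<rho> True PP(2) by (intro face_of_cone_dim_eq[OF product_cone(1)[OF PP(1)] faceP[OF PP(1) zP]]) auto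
      then show ?thesis
        using link_cones_span[OF T(1) z PP(1)] PP(2) T(2) zr by (simp add: L_def)
    qed (simp add: span_zero)
    then show ?thesis by (rule span_sum[OF span_scale])
  next
    case False
    have "card T \<le> dim (\<rho>\<^sub>1 \<times> \<rho>\<^sub>2)" by (rule card_le_dim[OF T(1) T\<rho>])
    then have dim\<rho>: "dim (\<rho>\<^sub>1 \<times> \<rho>\<^sub>2) = card T" using False T(2) by simp
    have dsum: "dim \<rho>\<^sub>1 + dim \<rho>\<^sub>2 = card T" using dim\<rho> dim_product r1(1) r2(1) by simp
    have span\<rho>: "span (\<rho>\<^sub>1 \<times> \<rho>\<^sub>2) = span T" by (rule span_cone_eq[OF T(1) T\<rho> dim\<rho>])
    have spanT: "span \<rho>\<^sub>1 \<times> span \<rho>\<^sub>2 = span T"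
      using span\<rho> span_Times_0[OF fan_0[OF r1(1)] fan_0[OF r2(1)]] by simp
    have single: "\<exists>b. b \<in> link T \<and> convex_cone hull (insert b T) \<subseteq> P \<and> L P = {b}"
      if P: "P \<in> \<Q>" "z \<in> P" for P
    proof -
      have PP: "P \<in> product_fan \<Delta> \<Delta>" "dim P = Suc (card T)" using P T(2) by (auto simp: \<Q>_def)
      show ?thesis
        unfolding L_def by (rule link_cone_facet[OF T(1) z PP faceP[OF PP(1) P(2)] span\<rho> T\<rho> z\<rho>])
    qed
    define \<A> where "\<A> = {P \<in> \<Q>. z \<in> P \<and> P \<in> product_fan (codim_cones \<Delta> k\<^sub>1) (codim_cones \<Delta> k\<^sub>2)}"
    have "(\<Sum>P\<in>\<Q>. w P *\<^sub>R \<Sum>(L P)) = (\<Sum>P\<in>\<A>. w P *\<^sub>R \<Sum>(L P))"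
    proof (rule sum.mono_neutral_right[OF finQ])
      show "\<forall>P\<in>\<Q> - \<A>. w P *\<^sub>R \<Sum>(L P) = 0"
      proof
        fix P assume P: "P \<in> \<Q> - \<A>"
        show "w P *\<^sub>R \<Sum>(L P) = 0"
        proof (cases "z \<in> P")
          case True
          then have "w P = 0" using P by (simp add: w_def product_weight_def \<A>_def)
          then show ?thesis by simp
        next
          case False
          then have "L P = {}" using mem by blast
          then show ?thesis by simp
        qed
      qed
    qed (auto simp: \<A>_def)
    also have "\<dots> \<in> span T"
    proof (cases "\<A> = {}")
      case False
      have factors: "a \<in> codim_cones \<Delta> k\<^sub>1 \<and> b \<in> codim_cones \<Delta> k\<^sub>2 \<and> \<rho>\<^sub>1 face_of a \<and> \<rho>\<^sub>2 face_of b \<and>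
          a \<in> \<Delta> \<and> b \<in> \<Delta> \<and> dim \<rho>\<^sub>1 \<le> dim a \<and> dim \<rho>\<^sub>2 \<le> dim b"
        if "a \<times> b \<in> \<A>" for a b
      proof -
        have ne: "a \<times> b \<noteq> {}" using that by (auto simp: \<A>_def)
        have ab: "a \<in> codim_cones \<Delta> k\<^sub>1" "b \<in> codim_cones \<Delta> k\<^sub>2"
          using that ne by (auto simp: \<A>_def product_fan_iff times_eq_iff)
        have f: "\<rho>\<^sub>1 face_of a \<and> \<rho>\<^sub>2 face_of b" using that faces[of a b] by (simp add: \<A>_def \<Q>_def)
        then have "dim \<rho>\<^sub>1 \<le> dim a" "dim \<rho>\<^sub>2 \<le> dim b"
          by (simp_all add: dim_subset face_of_imp_subset)
        then show ?thesis using ab f by (simp add: codim_cones_def)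
      qed
      \<comment> \<open>Common end of the two cases: \<open>em\<close> embeds the factor that
        varies, n gives its normal vectors, and r is the constant weight of the other
        factor.\<close>
      have combine: "(\<Sum>P\<in>\<A>. w P *\<^sub>R \<Sum>(L P)) \<in> span T"
        if D: "\<A> = pair ` D" "inj_on pair D" and em: "linear em" and wv: "\<And>\<sigma>. \<sigma> \<in> D \<Longrightarrow> w (pair \<sigma>) = r * c \<sigma>"
          and bal: "em (\<Sum>\<sigma>\<in>D. c \<sigma> *\<^sub>R n \<sigma>) \<in> span T"
          and shift: "\<And>\<sigma>. \<sigma> \<in> D \<Longrightarrow> \<Sum>(L (pair \<sigma>)) - em (n \<sigma>) \<in> span T"
        for pair :: "'a set \<Rightarrow> ('a \<times> 'a) set" and D and em :: "'a \<Rightarrow> 'a \<times> 'a" and r and c :: "'a set \<Rightarrow> real" and n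
      proof -
        have "(\<Sum>P\<in>\<A>. w P *\<^sub>R \<Sum>(L P)) = (\<Sum>\<sigma>\<in>D. w (pair \<sigma>) *\<^sub>R \<Sum>(L (pair \<sigma>)))"
          unfolding D(1) using D(2) by (simp add: sum.reindex)
        also have "\<dots> = (\<Sum>\<sigma>\<in>D. w (pair \<sigma>) *\<^sub>R (\<Sum>(L (pair \<sigma>)) - em (n \<sigma>))) + (\<Sum>\<sigma>\<in>D. w (pair \<sigma>) *\<^sub>R em (n \<sigma>))"
          by (simp add: scaleR_diff_right sum_subtractf)
        also have "(\<Sum>\<sigma>\<in>D. w (pair \<sigma>) *\<^sub>R em (n \<sigma>)) = r *\<^sub>R em (\<Sum>\<sigma>\<in>D. c \<sigma> *\<^sub>R n \<sigma>)"
          by (simp add: linear_sum[OF em] linear_scale[OF em] scaleR_sum_right wv)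
        also have "(\<Sum>\<sigma>\<in>D. w (pair \<sigma>) *\<^sub>R (\<Sum>(L (pair \<sigma>)) - em (n \<sigma>))) + r *\<^sub>R em (\<Sum>\<sigma>\<in>D. c \<sigma> *\<^sub>R n \<sigma>) \<in> span T"
        proof (rule span_add[OF _ span_scale[OF bal]])
          show "(\<Sum>\<sigma>\<in>D. w (pair \<sigma>) *\<^sub>R (\<Sum>(L (pair \<sigma>)) - em (n \<sigma>))) \<in> span T"
            by (rule span_sum, rule span_scale, rule shift)
        qed
        finally show ?thesis .
      qed
      obtain P0 where "P0 \<in> \<A>" using False by blast
      then obtain a0 b0 where ab0: "a0 \<times> b0 \<in> \<A>" by (auto simp: \<A>_def product_fan_iff)
      have codims: "dim \<rho>\<^sub>1 + k\<^sub>1 \<le> DIM('a)" "dim \<rho>\<^sub>2 + k\<^sub>2 \<le> DIM('a)"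
        using factors[OF ab0] by (auto simp: codim_cones_def)
      \<comment> \<open>The 1 is the dimension which
        \<open>\<rho>\<^sub>1 \<times> \<rho>\<^sub>2\<close> lacks. With the bounds before, exactly
        one factor has codimension one more than its weight.\<close>
      have total: "(dim \<rho>\<^sub>1 + k\<^sub>1) + (dim \<rho>\<^sub>2 + k\<^sub>2) + 1 = DIM('a) + DIM('a)"
        using dsum T(2) m by simp
      show ?thesis
      proof (cases "dim \<rho>\<^sub>2 + k\<^sub>2 = DIM('a)")
        case True
        then have \<rho>1: "\<rho>\<^sub>1 \<in> codim_cones \<Delta> (k\<^sub>1 + 1)" and d1: "dim \<rho>\<^sub>1 + k\<^sub>1 + 1 = DIM('a)"
          using total r1(1) by (auto simp: codim_cones_def)
        have \<rho>2: "\<rho>\<^sub>2 \<in> codim_cones \<Delta> k\<^sub>2" using True r2(1) by (simp add: codim_cones_def)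
        define D where "D = {\<sigma>. \<sigma> \<in> codim_cones \<Delta> k\<^sub>1 \<and> \<rho>\<^sub>1 \<subseteq> \<sigma>}"
        have inj: "inj_on (\<lambda>\<sigma>. \<sigma> \<times> \<rho>\<^sub>2) D"
          using fan_0[OF r2(1)] by (auto simp: inj_on_def times_eq_iff)
        have \<A>: "\<A> = (\<lambda>\<sigma>. \<sigma> \<times> \<rho>\<^sub>2) ` D"
        proof (intro equalityI subsetI)
          fix P assume P: "P \<in> \<A>"
          then obtain a b where ab: "P = a \<times> b" by (auto simp: \<A>_def product_fan_iff)
          have s: "a \<in> codim_cones \<Delta> k\<^sub>1" "b \<in> codim_cones \<Delta> k\<^sub>2" "\<rho>\<^sub>1 face_of a" "\<rho>\<^sub>2 face_of b" "b \<in> \<Delta>"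
            using factors P ab by blast+
          have "\<rho>\<^sub>2 = b"
            using s True by (intro codim_face_eq[OF r2(1) s(5,4)]) (simp add: codim_cones_def)
          then show "P \<in> (\<lambda>\<sigma>. \<sigma> \<times> \<rho>\<^sub>2) ` D"
            using ab s face_of_imp_subset by (auto simp: D_def)
        next
          fix P assume "P \<in> (\<lambda>\<sigma>. \<sigma> \<times> \<rho>\<^sub>2) ` D"
          then obtain \<sigma> where s: "P = \<sigma> \<times> \<rho>\<^sub>2" "\<sigma> \<in> codim_cones \<Delta> k\<^sub>1" "\<rho>\<^sub>1 \<subseteq> \<sigma>" by (auto simp: D_def)
          then have "\<sigma> \<in> \<Delta>" "dim \<sigma> + k\<^sub>1 = DIM('a)" by (auto simp: codim_cones_def)
          moreover have "z \<in> P" using z\<rho> s by auto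
          ultimately show "P \<in> \<A>"
            using s \<rho>2 r2(1) m True dim_product[OF \<open>\<sigma> \<in> \<Delta>\<close> r2(1)]
            by (auto simp: \<A>_def \<Q>_def product_fan_iff)
        qed
        have shift: "\<Sum>(L (\<sigma> \<times> \<rho>\<^sub>2)) - (normal_vector N \<sigma> \<rho>\<^sub>1, 0) \<in> span T" if \<sigma>: "\<sigma> \<in> D" for \<sigma>
        proof -
          have PA: "\<sigma> \<times> \<rho>\<^sub>2 \<in> \<A>" using \<sigma> \<A> by blast
          then obtain b where b: "b \<in> link T" "convex_cone hull (insert b T) \<subseteq> \<sigma> \<times> \<rho>\<^sub>2" "L (\<sigma> \<times> \<rho>\<^sub>2) = {b}"
            using single unfolding \<A>_def by blast
          have PP: "\<sigma> \<times> \<rho>\<^sub>2 \<in> product_fan \<Delta> \<Delta>" "dim (\<sigma> \<times> \<rho>\<^sub>2) = Suc (card T)" "z \<in> \<sigma> \<times> \<rho>\<^sub>2"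
            using PA T(2) by (auto simp: \<A>_def \<Q>_def)
          have "b - (\<lambda>x. (x, 0)) (normal_vector N \<sigma> \<rho>\<^sub>1) \<in> span T"
          proof (rule facet_normal[where pr = fst, OF _ _ _ _ linear_fst _ _ _ _ _ PP(1,2) faceP[OF PP(1,3)] span\<rho> T\<rho> _ b(1,2)])
            show "linear (\<lambda>x :: 'a. (x, 0 :: 'a))" by (simp add: linear_iff)
            show "\<rho>\<^sub>1 \<subseteq> \<sigma>" using \<sigma> by (simp add: D_def)
          qed (use N_0 fan_0[OF r2(1)] in \<open>auto simp: spanT[symmetric] span_zero span_base\<close>)
          then show ?thesis using b(3) by simp
        qed
        have wv: "w (\<sigma> \<times> \<rho>\<^sub>2) = real_of_int (c\<^sub>2 \<rho>\<^sub>2) * real_of_int (c\<^sub>1 \<sigma>)" if "\<sigma> \<in> D" for \<sigma>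
        proof -
          have "\<sigma> \<times> \<rho>\<^sub>2 \<in> product_fan (codim_cones \<Delta> k\<^sub>1) (codim_cones \<Delta> k\<^sub>2)"
            using that \<rho>2 by (auto simp: D_def product_fan_iff)
          moreover have "fst ` (\<sigma> \<times> \<rho>\<^sub>2) = \<sigma>" "snd ` (\<sigma> \<times> \<rho>\<^sub>2) = \<rho>\<^sub>2"
            using that fan_0[OF r2(1)] fan_0[of \<sigma>] by (auto simp: D_def codim_cones_def)
          ultimately show ?thesis by (simp add: w_def product_weight_def)
        qed
        show ?thesis
        proof (rule combine[OF \<A> inj _ wv])
          show "linear (\<lambda>x :: 'a. (x, 0 :: 'a))" by (simp add: linear_iff)
          show "((\<Sum>\<sigma>\<in>D. real_of_int (c\<^sub>1 \<sigma>) *\<^sub>R normal_vector N \<sigma> \<rho>\<^sub>1), 0) \<in> span T"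
            unfolding spanT[symmetric] using minkowski_weight_span[OF c1 \<rho>1, folded D_def] by (simp add: span_zero)
        qed (rule shift | assumption)+
      next
        case False
        then have "dim \<rho>\<^sub>1 + k\<^sub>1 = DIM('a)" and d2: "dim \<rho>\<^sub>2 + k\<^sub>2 + 1 = DIM('a)"
          using total codims by linarith+
        then have \<rho>2: "\<rho>\<^sub>2 \<in> codim_cones \<Delta> (k\<^sub>2 + 1)" and \<rho>1: "\<rho>\<^sub>1 \<in> codim_cones \<Delta> k\<^sub>1"
          using r1(1) r2(1) by (auto simp: codim_cones_def)
        define D where "D = {\<sigma>. \<sigma> \<in> codim_cones \<Delta> k\<^sub>2 \<and> \<rho>\<^sub>2 \<subseteq> \<sigma>}"
        have inj: "inj_on (\<lambda>\<sigma>. \<rho>\<^sub>1 \<times> \<sigma>) D"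
          using fan_0[OF r1(1)] by (auto simp: inj_on_def times_eq_iff)
        have \<A>: "\<A> = (\<lambda>\<sigma>. \<rho>\<^sub>1 \<times> \<sigma>) ` D"
        proof (intro equalityI subsetI)
          fix P assume P: "P \<in> \<A>"
          then obtain a b where ab: "P = a \<times> b" by (auto simp: \<A>_def product_fan_iff)
          have s: "a \<in> codim_cones \<Delta> k\<^sub>1" "b \<in> codim_cones \<Delta> k\<^sub>2" "\<rho>\<^sub>1 face_of a" "\<rho>\<^sub>2 face_of b" "a \<in> \<Delta>"
            using factors P ab by blast+
          have "\<rho>\<^sub>1 = a"
            using s \<open>dim \<rho>\<^sub>1 + k\<^sub>1 = DIM('a)\<close>
            by (intro codim_face_eq[OF r1(1) s(5,3)]) (simp add: codim_cones_def)
          then show "P \<in> (\<lambda>\<sigma>. \<rho>\<^sub>1 \<times> \<sigma>) ` D"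
            using ab s face_of_imp_subset by (auto simp: D_def)
        next
          fix P assume "P \<in> (\<lambda>\<sigma>. \<rho>\<^sub>1 \<times> \<sigma>) ` D"
          then obtain \<sigma> where s: "P = \<rho>\<^sub>1 \<times> \<sigma>" "\<sigma> \<in> codim_cones \<Delta> k\<^sub>2" "\<rho>\<^sub>2 \<subseteq> \<sigma>" by (auto simp: D_def)
          then have "\<sigma> \<in> \<Delta>" "dim \<sigma> + k\<^sub>2 = DIM('a)" by (auto simp: codim_cones_def)
          moreover have "z \<in> P" using z\<rho> s by auto
          ultimately show "P \<in> \<A>"
            using s \<rho>1 r1(1) m \<open>dim \<rho>\<^sub>1 + k\<^sub>1 = DIM('a)\<close> dim_product[OF r1(1) \<open>\<sigma> \<in> \<Delta>\<close>]
            by (auto simp: \<A>_def \<Q>_def product_fan_iff)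
        qed
        have shift: "\<Sum>(L (\<rho>\<^sub>1 \<times> \<sigma>)) - (0, normal_vector N \<sigma> \<rho>\<^sub>2) \<in> span T" if \<sigma>: "\<sigma> \<in> D" for \<sigma>
        proof -
          have PA: "\<rho>\<^sub>1 \<times> \<sigma> \<in> \<A>" using \<sigma> \<A> by blast
          then obtain b where b: "b \<in> link T" "convex_cone hull (insert b T) \<subseteq> \<rho>\<^sub>1 \<times> \<sigma>" "L (\<rho>\<^sub>1 \<times> \<sigma>) = {b}"
            using single unfolding \<A>_def by blast
          have PP: "\<rho>\<^sub>1 \<times> \<sigma> \<in> product_fan \<Delta> \<Delta>" "dim (\<rho>\<^sub>1 \<times> \<sigma>) = Suc (card T)" "z \<in> \<rho>\<^sub>1 \<times> \<sigma>"
            using PA T(2) by (auto simp: \<A>_def \<Q>_def)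
          have "b - (\<lambda>x. (0, x)) (normal_vector N \<sigma> \<rho>\<^sub>2) \<in> span T"
          proof (rule facet_normal[where pr = snd, OF _ _ _ _ linear_snd _ _ _ _ _ PP(1,2) faceP[OF PP(1,3)] span\<rho> T\<rho> _ b(1,2)])
            show "linear (\<lambda>x :: 'a. (0 :: 'a, x))" by (simp add: linear_iff)
            show "\<rho>\<^sub>2 \<subseteq> \<sigma>" using \<sigma> by (simp add: D_def)
          qed (use N_0 fan_0[OF r1(1)] in \<open>auto simp: spanT[symmetric] span_zero span_base\<close>)
          then show ?thesis using b(3) by simp
        qed
        have wv: "w (\<rho>\<^sub>1 \<times> \<sigma>) = real_of_int (c\<^sub>1 \<rho>\<^sub>1) * real_of_int (c\<^sub>2 \<sigma>)" if "\<sigma> \<in> D" for \<sigma>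
        proof -
          have "\<rho>\<^sub>1 \<times> \<sigma> \<in> product_fan (codim_cones \<Delta> k\<^sub>1) (codim_cones \<Delta> k\<^sub>2)"
            using that \<rho>1 by (auto simp: D_def product_fan_iff)
          moreover have "fst ` (\<rho>\<^sub>1 \<times> \<sigma>) = \<rho>\<^sub>1" "snd ` (\<rho>\<^sub>1 \<times> \<sigma>) = \<sigma>"
            using that fan_0[OF r1(1)] fan_0[of \<sigma>] by (auto simp: D_def codim_cones_def)
          ultimately show ?thesis by (simp add: w_def product_weight_def)
        qed
        show ?thesis
        proof (rule combine[OF \<A> inj _ wv])
          show "linear (\<lambda>x :: 'a. (0 :: 'a, x))" by (simp add: linear_iff)
          show "(0, (\<Sum>\<sigma>\<in>D. real_of_int (c\<^sub>2 \<sigma>) *\<^sub>R normal_vector N \<sigma> \<rho>\<^sub>2)) \<in> span T"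
            unfolding spanT[symmetric] using minkowski_weight_span[OF c2 \<rho>2, folded D_def] by (simp add: span_zero)
        qed (rule shift | assumption)+
      qed
    qed (simp add: span_zero)
    finally show ?thesis .
  qed
  finally show "(\<Sum>b\<in>link T. real_of_int (refine_weight \<Delta>' (product_fan \<Delta> \<Delta>) (k\<^sub>1 + k\<^sub>2)
            (product_weight \<Delta> k\<^sub>1 c\<^sub>1 k\<^sub>2 c\<^sub>2) (convex_cone hull (insert b T))) *\<^sub>R b) \<in> span T" .
qed

end

section \<open>Generic displacements\<close>

text \<open>The coordinate functionals of a lattice basis \<open>B\<close> are integral combinations
  of the u i, with coefficient matrix a. If U is the matrix of values of u on \<open>B\<close>,
  expanding u i in the u r and using their independence shows that U a is the identity; so the
  columns of a give the dual vectors.\<close>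

lemma dual_lattice_basis_dual:
  fixes N :: "'a::euclidean_space set"
  assumes N: "full_lattice N" and u: "dual_lattice_basis N u"
  obtains w where "\<And>j. w j \<in> N" "\<And>i j. i < DIM('a) \<Longrightarrow> j < DIM('a) \<Longrightarrow> u i (w j) = of_bool (i = j)"
    and "\<And>x. (\<forall>i<DIM('a). u i x = 0) \<Longrightarrow> x = 0"
proof -
  obtain B where B: "lattice_basis N B" using N by (auto simp: full_lattice_def)
  then have ind: "independent B" "span B = UNIV" by (auto simp: lattice_basis_def)
  have finB: "finite B" by (rule finiteI_independent[OF ind(1)])
  have BN: "B \<subseteq> N" by (rule lattice_basis_subset[OF B])
  have u1: "\<And>i. i < DIM('a) \<Longrightarrow> u i \<in> dual_lattice N"
    and u2: "\<And>m. m \<in> dual_lattice N \<Longrightarrow> \<exists>a::nat \<Rightarrow> int. \<forall>x. m x = (\<Sum>i<DIM('a). real_of_int (a i) * u i x)"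
    and u3: "\<And>a::nat \<Rightarrow> int. (\<forall>x. (\<Sum>i<DIM('a). real_of_int (a i) * u i x) = 0) \<Longrightarrow> (\<forall>i<DIM('a). a i = 0)"
    using u by (auto simp: dual_lattice_basis_def)
  have lin: "linear (u i)" if "i < DIM('a)" for i using u1[OF that] by (simp add: dual_lattice_def)
  have uZ: "u i x \<in> \<int>" if "i < DIM('a)" "x \<in> N" for i x using u1[OF that(1)] that(2) by (simp add: dual_lattice_def)
  have "\<forall>b\<in>B. \<exists>h :: 'a \<Rightarrow> real. linear h \<and> h b = 1 \<and> (\<forall>x\<in>B - {b}. h x = 0) \<and> (\<forall>x\<in>N. h x \<in> \<int>)"
    using lattice_basis_functional[OF B] by blast
  then obtain h :: "'a \<Rightarrow> 'a \<Rightarrow> real" where h: "\<forall>b\<in>B. linear (h b) \<and> h b b = 1 \<and> (\<forall>x\<in>B - {b}. h b x = 0) \<and> (\<forall>x\<in>N. h b x \<in> \<int>)"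
    by metis
  have "\<forall>b\<in>B. \<exists>a::nat \<Rightarrow> int. \<forall>x. h b x = (\<Sum>i<DIM('a). real_of_int (a i) * u i x)"
    using h u2 by (simp add: dual_lattice_def)
  then obtain a :: "'a \<Rightarrow> nat \<Rightarrow> int" where a: "\<forall>b\<in>B. \<forall>x. h b x = (\<Sum>i<DIM('a). real_of_int (a b i) * u i x)"
    by metis
  have expand: "x = (\<Sum>b\<in>B. h b x *\<^sub>R b)" for x
  proof -
    obtain e where e: "x = (\<Sum>b\<in>B. e b *\<^sub>R b)" using span_finite[OF finB] ind(2) by auto
    have "h b x = e b" if b: "b \<in> B" for b
    proof -
      have lh: "linear (h b)" using h b by blast
      have "h b x = (\<Sum>y\<in>B. e y * h b y)" unfolding e by (simp add: linear_sum[OF lh] linear_scale[OF lh])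
      also have "\<dots> = (\<Sum>y\<in>{b}. e y * h b y)" using h b finB by (intro sum.mono_neutral_right) auto
      finally show ?thesis using h b by simp
    qed
    then show ?thesis by (subst e, intro sum.cong) auto
  qed
  define w where "w = (\<lambda>j. \<Sum>b\<in>B. real_of_int (a b j) *\<^sub>R b)"
  have wN: "w j \<in> N" for j
    unfolding w_def by (intro add_subgroup_sum add_subgroup_scale add_subgroup_full_lattice[OF N]) (use BN in blast)
  have uw: "u i (w j) = of_bool (i = j)" if ij: "i < DIM('a)" "j < DIM('a)" for i j
  proof -
    have "\<forall>b\<in>B. \<exists>z::int. u i b = of_int z" using uZ[OF ij(1)] BN by (auto elim!: Ints_cases)
    then obtain U :: "'a \<Rightarrow> int" where U: "\<forall>b\<in>B. u i b = of_int (U b)" by metis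
    have ui: "u i x = (\<Sum>b\<in>B. h b x * u i b)" for x
      by (subst expand[of x]) (simp add: linear_sum[OF lin[OF ij(1)]] linear_scale[OF lin[OF ij(1)]])
    define e where "e = (\<lambda>r. (\<Sum>b\<in>B. U b * a b r) - of_bool (r = i))"
    have "(\<Sum>r<DIM('a). real_of_int (e r) * u r x) = 0" for x
    proof -
      have "u i x = (\<Sum>b\<in>B. \<Sum>r<DIM('a). of_int (U b * a b r) * u r x)"
        unfolding ui[of x] using U a
        by (intro sum.cong refl) (simp add: sum_distrib_left mult_ac)
      also have "\<dots> = (\<Sum>r<DIM('a). \<Sum>b\<in>B. of_int (U b * a b r) * u r x)" by (rule sum.swap)
      finally have "(\<Sum>r<DIM('a). \<Sum>b\<in>B. of_int (U b * a b r) * u r x) = u i x" by simp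
      moreover have "(\<Sum>r<DIM('a). of_bool (r = i) * u r x) = u i x"
        using ij(1) by simp
      ultimately show ?thesis
        by (simp add: e_def left_diff_distrib sum_subtractf sum_distrib_right)
    qed
    then have "\<forall>r<DIM('a). e r = 0" by (intro u3) blast
    then have "e j = 0" using ij(2) by blast
    then have "(\<Sum>b\<in>B. U b * a b j) = of_bool (j = i)" by (simp add: e_def)
    moreover have "u i (w j) = of_int (\<Sum>b\<in>B. U b * a b j)"
      unfolding w_def using U
      by (simp add: linear_sum[OF lin[OF ij(1)]] linear_scale[OF lin[OF ij(1)]] mult.commute)
    ultimately show ?thesis by (cases "i = j") auto
  qed
  have zero: "x = 0" if x: "\<forall>i<DIM('a). u i x = 0" for x
  proof -
    have "h b x = 0" if "b \<in> B" for b using a that x by simp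
    then show "x = 0" by (subst expand) simp
  qed
  show ?thesis by (rule that[OF wN uw zero])
qed

section \<open>Stability of the displacement condition\<close>

lemma convex_cone_hull_uminus:
  "convex_cone hull (uminus ` S) = uminus ` (convex_cone hull S)"
proof -
  have *: "convex_cone hull (uminus ` S) \<subseteq> uminus ` (convex_cone hull S)" for S :: "'b::real_vector set"
    by (intro hull_minimal image_mono hull_subset convex_cone_negations convex_cone_convex_cone_hull)
  have "uminus ` (convex_cone hull S) \<subseteq> uminus ` uminus ` (convex_cone hull (uminus ` S))"
    using *[of "uminus ` S"] by (intro image_mono) (simp add: image_comp o_def)
  then show ?thesis using *[of S] by (simp add: image_comp o_def)
qed

text \<open>The difference is the cone generated by \<open>S\<close> and the negatives of
  \<open>T\<close>, and finitely generated cones are closed.\<close>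

lemma closed_cone_difference:
  fixes N :: "'a::euclidean_space set"
  assumes "rational_cone N \<sigma>" "rational_cone N \<tau>"
  shows "closed {x - y | x y. x \<in> \<sigma> \<and> y \<in> \<tau>}"
proof -
  obtain S T where S: "finite S" "\<sigma> = convex_cone hull S" and T: "finite T" "\<tau> = convex_cone hull T"
    using assms by (auto simp: rational_cone_def)
  have "{x - y | x y. x \<in> \<sigma> \<and> y \<in> \<tau>} = convex_cone hull (S \<union> uminus ` T)"
    unfolding convex_cone_hull_Un convex_cone_hull_uminus S T by force
  then show ?thesis using closed_convex_cone_hull[of "S \<union> uminus ` T"] S(1) T(1) by simp
qed

text \<open>Proper subspaces are null sets, so finitely many of them cannot cover a nonempty open
  set.\<close>

lemma finite_subspaces_avoid:
  fixes U :: "'a::euclidean_space set"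
  assumes "open U" "U \<noteq> {}" "finite \<B>" "\<And>B. B \<in> \<B> \<Longrightarrow> subspace B \<and> B \<noteq> UNIV"
  obtains q where "q \<in> U" "\<And>B. B \<in> \<B> \<Longrightarrow> q \<notin> B"
proof -
  have "negligible B" if "B \<in> \<B>" for B
  proof (rule negligible_lowdim)
    show "dim B < DIM('a)"
      using assms(4)[OF that] subspace_dim_equal[of B UNIV] dim_subset_UNIV[of B]
      by (metis dim_UNIV le_neq_implies_less not_less order_refl subset_UNIV subspace_UNIV)
  qed
  then have "negligible (\<Union>\<B>)" using assms(3) by (intro negligible_Union) auto
  then have "\<not> U \<subseteq> \<Union>\<B>" using open_not_negligible[OF assms(1,2)] negligible_subset by blast
  then show ?thesis using that by blast
qed

lemma displacement_iff:
  fixes v :: "'a::euclidean_space"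
  shows "\<sigma> \<inter> (v +o \<tau>) \<noteq> {} \<longleftrightarrow> v \<in> {x - y | x y. x \<in> \<sigma> \<and> y \<in> \<tau>}"
proof
  assume "\<sigma> \<inter> (v +o \<tau>) \<noteq> {}"
  then obtain x y where "x \<in> \<sigma>" "y \<in> \<tau>" "x = v + y" by (auto simp: elt_set_plus_def)
  then have "v = x - y" by simp
  then show "v \<in> {x - y | x y. x \<in> \<sigma> \<and> y \<in> \<tau>}" using \<open>x \<in> \<sigma>\<close> \<open>y \<in> \<tau>\<close> by blast
next
  assume "v \<in> {x - y | x y. x \<in> \<sigma> \<and> y \<in> \<tau>}"
  then obtain x y where "x \<in> \<sigma>" "y \<in> \<tau>" "v = x - y" by blast
  then have "x \<in> \<sigma>" "x \<in> v +o \<tau>" by (auto simp: elt_set_plus_def intro: bexI[of _ y])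
  then show "\<sigma> \<inter> (v +o \<tau>) \<noteq> {}" by blast
qed

text \<open>Write v = x - y and let F, G be the cones with x, y in their relative interiors. Then v
  lies in \<open>span F + span G\<close>, which by genericity is the whole space; so v can be moved
  in any direction by moving x inside F and y inside G.\<close>

lemma generic_displacement_interior:
  fixes N :: "'a::euclidean_space set"
  assumes fan: "complete_fan N \<Delta>" and v: "generic_displacement \<Delta> v"
    and \<sigma>: "\<sigma> \<in> \<Delta>" "\<tau> \<in> \<Delta>" "v \<in> {x - y | x y. x \<in> \<sigma> \<and> y \<in> \<tau>}"
  shows "v \<in> interior {x - y | x y. x \<in> \<sigma> \<and> y \<in> \<tau>}"
proof -
  have fN: "fan N \<Delta>" and U: "\<Union>\<Delta> = UNIV" using fan by (auto simp: complete_fan_def)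
  obtain x y where xy: "x \<in> \<sigma>" "y \<in> \<tau>" "v = x - y" using \<sigma>(3) by blast
  obtain F where F: "F \<in> \<Delta>" "x \<in> rel_interior F" "\<And>\<sigma>. \<sigma> \<in> \<Delta> \<Longrightarrow> x \<in> \<sigma> \<Longrightarrow> F face_of \<sigma>"
    using fan_carrier_cone[OF fN, of x] U by blast
  obtain G where G: "G \<in> \<Delta>" "y \<in> rel_interior G" "\<And>\<sigma>. \<sigma> \<in> \<Delta> \<Longrightarrow> y \<in> \<sigma> \<Longrightarrow> G face_of \<sigma>"
    using fan_carrier_cone[OF fN, of y] U by blast
  have FG: "F \<subseteq> \<sigma>" "G \<subseteq> \<tau>" using F(3) G(3) \<sigma>(1,2) xy face_of_imp_subset by blast+
  have xs: "x \<in> F" "y \<in> G" using F(2) G(2) rel_interior_subset by blast+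
  have cF: "convex_cone F" "convex_cone G" using fan_convex_cone[OF fN] F(1) G(1) by blast+
  have cv: "convex F" "convex G" using cF by (simp_all add: convex_cone_def)
  have "v = x + (- y)" using xy(3) by simp
  moreover have "x + (- y) \<in> span F + span G"
    using xs by (intro set_plus_intro span_base span_neg)
  ultimately have "v \<in> span F + span G" by simp
  then have full: "span F + span G = UNIV" using v F(1) G(1) unfolding generic_displacement_def by blast
  have conv: "convex {x - y | x y. x \<in> \<sigma> \<and> y \<in> \<tau>}"
  proof -
    have "{x - y | x y. x \<in> \<sigma> \<and> y \<in> \<tau>} = (\<Union>x\<in>\<sigma>. \<Union>y\<in>\<tau>. {x - y})" by auto
    then show ?thesis
      using convex_differences[of \<sigma> \<tau>] fan_convex_cone[OF fN] \<sigma>(1,2) by (simp add: convex_cone_def)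
  qed
  show ?thesis
    unfolding convex_interior_iff[OF conv]
  proof
    fix d
    have "d \<in> span F + span G" using full by simp
    then obtain a b where ab: "a \<in> span F" "b \<in> span G" "d = a + b" by (auto elim: set_plus_elim)
    obtain e1 where e1: "e1 > 0" "x + e1 *\<^sub>R a \<in> F" using rel_interior_cone_move[OF cF(1) F(2) ab(1)] by blast
    have "- b \<in> span G" using ab(2) by (rule span_neg)
    then obtain e2 where e2: "e2 > 0" "y + e2 *\<^sub>R (- b) \<in> G" using rel_interior_cone_move[OF cF(2) G(2)] by blast
    define e where "e = min e1 e2"
    have e: "0 < e" "0 \<le> e" "e \<le> e1" "e \<le> e2" using e1 e2 by (auto simp: e_def)
    have "x + e *\<^sub>R a \<in> F" "y + e *\<^sub>R (- b) \<in> G"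
      using convex_segment_from[OF cv(1) xs(1) e1(2,1) e(2,3)] convex_segment_from[OF cv(2) xs(2) e2(2,1) e(2,4)] by auto
    then have "x + e *\<^sub>R a \<in> \<sigma>" "y + e *\<^sub>R (- b) \<in> \<tau>" using FG by blast+
    moreover have "v + e *\<^sub>R d = (x + e *\<^sub>R a) - (y + e *\<^sub>R (- b))"
      using xy(3) ab(3) by (simp add: algebra_simps)
    ultimately show "\<exists>e>0. v + e *\<^sub>R d \<in> {x - y | x y. x \<in> \<sigma> \<and> y \<in> \<tau>}"
      using e(1) by blast
  qed
qed

text \<open>Each difference of two cones is closed and has v either outside or in its interior;
  finitely many such open conditions define U.\<close>

lemma displacement_locally_constant:
  fixes N :: "'a::euclidean_space set"
  assumes fan: "complete_fan N \<Delta>" and v: "generic_displacement \<Delta> v"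
  obtains U where "open U" "v \<in> U"
    "\<And>q \<sigma> \<tau>. q \<in> U \<Longrightarrow> \<sigma> \<in> \<Delta> \<Longrightarrow> \<tau> \<in> \<Delta> \<Longrightarrow> \<sigma> \<inter> (q +o \<tau>) \<noteq> {} \<longleftrightarrow> \<sigma> \<inter> (v +o \<tau>) \<noteq> {}"
proof -
  define A where "A = (\<lambda>(\<sigma>, \<tau>). {x - y | x y. x \<in> \<sigma> \<and> y \<in> \<tau>} :: 'a set)"
  define V where "V = (\<lambda>p. if v \<in> A p then interior (A p) else - A p)"
  have fN: "fan N \<Delta>" using fan by (simp add: complete_fan_def)
  define U where "U = (\<Inter>p\<in>\<Delta> \<times> \<Delta>. V p)"
  have opV: "open (V p)" if p: "p \<in> \<Delta> \<times> \<Delta>" for p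
  proof -
    obtain \<sigma> \<tau> where p': "p = (\<sigma>, \<tau>)" "\<sigma> \<in> \<Delta>" "\<tau> \<in> \<Delta>" using p by auto
    have "rational_cone N \<sigma>" "rational_cone N \<tau>" using fN p' by (simp_all add: fan_def)
    then have "closed (A p)" unfolding p' A_def using closed_cone_difference by simp
    then show ?thesis by (simp add: V_def open_Compl)
  qed
  have "open U" unfolding U_def using fN opV by (intro open_INT) (auto simp: fan_def)
  moreover have "v \<in> V p" if p: "p \<in> \<Delta> \<times> \<Delta>" for p
  proof -
    obtain \<sigma> \<tau> where p': "p = (\<sigma>, \<tau>)" "\<sigma> \<in> \<Delta>" "\<tau> \<in> \<Delta>" using p by auto
    show ?thesis
      using generic_displacement_interior[OF fan v p'(2,3)] unfolding V_def A_def p' by simp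
  qed
  then have "v \<in> U" by (simp add: U_def)
  moreover have "\<sigma> \<inter> (q +o \<tau>) \<noteq> {} \<longleftrightarrow> \<sigma> \<inter> (v +o \<tau>) \<noteq> {}" if q: "q \<in> U" "\<sigma> \<in> \<Delta>" "\<tau> \<in> \<Delta>" for q \<sigma> \<tau>
  proof -
    have "q \<in> V (\<sigma>, \<tau>)" using q unfolding U_def by blast
    then have "q \<in> A (\<sigma>, \<tau>) \<longleftrightarrow> v \<in> A (\<sigma>, \<tau>)"
      unfolding V_def using interior_subset[of "A (\<sigma>, \<tau>)"] by (auto split: if_splits)
    then show ?thesis unfolding displacement_iff A_def by simp
  qed
  ultimately show ?thesis using that by blast
qed

context unimodular_complex
begin

lemma balanced_cong:
  assumes "\<And>S. S \<in> \<S> \<Longrightarrow> card S = m \<Longrightarrow> c S = c' S"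
  shows "balanced m c \<longleftrightarrow> balanced m c'"
proof -
  have "(\<Sum>b\<in>link T. c (insert b T) *\<^sub>R b) = (\<Sum>b\<in>link T. c' (insert b T) *\<^sub>R b)"
    if "T \<in> \<S>" "card T + 1 = m" for T
    using that assms finite_in_complex[OF that(1)] by (intro sum.cong) (auto simp: link_def)
  then show ?thesis by (simp add: balanced_def)
qed

lemma degree_cong:
  assumes "\<And>S. S \<in> \<S> \<Longrightarrow> card S = m \<Longrightarrow> c S = c' S"
  shows "degree T\<^sub>0 K m c z = degree T\<^sub>0 K m c' z"
  unfolding degree_def using assms by (intro sum.cong) auto

text \<open>The end of the chain of degrees: modulo everything only \<open>T\<^sub>0\<close> itself
  is counted, with index 1.\<close>

lemma degree_UNIV:
  assumes "T\<^sub>0 \<in> \<S>" shows "degree T\<^sub>0 UNIV (card T\<^sub>0) c z = c T\<^sub>0"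
proof -
  have U: "convex_cone hull S + (UNIV :: 'a set) = UNIV" "sublattice \<Lambda> S + \<Lambda> = \<Lambda>" for S
  proof -
    have "x \<in> convex_cone hull S + UNIV" for x
      using set_plus_intro[of 0 "convex_cone hull S" x UNIV] by (simp add: convex_cone_hull_contains_0)
    then show "convex_cone hull S + (UNIV :: 'a set) = UNIV" by blast
    show "sublattice \<Lambda> S + \<Lambda> = \<Lambda>"
    proof
      show "sublattice \<Lambda> S + \<Lambda> \<subseteq> \<Lambda>"
        using add_subgroup_add[OF subgroup] by (auto simp: sublattice_def elim!: set_plus_elim)
      show "\<Lambda> \<subseteq> sublattice \<Lambda> S + \<Lambda>"
        by (rule set_zero_plus2[OF add_subgroup_0[OF subgroup_sublattice]])
    qed
  qed
  have "{S. S \<in> \<S> \<and> T\<^sub>0 \<subseteq> S \<and> card S = card T\<^sub>0 \<and> z \<in> convex_cone hull S + UNIV} = {T\<^sub>0}"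
  proof -
    have "S = T\<^sub>0" if "S \<in> \<S>" "T\<^sub>0 \<subseteq> S" "card S = card T\<^sub>0" for S
      using card_subset_eq[OF finite_in_complex[OF that(1)] that(2)] that(3) by simp
    then show ?thesis using assms by (auto simp: U)
  qed
  then show ?thesis by (simp add: degree_def mult_def U lattice_index_self[OF subgroup])
qed

end

section \<open>Degrees over the diagonal\<close>

context refined_square
begin

definition diagonal :: "('a \<times> 'a) set" where
  "diagonal = {z. fst z = snd z}"

lemma subspace_diagonal: "subspace diagonal"
  unfolding diagonal_def by (auto simp: subspace_def)

text \<open>The difference of the two components has the diagonal as kernel and maps
  \<open>N \<times> N\<close> onto \<open>N\<close>; the subgroup in question goes to the sum of the
  two sublattices.\<close>

lemma mult_diagonal:
  assumes S: "S \<in> complex" "span S = span \<sigma> \<times> span \<tau>"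
  shows "mult diagonal S = real (lattice_index N (sublattice N \<sigma> + sublattice N \<tau>))"
proof -
  define H where "H = sublattice (N \<times> N) S + ((N \<times> N) \<inter> diagonal)"
  define h where "h = (\<lambda>z :: 'a \<times> 'a. fst z - snd z)"
  have h: "linear h" unfolding h_def by (intro linear_compose_sub linear_fst linear_snd)
  have H: "add_subgroup H" unfolding H_def by (rule subgroup_plus[OF subspace_diagonal])
  have HG: "H \<subseteq> N \<times> N"
  proof
    fix x assume "x \<in> H"
    then obtain a b where "x = a + b" "a \<in> N \<times> N" "b \<in> N \<times> N"
      by (auto simp: H_def sublattice_def elim!: set_plus_elim)
    then show "x \<in> N \<times> N" using add_subgroup_add[OF subgroup] by simp
  qed
  have ker: "x \<in> H" if "x \<in> N \<times> N" "h x = 0" for x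
  proof -
    have "x \<in> (N \<times> N) \<inter> diagonal" using that by (simp add: h_def diagonal_def)
    then have "0 + x \<in> H" unfolding H_def using add_subgroup_0[OF subgroup_sublattice] by (intro set_plus_intro)
    then show ?thesis by simp
  qed
  have hN: "h ` (N \<times> N) = N"
  proof
    show "h ` (N \<times> N) \<subseteq> N" using add_subgroup_diff[OF subgroup_N] by (auto simp: h_def)
    show "N \<subseteq> h ` (N \<times> N)"
    proof
      fix x assume "x \<in> N"
      then have "(x, 0) \<in> N \<times> N" "x = h (x, 0)" using N_0 by (auto simp: h_def)
      then show "x \<in> h ` (N \<times> N)" by blast
    qed
  qed
  have hH: "h ` H = sublattice N \<sigma> + sublattice N \<tau>"
  proof (intro equalityI subsetI)
    fix y assume "y \<in> h ` H"
    then obtain a b where ab: "y = h (a + b)" "a \<in> sublattice (N \<times> N) S" "b \<in> diagonal"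
      by (auto simp: H_def elim!: set_plus_elim)
    have "y = fst a + (- snd a)" using ab by (simp add: h_def diagonal_def)
    moreover have "fst a \<in> sublattice N \<sigma>" "- snd a \<in> sublattice N \<tau>"
      using ab(2) S(2) add_subgroup_minus[OF subgroup_N] span_neg
      by (auto simp: sublattice_def)
    ultimately show "y \<in> sublattice N \<sigma> + sublattice N \<tau>" by blast
  next
    fix y assume "y \<in> sublattice N \<sigma> + sublattice N \<tau>"
    then obtain a b where ab: "y = a + b" "a \<in> sublattice N \<sigma>" "b \<in> sublattice N \<tau>" by (auto elim: set_plus_elim)
    have "(a, - b) \<in> sublattice (N \<times> N) S"
      using ab S(2) add_subgroup_minus[OF subgroup_N] span_neg by (auto simp: sublattice_def)
    moreover have "0 \<in> (N \<times> N) \<inter> diagonal"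
      using N_0 by (simp add: diagonal_def zero_prod_def)
    ultimately have "(a, - b) + 0 \<in> H" unfolding H_def by (rule set_plus_intro)
    moreover have "y = h ((a, - b) + 0)" using ab(1) by (simp add: h_def)
    ultimately show "y \<in> h ` H" by blast
  qed
  show ?thesis
    using lattice_index_image[OF subgroup H h ker HG] unfolding hN hH mult_def H_def[symmetric] by simp
qed

text \<open>A point s represents the class of (q, 0) modulo the diagonal if and only if fst s = q +
  snd s, which is the displacement condition. A product cone containing a cone through
  \<open>T\<^sub>0\<close> contains (p, p), so both factors contain \<gamma>, because p is interior
  to it. It remains to see that a product cone contributes at most one cone of the refinement, and
  one whenever the conditions hold.\<close>

lemma degree_diagonal_eq:
  assumes \<gamma>: "\<gamma> \<in> \<Delta>" "p \<in> rel_interior \<gamma>" and T0: "T\<^sub>0 \<in> complex" "positive_combination T\<^sub>0 (p, p)" "T\<^sub>0 \<subseteq> diagonal"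
    and m: "m = card T\<^sub>0 + DIM('a)" "m + (k\<^sub>1 + k\<^sub>2) = DIM('a \<times> 'a)"
    and gen: "generic (q, 0) diagonal"
  shows "degree T\<^sub>0 diagonal m (\<lambda>S. real_of_int (refine_weight \<Delta>' (product_fan \<Delta> \<Delta>) (k\<^sub>1 + k\<^sub>2)
            (product_weight \<Delta> k\<^sub>1 c\<^sub>1 k\<^sub>2 c\<^sub>2) (convex_cone hull S))) (q, 0) =
         (\<Sum>(\<sigma>\<^sub>1, \<sigma>\<^sub>2) \<in> codim_cones \<Delta> k\<^sub>1 \<times> codim_cones \<Delta> k\<^sub>2.
             real (displacement_mult N q \<gamma> \<sigma>\<^sub>1 \<sigma>\<^sub>2) * real_of_int (c\<^sub>1 \<sigma>\<^sub>1) * real_of_int (c\<^sub>2 \<sigma>\<^sub>2))"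
proof -
  define w where "w = (\<lambda>P. real_of_int (product_weight \<Delta> k\<^sub>1 c\<^sub>1 k\<^sub>2 c\<^sub>2 P))"
  define \<Q> where "\<Q> = {P \<in> product_fan \<Delta> \<Delta>. dim P = m}"
  define A where "A = {S. S \<in> complex \<and> T\<^sub>0 \<subseteq> S \<and> card S = m \<and> (q, 0) \<in> convex_cone hull S + diagonal}"
  have finA: "finite A" using finite_complex by (simp add: A_def)
  have finQ: "finite \<Q>" using finite_product by (simp add: \<Q>_def)
  have dim_diag: "dim diagonal = DIM('a)"
  proof -
    have l: "linear (\<lambda>x :: 'a. (x, x))" by (simp add: linear_iff)
    have "diagonal = range (\<lambda>x :: 'a. (x, x))" by (auto simp: diagonal_def)
    then show ?thesis using dim_image_eq[OF l, of UNIV] by (simp add: inj_on_def)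
  qed
  have dimE: "m + dim diagonal = DIM('a \<times> 'a) + card T\<^sub>0" using m(1) dim_diag by simp
  have zT0: "(p, p) \<in> convex_cone hull T\<^sub>0"
    by (rule positive_combination_in_cone[OF complex_finite[OF T0(1)] T0(2)])
  have pP: "(p, p) \<in> convex_cone hull S" if "T\<^sub>0 \<subseteq> S" for S using zT0 hull_mono[OF that] by blast
  have "degree T\<^sub>0 diagonal m (\<lambda>S. real_of_int (refine_weight \<Delta>' (product_fan \<Delta> \<Delta>) (k\<^sub>1 + k\<^sub>2)
            (product_weight \<Delta> k\<^sub>1 c\<^sub>1 k\<^sub>2 c\<^sub>2) (convex_cone hull S))) (q, 0) =
      (\<Sum>S\<in>A. mult diagonal S * (\<Sum>P\<in>\<Q>. of_bool (convex_cone hull S \<subseteq> P) * w P))"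
    unfolding degree_def A_def[symmetric]
  proof (rule sum.cong[OF refl])
    fix S assume S: "S \<in> A"
    then have "S \<in> complex" "card S + (k\<^sub>1 + k\<^sub>2) = DIM('a \<times> 'a)" using m(2) by (simp_all add: A_def)
    from refine_weight_eq_sum[OF this] S
    show "mult diagonal S * real_of_int (refine_weight \<Delta>' (product_fan \<Delta> \<Delta>) (k\<^sub>1 + k\<^sub>2)
            (product_weight \<Delta> k\<^sub>1 c\<^sub>1 k\<^sub>2 c\<^sub>2) (convex_cone hull S)) =
        mult diagonal S * (\<Sum>P\<in>\<Q>. of_bool (convex_cone hull S \<subseteq> P) * w P)"
      by (simp add: \<Q>_def w_def A_def)
  qed
  also have "\<dots> = (\<Sum>S\<in>A. \<Sum>P\<in>\<Q>. w P * (of_bool (convex_cone hull S \<subseteq> P) * mult diagonal S))"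
    by (simp add: sum_distrib_left mult_ac)
  also have "\<dots> = (\<Sum>P\<in>\<Q>. w P * (\<Sum>S\<in>A. of_bool (convex_cone hull S \<subseteq> P) * mult diagonal S))"
    unfolding sum_distrib_left by (rule sum.swap)
  also have "\<dots> = (\<Sum>P\<in>product_fan (codim_cones \<Delta> k\<^sub>1) (codim_cones \<Delta> k\<^sub>2).
      w P * (\<Sum>S\<in>A. of_bool (convex_cone hull S \<subseteq> P) * mult diagonal S))"
  proof (rule sum.mono_neutral_right[OF finQ])
    show "product_fan (codim_cones \<Delta> k\<^sub>1) (codim_cones \<Delta> k\<^sub>2) \<subseteq> \<Q>"
    proof
      fix P assume "P \<in> product_fan (codim_cones \<Delta> k\<^sub>1) (codim_cones \<Delta> k\<^sub>2)"
      then obtain a b where ab: "P = a \<times> b" "a \<in> codim_cones \<Delta> k\<^sub>1" "b \<in> codim_cones \<Delta> k\<^sub>2"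
        by (auto simp: product_fan_iff)
      then have "a \<in> \<Delta>" "b \<in> \<Delta>" "dim a + k\<^sub>1 = DIM('a)" "dim b + k\<^sub>2 = DIM('a)"
        by (auto simp: codim_cones_def)
      then show "P \<in> \<Q>"
        using m(2) dim_product[of a b] unfolding \<Q>_def product_fan_iff ab(1) by auto
    qed
  qed (simp add: w_def product_weight_def)
  also have "\<dots> = (\<Sum>(\<sigma>\<^sub>1, \<sigma>\<^sub>2) \<in> codim_cones \<Delta> k\<^sub>1 \<times> codim_cones \<Delta> k\<^sub>2.
      w (\<sigma>\<^sub>1 \<times> \<sigma>\<^sub>2) * (\<Sum>S\<in>A. of_bool (convex_cone hull S \<subseteq> \<sigma>\<^sub>1 \<times> \<sigma>\<^sub>2) * mult diagonal S))"
  proof (rule sum.reindex_cong[of "\<lambda>(a, b). a \<times> b"])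
    show "inj_on (\<lambda>(a, b). a \<times> b) (codim_cones \<Delta> k\<^sub>1 \<times> codim_cones \<Delta> k\<^sub>2)"
    proof (rule inj_onI, clarify)
      fix a b a' b'
      assume *: "a \<in> codim_cones \<Delta> k\<^sub>1" "b \<in> codim_cones \<Delta> k\<^sub>2" "a' \<in> codim_cones \<Delta> k\<^sub>1" "b' \<in> codim_cones \<Delta> k\<^sub>2"
        and eq: "a \<times> b = a' \<times> b'"
      have "0 \<in> a" "0 \<in> b" "0 \<in> a'" "0 \<in> b'" using * fan_0 by (auto simp: codim_cones_def)
      then show "a = a' \<and> b = b'" using eq unfolding times_eq_iff by blast
    qed
    show "product_fan (codim_cones \<Delta> k\<^sub>1) (codim_cones \<Delta> k\<^sub>2) =
        (\<lambda>(a, b). a \<times> b) ` (codim_cones \<Delta> k\<^sub>1 \<times> codim_cones \<Delta> k\<^sub>2)"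
      by (auto simp: product_fan_def)
  qed auto
  also have "\<dots> = (\<Sum>(\<sigma>\<^sub>1, \<sigma>\<^sub>2) \<in> codim_cones \<Delta> k\<^sub>1 \<times> codim_cones \<Delta> k\<^sub>2.
             real (displacement_mult N q \<gamma> \<sigma>\<^sub>1 \<sigma>\<^sub>2) * real_of_int (c\<^sub>1 \<sigma>\<^sub>1) * real_of_int (c\<^sub>2 \<sigma>\<^sub>2))"
  proof (rule sum.cong[OF refl], clarify)
    fix \<sigma>\<^sub>1 \<sigma>\<^sub>2 assume s: "\<sigma>\<^sub>1 \<in> codim_cones \<Delta> k\<^sub>1" "\<sigma>\<^sub>2 \<in> codim_cones \<Delta> k\<^sub>2"
    define P where "P = \<sigma>\<^sub>1 \<times> \<sigma>\<^sub>2"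
    have s\<Delta>: "\<sigma>\<^sub>1 \<in> \<Delta>" "\<sigma>\<^sub>2 \<in> \<Delta>" "dim \<sigma>\<^sub>1 + k\<^sub>1 = DIM('a)" "dim \<sigma>\<^sub>2 + k\<^sub>2 = DIM('a)"
      using s by (auto simp: codim_cones_def)
    have P: "P \<in> product_fan \<Delta> \<Delta>" "dim P = m"
      using s\<Delta> m(2) dim_product[OF s\<Delta>(1,2)] by (auto simp: P_def product_fan_iff)
    have wP: "w P = real_of_int (c\<^sub>1 \<sigma>\<^sub>1) * real_of_int (c\<^sub>2 \<sigma>\<^sub>2)"
    proof -
      have "P \<in> product_fan (codim_cones \<Delta> k\<^sub>1) (codim_cones \<Delta> k\<^sub>2)" using s by (auto simp: P_def product_fan_iff)
      moreover have "fst ` P = \<sigma>\<^sub>1" "snd ` P = \<sigma>\<^sub>2" using fan_0[OF s\<Delta>(1)] fan_0[OF s\<Delta>(2)] by (auto simp: P_def)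
      ultimately show ?thesis by (simp add: w_def product_weight_def)
    qed
    define E where "E = {S \<in> A. convex_cone hull S \<subseteq> P}"
    have sumE: "(\<Sum>S\<in>A. of_bool (convex_cone hull S \<subseteq> P) * mult diagonal S) = (\<Sum>S\<in>E. mult diagonal S)"
      using finA by (intro sum.mono_neutral_cong_right) (auto simp: E_def)
    have spanS: "span S = span \<sigma>\<^sub>1 \<times> span \<sigma>\<^sub>2" if "S \<in> E" for S
    proof -
      have "span P = span S"
        using that P(2) by (intro span_cone_eq) (auto simp: E_def A_def)
      then show ?thesis using span_Times_0[OF fan_0[OF s\<Delta>(1)] fan_0[OF s\<Delta>(2)]] by (simp add: P_def)
    qed
    have cond: "\<gamma> \<subseteq> \<sigma>\<^sub>1 \<and> \<gamma> \<subseteq> \<sigma>\<^sub>2 \<and> \<sigma>\<^sub>1 \<inter> (q +o \<sigma>\<^sub>2) \<noteq> {}" if SE: "S \<in> E" for S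
    proof -
      have SP: "convex_cone hull S \<subseteq> P" and SA: "T\<^sub>0 \<subseteq> S" "(q, 0) \<in> convex_cone hull S + diagonal"
        using SE by (auto simp: E_def A_def)
      have "(p, p) \<in> P" using pP[OF SA(1)] SP by blast
      then have pp: "p \<in> \<sigma>\<^sub>1" "p \<in> \<sigma>\<^sub>2" by (auto simp: P_def)
      have sub: "\<gamma> \<subseteq> \<sigma>" if "\<sigma> \<in> \<Delta>" "p \<in> \<sigma>" for \<sigma>
      proof -
        have "\<gamma> \<inter> \<sigma> face_of \<gamma>" by (rule fan_Int_face[OF fan_N \<gamma>(1) that(1)])
        moreover have "p \<in> \<gamma> \<inter> \<sigma>" using \<gamma>(2) that(2) rel_interior_subset by blast
        moreover have "p \<in> rel_interior \<gamma>" by (rule \<gamma>(2))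
        ultimately have "\<gamma> \<subseteq> \<gamma> \<inter> \<sigma>"
          by (intro subset_of_face_of[of "\<gamma> \<inter> \<sigma>" \<gamma> \<gamma>] order_refl) blast+
        then show ?thesis by blast
      qed
      obtain s d where sd: "s \<in> convex_cone hull S" "d \<in> diagonal" "(q, 0) = s + d"
        using SA(2) by (auto elim: set_plus_elim)
      have fs: "fst s \<in> \<sigma>\<^sub>1" "snd s \<in> \<sigma>\<^sub>2" using sd(1) SP by (auto simp: P_def)
      have "fst d = - snd s" using sd(2,3) by (simp add: prod_eq_iff diagonal_def add_eq_0_iff)
      moreover have "q = fst s + fst d" using sd(3) by (simp add: prod_eq_iff)
      ultimately have "fst s = q + snd s" by simp
      then have "fst s \<in> q +o \<sigma>\<^sub>2" using fs(2) by (metis set_plus_intro2)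
      then show ?thesis using fs(1) sub s\<Delta> pp by blast
    qed
    have unique: "S = S'" if SE: "S \<in> E" "S' \<in> E" for S S'
    proof -
      have SS: "S \<in> complex" "T\<^sub>0 \<subseteq> S" "card S = m" "(q, 0) \<in> convex_cone hull S + diagonal" "convex_cone hull S \<subseteq> P"
        and SS': "S' \<in> complex" "T\<^sub>0 \<subseteq> S'" "card S' = m" "(q, 0) \<in> convex_cone hull S' + diagonal" "convex_cone hull S' \<subseteq> P"
        using SE by (auto simp: E_def A_def)
      obtain s d where sd: "s \<in> convex_cone hull S" "d \<in> diagonal" "(q, 0) = s + d"
        using SS(4) by (auto elim: set_plus_elim)
      obtain s' d' where sd': "s' \<in> convex_cone hull S'" "d' \<in> diagonal" "(q, 0) = s' + d'"
        using SS'(4) by (auto elim: set_plus_elim)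
      have hit: "span S + diagonal = UNIV"
      proof -
        have "(q, 0) \<in> span S + diagonal"
          using SS(4) set_plus_mono2[OF convex_cone_hull_subset_span[of S] order_refl[of diagonal]] by blast
        then show ?thesis using gen SS(1) by (simp add: generic_def)
      qed
      have int: "span S \<inter> diagonal = span T\<^sub>0"
        by (rule span_Int_eq[OF SS(1,2) T0(3) subspace_diagonal _ hit]) (use dimE SS(3) in simp)
      have "s \<in> span S" "s' \<in> span S"
        using sd(1) sd'(1) convex_cone_hull_subset_span spanS[OF SE(1)] spanS[OF SE(2)] by blast+
      then have "s - s' \<in> span S" by (rule span_diff)
      moreover have "s - s' = d' - d"
      proof -
        have "s = (q, 0) - d" "s' = (q, 0) - d'" using sd(3) sd'(3) by (metis add_diff_cancel_right')+
        then show ?thesis by simp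
      qed
      then have "s - s' \<in> diagonal" using sd(2) sd'(2) subspace_diff[OF subspace_diagonal] by metis
      ultimately have "s - s' \<in> span T\<^sub>0" using int by blast
      \<comment> \<open>s and s' agree modulo \<open>span T\<^sub>0\<close>; a shift by g produces a
        common point of both cones without changing the class modulo the diagonal. Genericity then
        forces the common face to have full cardinality.\<close>
      then obtain g where g: "g \<in> convex_cone hull T\<^sub>0" "(s - s') + g \<in> convex_cone hull T\<^sub>0"
        using span_shift_cone[OF complex_finite[OF T0(1)]] by blast
      have mono: "convex_cone hull T\<^sub>0 \<subseteq> convex_cone hull S" "convex_cone hull T\<^sub>0 \<subseteq> convex_cone hull S'"
        using SS(2) SS'(2) by (simp_all add: hull_mono)
      have "s + g \<in> convex_cone hull S" by (rule convex_cone_hull_add) (use sd(1) g(1) mono in auto)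
      moreover have "s' + ((s - s') + g) \<in> convex_cone hull S'" by (rule convex_cone_hull_add) (use sd'(1) g(2) mono in auto)
      then have "s + g \<in> convex_cone hull S'" by simp
      ultimately have "s + g \<in> convex_cone hull (S \<inter> S')" using cone_Int[OF SS(1) SS'(1)] by blast
      then have sg: "s + g \<in> span (S \<inter> S')" using convex_cone_hull_subset_span by blast
      have dg: "d - g \<in> diagonal"
      proof (rule subspace_diff[OF subspace_diagonal sd(2)])
        show "g \<in> diagonal"
          using g(1) convex_cone_hull_subset_span span_minimal[OF T0(3) subspace_diagonal] by blast
      qed
      have "(s + g) + (d - g) \<in> span (S \<inter> S') + diagonal" by (rule set_plus_intro[OF sg dg])
      then have "(q, 0) \<in> span (S \<inter> S') + diagonal" using sd(3) by simp
      moreover have SI: "S \<inter> S' \<in> complex" using complex_subset[OF SS(1)] by blast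
      ultimately have full: "span (S \<inter> S') + diagonal = UNIV" using gen by (simp add: generic_def)
      have "\<not> card (S \<inter> S') + dim diagonal < DIM('a \<times> 'a) + card T\<^sub>0"
        using span_plus_proper[OF SI _ T0(3) subspace_diagonal] full SS(2) SS'(2) by blast
      then have "m \<le> card (S \<inter> S')" using dimE by simp
      then have "S \<inter> S' = S" "S \<inter> S' = S'"
        using SS(3) SS'(3) card_seteq[OF complex_finite[OF SS(1)] Int_lower1]
          card_seteq[OF complex_finite[OF SS'(1)] Int_lower2] by simp_all
      then show ?thesis by simp
    qed
    have exist: "E \<noteq> {}" if c: "\<gamma> \<subseteq> \<sigma>\<^sub>1" "\<gamma> \<subseteq> \<sigma>\<^sub>2" "\<sigma>\<^sub>1 \<inter> (q +o \<sigma>\<^sub>2) \<noteq> {}"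
    proof -
      obtain x y where xy: "x \<in> \<sigma>\<^sub>1" "y \<in> \<sigma>\<^sub>2" "x = q + y" using c(3) by (auto simp: elt_set_plus_def)
      have "p \<in> \<gamma>" using \<gamma>(2) rel_interior_subset by blast
      then have ppP: "(p, p) \<in> P" using c by (auto simp: P_def)
      have "(x, y) \<in> P" using xy by (simp add: P_def)
      then have "(p, p) + (x, y) \<in> P" by (rule convex_cone_add[OF product_cone(1)[OF P(1)] ppP])
      then have "(p, p) + 1 *\<^sub>R (x, y) \<in> P" by simp
      then obtain e S where S: "e > 0" "S \<in> complex" "T\<^sub>0 \<subseteq> S" "convex_cone hull S \<subseteq> P"
        "positive_combination S ((p, p) + e *\<^sub>R (x, y))"
        using local_cone[OF T0(1,2) P(1) ppP zero_less_one] by blast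
      \<comment> \<open>(p, p) vanishes modulo the diagonal, so after division by e this point has
        the class of (x, y), which is that of (q, 0).\<close>
      define s where "s = (1 / e) *\<^sub>R ((p, p) + e *\<^sub>R (x, y))"
      have sS: "s \<in> convex_cone hull S"
        unfolding s_def using positive_combination_in_cone[OF complex_finite[OF S(2)] S(5)] S(1)
        by (intro convex_cone_hull_mul) auto
      have "(q, 0) = s + (- (y + (1 / e) *\<^sub>R p), - (y + (1 / e) *\<^sub>R p))"
        using xy(3) S(1) by (simp add: s_def algebra_simps)
      moreover have "(- (y + (1 / e) *\<^sub>R p), - (y + (1 / e) *\<^sub>R p)) \<in> diagonal" by (simp add: diagonal_def)
      ultimately have hitS: "(q, 0) \<in> convex_cone hull S + diagonal" using sS by (metis set_plus_intro)
      then have "(q, 0) \<in> span S + diagonal"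
        using set_plus_mono2[OF convex_cone_hull_subset_span[of S] order_refl[of diagonal]] by blast
      then have full: "span S + diagonal = UNIV" using gen S(2) by (simp add: generic_def)
      have "\<not> card S + dim diagonal < DIM('a \<times> 'a) + card T\<^sub>0"
        using span_plus_proper[OF S(2,3) T0(3) subspace_diagonal] full by blast
      then have "m \<le> card S" using dimE by simp
      moreover have "card S \<le> m" using card_le_dim[OF S(2,4)] P(2) by simp
      ultimately have "S \<in> E" using S hitS by (simp add: E_def A_def)
      then show ?thesis by blast
    qed
    have "(\<Sum>S\<in>E. mult diagonal S) = real (displacement_mult N q \<gamma> \<sigma>\<^sub>1 \<sigma>\<^sub>2)"
    proof (cases "E = {}")
      case True
      then show ?thesis using exist by (auto simp: displacement_mult_def)
    next
      case False
      then obtain S where S: "S \<in> E" by blast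
      then have "E = {S}" using unique by blast
      moreover have "S \<in> complex" using S by (simp add: E_def A_def)
      ultimately show ?thesis
        using mult_diagonal[OF _ spanS[OF S]] cond[OF S] by (simp add: displacement_mult_def)
    qed
    then show "w (\<sigma>\<^sub>1 \<times> \<sigma>\<^sub>2) * (\<Sum>S\<in>A. of_bool (convex_cone hull S \<subseteq> \<sigma>\<^sub>1 \<times> \<sigma>\<^sub>2) * mult diagonal S) =
        real (displacement_mult N q \<gamma> \<sigma>\<^sub>1 \<sigma>\<^sub>2) * real_of_int (c\<^sub>1 \<sigma>\<^sub>1) * real_of_int (c\<^sub>2 \<sigma>\<^sub>2)"
      using sumE wP unfolding P_def by simp
  qed
  finally show ?thesis .
qed

end

section \<open>The coordinate functions and the chain of subspaces \<open>K i\<close>\<close>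

locale refined_square_coordinates = refined_square N \<Delta> \<Delta>'
  for N :: "'a::euclidean_space set" and \<Delta> and \<Delta>' :: "('a \<times> 'a) set set" +
  fixes u :: "nat \<Rightarrow> 'a \<Rightarrow> real"
  assumes dual_basis: "dual_lattice_basis N u"
    and chi_linear: "\<And>i. i < DIM('a) \<Longrightarrow> linear_on_cones \<Delta>' (chi u i)"
begin

definition l :: "nat \<Rightarrow> 'a \<times> 'a \<Rightarrow> real" where
  "l i = (\<lambda>z. u i (snd z) - u i (fst z))"

definition K :: "nat \<Rightarrow> ('a \<times> 'a) set" where
  "K i = {z. \<forall>r\<in>{i..<DIM('a)}. l r z = 0}"

lemma chi_eq: "chi u i = (\<lambda>z. min 0 (l i z))"
  by (auto simp: chi_def l_def split: prod.splits)

lemma u_linear: "i < DIM('a) \<Longrightarrow> linear (u i)"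
  using dual_basis by (simp add: dual_lattice_basis_def dual_lattice_def)

lemma u_integral: "i < DIM('a) \<Longrightarrow> x \<in> N \<Longrightarrow> u i x \<in> \<int>"
  using dual_basis by (simp add: dual_lattice_basis_def dual_lattice_def)

lemma l_linear:
  assumes "i < DIM('a)" shows "linear (l i)"
proof -
  have "linear (\<lambda>z. u i (snd z))" "linear (\<lambda>z. u i (fst z))"
    using linear_compose[OF linear_snd u_linear[OF assms]] linear_compose[OF linear_fst u_linear[OF assms]]
    by (simp_all add: o_def)
  then show ?thesis unfolding l_def by (rule linear_compose_sub)
qed

lemma l_dual: "i < DIM('a) \<Longrightarrow> l i \<in> dual_lattice (N \<times> N)"
  using l_linear u_integral by (auto simp: dual_lattice_def l_def)

lemma l_sign:
  assumes "i < DIM('a)" "S \<in> complex"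
  shows "(\<forall>b\<in>S. l i b \<ge> 0) \<or> (\<forall>b\<in>S. l i b \<le> 0)"
  using linear_on_cones_sign[OF l_linear[OF assms(1)] _ assms(2)] chi_linear[OF assms(1)] by (simp add: chi_eq)

lemma subspace_K: "subspace (K i)"
  unfolding K_def subspace_def
  by (auto simp: linear_0[OF l_linear] linear_add[OF l_linear] linear_scale[OF l_linear])

lemma K_Suc: "i < DIM('a) \<Longrightarrow> K i = {z \<in> K (Suc i). l i z = 0}"
  unfolding K_def by (auto simp: atLeastLessThan_iff le_less Suc_le_eq)

lemma K_DIM: "K DIM('a) = UNIV"
  by (simp add: K_def)

lemma K_0: "K 0 = diagonal"
proof -
  obtain w where w: "\<And>j. w j \<in> N" "\<And>i j. i < DIM('a) \<Longrightarrow> j < DIM('a) \<Longrightarrow> u i (w j) = of_bool (i = j)"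
    and zero: "\<And>x. (\<forall>i<DIM('a). u i x = 0) \<Longrightarrow> x = 0"
    by (rule dual_lattice_basis_dual[OF full_N dual_basis]) blast
  show ?thesis
  proof (intro equalityI subsetI)
    fix z assume "z \<in> K 0"
    then have "\<forall>i<DIM('a). u i (snd z - fst z) = 0"
      by (simp add: K_def l_def linear_diff[OF u_linear])
    then have "snd z - fst z = 0" by (rule zero)
    then show "z \<in> diagonal" by (simp add: diagonal_def)
  qed (simp add: K_def l_def diagonal_def)
qed

lemma coordinate_vector:
  assumes i: "i < DIM('a)"
  obtains f where "f \<in> N \<times> N" "f \<in> K (Suc i)" "l i f = 1"
proof -
  obtain w where w: "\<And>j. w j \<in> N" "\<And>i j. i < DIM('a) \<Longrightarrow> j < DIM('a) \<Longrightarrow> u i (w j) = of_bool (i = j)"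
    and zero: "\<And>x. (\<forall>i<DIM('a). u i x = 0) \<Longrightarrow> x = 0"
    by (rule dual_lattice_basis_dual[OF full_N dual_basis]) blast
  have u0: "u r 0 = 0" if "r < DIM('a)" for r using linear_0[OF u_linear[OF that]] .
  show ?thesis
  proof (rule that[of "(0, w i)"])
    show "(0, w i) \<in> N \<times> N" using w(1) N_0 by simp
    show "(0, w i) \<in> K (Suc i)" using w(2) i u0 by (simp add: K_def l_def)
    show "l i (0, w i) = 1" using w(2) i u0 by (simp add: l_def)
  qed
qed

lemma dim_K: "i \<le> DIM('a) \<Longrightarrow> dim (K i) = DIM('a) + i"
proof (induction "DIM('a) - i" arbitrary: i)
  case 0
  then have "i = DIM('a)" by simp
  then show ?case by (simp add: K_DIM)
next
  case (Suc n)
  then have i: "i < DIM('a)" by simp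
  obtain f where f: "f \<in> N \<times> N" "f \<in> K (Suc i)" "l i f = 1" using coordinate_vector[OF i] by blast
  have "dim (K (Suc i)) = Suc (dim (K i))"
    by (rule dim_kernel_step[OF subspace_K l_linear[OF i] K_Suc[OF i] f(2,3)])
  moreover have "dim (K (Suc i)) = DIM('a) + Suc i" using Suc i by (intro Suc.hyps(1)) simp_all
  ultimately show ?case by simp
qed

section \<open>The iterated weights, their supports and degrees\<close>

definition kappa_weight :: "nat \<Rightarrow> (('a \<times> 'a) set \<Rightarrow> int) \<Rightarrow> nat \<Rightarrow> ('a \<times> 'a) set \<Rightarrow> real" where
  "kappa_weight k c i S = real_of_int (kappa_iter (N \<times> N) \<Delta>' k c (chi u) i (convex_cone hull S))"

lemma kappa_weight_0: "kappa_weight k c 0 = (\<lambda>S. real_of_int (c (convex_cone hull S)))"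
  by (simp add: kappa_weight_def fun_eq_iff)

text \<open>d stands for the dimension of \<gamma>; with n the rank of \<open>N\<close>, the weight
  after i steps lives in dimension d + n - i.\<close>

context
  fixes c :: "('a \<times> 'a) set \<Rightarrow> int" and k d :: nat
  assumes k: "d + DIM('a) + k = DIM('a \<times> 'a)"
    and bal: "balanced (d + DIM('a)) (\<lambda>S. real_of_int (c (convex_cone hull S)))"
begin

abbreviation iter :: "nat \<Rightarrow> ('a \<times> 'a) set \<Rightarrow> real" where
  "iter \<equiv> kappa_weight k c"

lemma iter_Suc:
  assumes i: "i < DIM('a)" and bali: "balanced (d + (DIM('a) - i)) (iter i)"
    and S: "S \<in> complex" "card S = d + (DIM('a) - Suc i)"
  shows "iter (Suc i) S = divisor (\<lambda>z. - l i z) (iter i) S"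
proof -
  have card: "Suc (card S) = d + (DIM('a) - i)" using S(2) i by simp
  have "Suc (card S) + (k + i) = DIM('a \<times> 'a)" using card k i by simp
  then have "real_of_int (kappa (N \<times> N) \<Delta>' (k + i) (kappa_iter (N \<times> N) \<Delta>' k c (chi u) i) (\<lambda>x. min 0 (l i x)) (convex_cone hull S)) =
         divisor (\<lambda>x. - l i x) (\<lambda>S. real_of_int (kappa_iter (N \<times> N) \<Delta>' k c (chi u) i (convex_cone hull S))) S"
    using l_sign[OF i] bali card
    by (intro kappa_divisor[OF S(1) _ l_dual[OF i]]) (simp_all add: kappa_weight_def[abs_def])
  then show ?thesis by (simp add: kappa_weight_def[abs_def] chi_eq)
qed

text \<open>Balancing after i steps is what turns step i + 1 into a divisor
  (\<open>iter_Suc\<close>), and divisors are balanced again.\<close>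

lemma balanced_iter: "i \<le> DIM('a) \<Longrightarrow> balanced (d + (DIM('a) - i)) (iter i)"
proof (induction i)
  case 0
  then show ?case using bal by (simp add: kappa_weight_0)
next
  case (Suc i)
  then have i: "i < DIM('a)" and IH: "balanced (d + (DIM('a) - i)) (iter i)" by simp_all
  have eq: "d + (DIM('a) - i) = Suc (d + (DIM('a) - Suc i))" using i by simp
  have "balanced (d + (DIM('a) - Suc i)) (divisor (\<lambda>z. - l i z) (iter i))"
  proof (rule balanced_divisor)
    show "balanced (Suc (d + (DIM('a) - Suc i))) (iter i)" using IH unfolding eq .
    show "linear (\<lambda>z. - l i z)" by (rule linear_compose_neg[OF l_linear[OF i]])
    show "(\<forall>b\<in>S. - l i b \<ge> 0) \<or> (\<forall>b\<in>S. - l i b \<le> 0)" if "S \<in> complex" for S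
      using l_sign[OF i that] by auto
  qed
  then show ?case
    using balanced_cong[of "d + (DIM('a) - Suc i)" "iter (Suc i)" "divisor (\<lambda>z. - l i z) (iter i)"]
      iter_Suc[OF i IH] by blast
qed

text \<open>A nonzero value at \<open>S\<close> requires \<open>l i\<close> to vanish on
  \<open>S\<close> and the preceding weight to be nonzero at some \<open>insert b S\<close>, from
  which \<open>S\<close> inherits the earlier equations.\<close>

lemma iter_support:
  "i \<le> DIM('a) \<Longrightarrow> S \<in> complex \<Longrightarrow> card S = d + (DIM('a) - i) \<Longrightarrow> iter i S \<noteq> 0 \<Longrightarrow> \<forall>r<i. \<forall>b\<in>S. l r b = 0"
proof (induction i arbitrary: S)
  case (Suc i)
  then have i: "i < DIM('a)" by simp
  have "divisor (\<lambda>z. - l i z) (iter i) S \<noteq> 0"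
    using Suc.prems iter_Suc[OF i balanced_iter] i by simp
  then have zero: "\<forall>b\<in>S. l i b = 0"
    and "(\<Sum>b | b \<in> link S \<and> - l i b > 0. - l i b * iter i (insert b S)) \<noteq> 0"
    by (auto simp: divisor_def split: if_splits)
  then obtain b where b: "b \<in> link S" "iter i (insert b S) \<noteq> 0"
    using sum.neutral[of "{b. b \<in> link S \<and> - l i b > 0}" "\<lambda>b. - l i b * iter i (insert b S)"] by auto
  have "insert b S \<in> complex" "card (insert b S) = d + (DIM('a) - i)"
    using b(1) Suc.prems(3) complex_finite[OF Suc.prems(2)] i by (auto simp: link_def)
  then have "\<forall>r<i. \<forall>x\<in>insert b S. l r x = 0" using Suc.IH b(2) i by simp
  then show ?case using zero by (auto simp: less_Suc_eq)
qed simp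

lemma iter_diagonal:
  assumes "S \<in> complex" "card S = d" "iter DIM('a) S \<noteq> 0"
  shows "S \<subseteq> diagonal"
proof -
  have "\<forall>r<DIM('a). \<forall>b\<in>S. l r b = 0" using iter_support[OF order_refl assms(1) _ assms(3)] assms(2) by simp
  then show ?thesis unfolding K_0[symmetric] K_def by auto
qed

lemma degree_iter:
  assumes T0: "T\<^sub>0 \<in> complex" "card T\<^sub>0 = d" "T\<^sub>0 \<subseteq> diagonal"
    and gen: "\<And>i. i \<le> DIM('a) \<Longrightarrow> generic z (K i)" and nz: "\<And>i. i < DIM('a) \<Longrightarrow> l i z \<noteq> 0"
  shows "iter DIM('a) T\<^sub>0 = degree T\<^sub>0 diagonal (d + DIM('a)) (iter 0) z"
proof -
  have "degree T\<^sub>0 (K 0) (d + DIM('a)) (iter 0) z = degree T\<^sub>0 (K i) (d + (DIM('a) - i)) (iter i) z"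
    if "i \<le> DIM('a)" for i
    using that
  proof (induction i)
    case (Suc i)
    then have i: "i < DIM('a)" by simp
    define m where "m = d + (DIM('a) - Suc i)"
    have m: "d + (DIM('a) - i) = Suc m" using i by (simp add: m_def)
    have bali: "balanced (Suc m) (iter i)" using balanced_iter[of i] i m by simp
    have T0K: "T\<^sub>0 \<subseteq> K i" using T0(3) unfolding K_0[symmetric] by (auto simp: K_def)
    have dimK: "Suc m + dim (K i) = DIM('a \<times> 'a) + card T\<^sub>0" using dim_K[of i] i T0(2) by (simp add: m_def)
    obtain f where f: "f \<in> N \<times> N" "f \<in> K (Suc i)" "l i f = 1" using coordinate_vector[OF i] by blast
    have lZ: "l i x \<in> \<int>" if "x \<in> N \<times> N" for x using l_dual[OF i] that unfolding dual_lattice_def by blast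
    have gi: "generic z (K i)" "generic z (K (Suc i))" using gen i by simp_all
    have "degree T\<^sub>0 (K i) (Suc m) (iter i) z = degree T\<^sub>0 (K (Suc i)) m (divisor (\<lambda>z. - l i z) (iter i)) z"
    \<comment> \<open>The new weight is a divisor of \<open>- l i\<close>. For
      \<open>l i z < 0\<close> this fits \<open>degree_divisor\<close> with \<open>- l i\<close> and
      \<open>- f\<close>; for \<open>l i z > 0\<close> the sign is changed by
      \<open>divisor_uminus\<close>.\<close>
    proof (cases "l i z > 0")
      case True
      have "degree T\<^sub>0 (K i) (Suc m) (iter i) z = degree T\<^sub>0 (K (Suc i)) m (divisor (l i) (iter i)) z"
        by (rule degree_divisor[OF bali T0K subspace_K l_linear[OF i] lZ K_Suc[OF i] f dimK l_sign[OF i] True gi])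
      also have "\<dots> = degree T\<^sub>0 (K (Suc i)) m (divisor (\<lambda>z. - l i z) (iter i)) z"
        by (rule degree_cong) (simp add: divisor_uminus[OF bali _ _ l_linear[OF i]])
      finally show ?thesis .
    next
      case False
      then have neg: "- l i z > 0" using nz[OF i] by simp
      show ?thesis
      proof (rule degree_divisor[where \<phi> = "\<lambda>z. - l i z" and f = "- f", OF bali T0K subspace_K _ _ _ _ _ _ dimK _ neg gi])
        show "linear (\<lambda>z. - l i z)" by (rule linear_compose_neg[OF l_linear[OF i]])
        show "- l i x \<in> \<int>" if "x \<in> N \<times> N" for x using lZ[OF that] by simp
        show "K i = {x \<in> K (Suc i). - l i x = 0}" using K_Suc[OF i] by simp
        show "- f \<in> N \<times> N" using f(1) add_subgroup_minus[OF subgroup] by blast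
        show "- f \<in> K (Suc i)" using f(2) subspace_neg[OF subspace_K] by blast
        show "- l i (- f) = 1" using f(3) by (simp add: linear_neg[OF l_linear[OF i]])
        show "(\<forall>b\<in>S. - l i b \<ge> 0) \<or> (\<forall>b\<in>S. - l i b \<le> 0)" if "S \<in> complex" for S
          using l_sign[OF i that] by auto
      qed
    qed
    also have "\<dots> = degree T\<^sub>0 (K (Suc i)) m (iter (Suc i)) z"
      using iter_Suc[OF i balanced_iter] i by (intro degree_cong) (simp add: m_def)
    finally show ?case using Suc.IH i m by (simp add: m_def)
  qed simp
  from this[of "DIM('a)"] show ?thesis
    using degree_UNIV[OF T0(1)] T0(2) by (simp add: K_0 K_DIM)
qed

end

text \<open>Let \<open>T\<close> generate the cone with (p, p) in its interior. Each
  \<open>l i\<close> has one sign on \<open>T\<close> and vanishes at (p, p), hence on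
  \<open>T\<close>, so \<open>T\<close> lies in the diagonal. Genericity of p gives \<open>T\<close>
  the dimension of \<gamma>, and the first projection identifies the diagonal lattice with
  \<open>N\<close>, so the index is 1. Any other cone in the sum with nonzero weight would lie in
  the diagonal and contain (p, p), hence be this one.\<close>

lemma pushforward_eq:
  fixes e :: "('a \<times> 'a) set \<Rightarrow> int"
  assumes \<gamma>: "\<gamma> \<in> \<Delta>" and p: "generic_point \<Delta>' \<gamma> p"
    and supp: "\<And>S. S \<in> complex \<Longrightarrow> card S = dim \<gamma> \<Longrightarrow> e (convex_cone hull S) \<noteq> 0 \<Longrightarrow> S \<subseteq> diagonal"
  shows "\<exists>T\<^sub>0\<in>complex. positive_combination T\<^sub>0 (p, p) \<and> T\<^sub>0 \<subseteq> diagonal \<and> card T\<^sub>0 = dim \<gamma> \<and>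
    pushforward N \<Delta>' e p \<gamma> = e (convex_cone hull T\<^sub>0)"
proof -
  have pr: "p \<in> rel_interior \<gamma>" and plow: "\<And>\<tau>. \<tau> \<in> \<Delta>' \<Longrightarrow> p \<in> fst ` \<tau> \<Longrightarrow> \<not> dim (fst ` \<tau>) < dim \<gamma>"
    using p by (auto simp: generic_point_def)
  have pg: "p \<in> \<gamma>" using pr rel_interior_subset by blast
  obtain T where T: "T \<in> complex" "positive_combination T (p, p)" using point_in_cone by blast
  have finT: "finite T" by (rule complex_finite[OF T(1)])
  have ppT: "(p, p) \<in> convex_cone hull T" by (rule positive_combination_in_cone[OF finT T(2)])
  have Tdiag: "T \<subseteq> diagonal"
  proof -
    obtain a where a: "\<forall>b\<in>T. a b > 0" "(p, p) = (\<Sum>b\<in>T. a b *\<^sub>R b)"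
      using T(2) by (auto simp: positive_combination_def)
    have "l i b = 0" if i: "i < DIM('a)" and b: "b \<in> T" for i b
    proof -
      have "l i (p, p) = 0" by (simp add: l_def)
      then have sum0: "(\<Sum>b\<in>T. a b * l i b) = 0"
        unfolding a(2) by (simp add: linear_sum[OF l_linear[OF i]] linear_scale[OF l_linear[OF i]])
      have "\<forall>b\<in>T. a b * l i b = 0"
        using l_sign[OF i T(1)]
      proof
        assume "\<forall>b\<in>T. l i b \<ge> 0"
        then show ?thesis
          using sum_nonneg_eq_0_iff[OF finT, of "\<lambda>b. a b * l i b"] sum0 a(1) by (simp add: less_imp_le)
      next
        assume "\<forall>b\<in>T. l i b \<le> 0"
        then show ?thesis
          using sum_nonneg_eq_0_iff[OF finT, of "\<lambda>b. - (a b * l i b)"] sum0 a(1)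
          by (simp add: sum_negf mult_nonneg_nonpos less_imp_le)
      qed
      then have "a b * l i b = 0" using b by blast
      moreover have "a b > 0" using a(1) b by blast
      ultimately show ?thesis by simp
    qed
    then show ?thesis unfolding K_0[symmetric] K_def by auto
  qed
  have conv: "convex_cone hull S \<subseteq> diagonal" if "S \<subseteq> diagonal" for S
    using convex_cone_hull_subset_span[of S] span_minimal[OF that subspace_diagonal] by blast
  have inj_fst: "inj_on fst diagonal" by (auto simp: inj_on_def diagonal_def)
  have dim_fst: "dim (fst ` (convex_cone hull S)) = card S" if S: "S \<in> complex" "S \<subseteq> diagonal" for S
  proof -
    have "inj_on fst (span (convex_cone hull S))"
      unfolding span_convex_cone_hull
      by (rule inj_on_subset[OF inj_fst span_minimal[OF S(2) subspace_diagonal]])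
    then show ?thesis using dim_image_eq[OF linear_fst] dim_cone[OF S(1)] by metis
  qed
  have T\<gamma>: "convex_cone hull T \<subseteq> \<gamma> \<times> \<gamma>"
    by (rule cone_subset_product[OF T]) (use pg \<gamma> in \<open>auto simp: product_fan_iff\<close>)
  have fstT: "fst ` (convex_cone hull T) \<subseteq> \<gamma>" using T\<gamma> by auto
  have pT: "p \<in> fst ` (convex_cone hull T)" using ppT by force
  have cardT: "card T = dim \<gamma>"
  proof (rule antisym)
    show "card T \<le> dim \<gamma>" using dim_subset[OF fstT] dim_fst[OF T(1) Tdiag] by simp
    show "dim \<gamma> \<le> card T" using plow[OF cone_in_fan[OF T(1)] pT] dim_fst[OF T(1) Tdiag] by simp
  qed
  have uniq: "S = T" if S: "S \<in> complex" "card S = dim \<gamma>" "S \<subseteq> diagonal" "p \<in> fst ` (convex_cone hull S)" for S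
  proof -
    have "(p, p) \<in> convex_cone hull S" using S(4) conv[OF S(3)] by (auto simp: diagonal_def)
    then have "T \<subseteq> S" by (rule subset_complexI[OF T(1) S(1) T(2)])
    then have "T = S" using cardT S(2) by (intro card_subset_eq[OF complex_finite[OF S(1)]]) simp_all
    then show ?thesis by simp
  qed
  have fstspan: "fst ` span T = span \<gamma>"
  proof (rule subspace_dim_equal)
    show "subspace (fst ` span T)" by (intro linear_subspace_image linear_fst subspace_span)
    show "fst ` span T \<subseteq> span \<gamma>"
    proof -
      have "fst ` span (convex_cone hull T) = span (fst ` (convex_cone hull T))"
        by (rule linear_span_image[OF linear_fst, symmetric])
      then show ?thesis using span_mono[OF fstT] by simp
    qed
    have "dim (fst ` span T) = dim (span T)"
      using inj_on_subset[OF inj_fst span_minimal[OF Tdiag subspace_diagonal]]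
      by (intro dim_image_eq[OF linear_fst]) (simp add: span_span)
    then show "dim (span \<gamma>) \<le> dim (fst ` span T)"
      using cardT complex_independent[OF T(1)] by (simp add: dim_eq_card_independent)
  qed simp
  have index: "lattice_index (sublattice N \<gamma>) (fst ` sublattice (N \<times> N) (convex_cone hull T)) = 1"
  proof -
    have "fst ` sublattice (N \<times> N) (convex_cone hull T) = sublattice N \<gamma>"
    proof (intro equalityI subsetI)
      fix x assume "x \<in> fst ` sublattice (N \<times> N) (convex_cone hull T)"
      then show "x \<in> sublattice N \<gamma>" using fstspan by (auto simp: sublattice_def)
    next
      fix x assume x: "x \<in> sublattice N \<gamma>"
      then have "x \<in> fst ` span T" unfolding fstspan by (simp add: sublattice_def)
      then obtain z where z: "z \<in> span T" "x = fst z" by blast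
      then have "z = (x, x)"
        using span_minimal[OF Tdiag subspace_diagonal] by (auto simp: diagonal_def prod_eq_iff)
      then have "z \<in> N \<times> N" using x by (simp add: sublattice_def)
      then have "z \<in> sublattice (N \<times> N) (convex_cone hull T)" using z(1) by (simp add: sublattice_def)
      then show "x \<in> fst ` sublattice (N \<times> N) (convex_cone hull T)" using z(2) by blast
    qed
    moreover have "add_subgroup (sublattice N \<gamma>)"
      unfolding sublattice_def by (intro add_subgroup_Int subgroup_N add_subgroup_subspace subspace_span)
    ultimately show ?thesis by (simp add: lattice_index_self)
  qed
  define D where "D = {\<sigma>. \<sigma> \<in> \<Delta>' \<and> dim \<sigma> = dim \<gamma> \<and> dim (fst ` \<sigma>) = dim \<gamma> \<and> fst ` \<sigma> \<subseteq> \<gamma> \<and> p \<in> fst ` \<sigma>}"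
  have finD: "finite D" using finite_fan' by (simp add: D_def)
  have TD: "convex_cone hull T \<in> D"
    using cone_in_fan[OF T(1)] dim_cone[OF T(1)] dim_fst[OF T(1) Tdiag] cardT fstT pT by (simp add: D_def)
  have "pushforward N \<Delta>' e p \<gamma> =
      (\<Sum>\<sigma>\<in>D. int (lattice_index (sublattice N \<gamma>) (fst ` sublattice (N \<times> N) \<sigma>)) * e \<sigma>)"
    by (simp add: pushforward_def D_def)
  also have "\<dots> = (\<Sum>\<sigma>\<in>{convex_cone hull T}. int (lattice_index (sublattice N \<gamma>) (fst ` sublattice (N \<times> N) \<sigma>)) * e \<sigma>)"
  proof (rule sum.mono_neutral_right[OF finD])
    show "{convex_cone hull T} \<subseteq> D" using TD by blast
    show "\<forall>\<sigma>\<in>D - {convex_cone hull T}. int (lattice_index (sublattice N \<gamma>) (fst ` sublattice (N \<times> N) \<sigma>)) * e \<sigma> = 0"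
    proof
      fix \<sigma> assume s: "\<sigma> \<in> D - {convex_cone hull T}"
      then obtain S where S: "S \<in> complex" "\<sigma> = convex_cone hull S" using cone_ex by (auto simp: D_def)
      have cS: "card S = dim \<gamma>" using s S dim_cone[OF S(1)] by (simp add: D_def)
      have "e \<sigma> = 0"
      proof (rule ccontr)
        assume "e \<sigma> \<noteq> 0"
        then have "S \<subseteq> diagonal" using supp[OF S(1) cS] S(2) by blast
        then have "S = T" using uniq[OF S(1) cS] s S(2) by (simp add: D_def)
        then show False using s S(2) by blast
      qed
      then show "int (lattice_index (sublattice N \<gamma>) (fst ` sublattice (N \<times> N) \<sigma>)) * e \<sigma> = 0" by simp
    qed
  qed
  also have "\<dots> = e (convex_cone hull T)" using index by simp
  finally show ?thesis using T Tdiag cardT by blast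
qed

lemma generic_point_near:
  assumes v: "generic_displacement \<Delta> v"
  obtains q where "\<And>i. i \<le> DIM('a) \<Longrightarrow> generic (q, 0) (K i)" "\<And>i. i < DIM('a) \<Longrightarrow> l i (q, 0) \<noteq> 0"
    "\<And>\<sigma> \<tau>. \<sigma> \<in> \<Delta> \<Longrightarrow> \<tau> \<in> \<Delta> \<Longrightarrow> \<sigma> \<inter> (q +o \<tau>) \<noteq> {} \<longleftrightarrow> \<sigma> \<inter> (v +o \<tau>) \<noteq> {}"
proof -
  obtain U where U: "open U" "v \<in> U"
    "\<And>q \<sigma> \<tau>. q \<in> U \<Longrightarrow> \<sigma> \<in> \<Delta> \<Longrightarrow> \<tau> \<in> \<Delta> \<Longrightarrow> \<sigma> \<inter> (q +o \<tau>) \<noteq> {} \<longleftrightarrow> \<sigma> \<inter> (v +o \<tau>) \<noteq> {}"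
    by (rule displacement_locally_constant[OF complete v]) blast
  have emb: "linear (\<lambda>q :: 'a. (q, 0 :: 'a))" by (simp add: linear_iff)
  define X where "X = (\<lambda>(S, i). {q :: 'a. (q, 0 :: 'a) \<in> span S + K i})"
  define \<B> where "\<B> = X ` {(S, i). S \<in> complex \<and> i \<le> DIM('a) \<and> span S + K i \<noteq> UNIV} \<union>
    (\<lambda>i. {q. l i (q, 0) = 0}) ` {..<DIM('a)}"
  have "{(S, i). S \<in> complex \<and> i \<le> DIM('a) \<and> span S + K i \<noteq> UNIV} \<subseteq> complex \<times> {..DIM('a)}" by auto
  then have "finite {(S, i). S \<in> complex \<and> i \<le> DIM('a) \<and> span S + K i \<noteq> UNIV}"
    using finite_complex finite_subset by blast
  then have fin: "finite \<B>" by (simp add: \<B>_def)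
  have sub: "subspace B \<and> B \<noteq> UNIV" if B: "B \<in> \<B>" for B
  proof -
    consider S i where "B = X (S, i)" "S \<in> complex" "i \<le> DIM('a)" "span S + K i \<noteq> UNIV"
      | i where "i < DIM('a)" "B = {q. l i (q, 0) = 0}"
      using B unfolding \<B>_def by blast
    then show ?thesis
    proof cases
      case 1
      have sK: "subspace (span S + K i)" by (intro subspace_plus subspace_span subspace_K)
      have "B = (\<lambda>q. (q, 0)) -` (span S + K i)" using 1(1) by (auto simp: X_def)
      then have sB: "subspace B" using linear_subspace_vimage[OF emb sK] by simp
      have "B \<noteq> UNIV"
      proof
        assume all: "B = UNIV"
        \<comment> \<open>z differs from (fst z - snd z, 0) by a point of the diagonal, which
          \<open>K i\<close> contains; so a condition holding for all (q, 0) holds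
          everywhere.\<close>
        have "z \<in> span S + K i" for z
        proof -
          have "(fst z - snd z, 0) \<in> span S + K i" using all 1(1) by (auto simp: X_def)
          moreover have "(snd z, snd z) \<in> span S + K i"
          proof -
            have "(snd z, snd z) \<in> K i" by (simp add: K_def l_def)
            then have "0 + (snd z, snd z) \<in> span S + K i" by (intro set_plus_intro span_zero)
            then show ?thesis by simp
          qed
          ultimately have "(fst z - snd z, 0) + (snd z, snd z) \<in> span S + K i" by (rule subspace_add[OF sK])
          then show ?thesis by simp
        qed
        then show False using 1(4) by blast
      qed
      then show ?thesis using sB by blast
    next
      case 2
      have lin: "linear (\<lambda>q. l i (q, 0))" using linear_compose[OF emb l_linear[OF 2(1)]] by (simp add: o_def)
      have "subspace B" unfolding 2(2) by (rule linear_subspace_kernel[OF lin])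
      moreover have "B \<noteq> UNIV"
      proof
        assume "B = UNIV"
        then have z: "l i (q, 0) = 0" for q unfolding 2(2) by blast
        obtain f where f: "f \<in> N \<times> N" "f \<in> K (Suc i)" "l i f = 1" using coordinate_vector[OF 2(1)] by blast
        have "l i (snd f - fst f, 0) = - l i f"
          using linear_0[OF u_linear[OF 2(1)]] by (simp add: l_def linear_diff[OF u_linear[OF 2(1)]])
        then show False using z f(3) by simp
      qed
      ultimately show ?thesis by blast
    qed
  qed
  obtain q where q: "q \<in> U" "\<And>B. B \<in> \<B> \<Longrightarrow> q \<notin> B"
    using finite_subspaces_avoid[OF U(1) _ fin sub] U(2) by blast
  show ?thesis
  proof (rule that)
    show "generic (q, 0) (K i)" if i: "i \<le> DIM('a)" for i
      unfolding generic_def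
    proof (intro ballI impI, rule ccontr)
      fix S assume S: "S \<in> complex" "(q, 0) \<in> span S + K i" "span S + K i \<noteq> UNIV"
      then have "X (S, i) \<in> \<B>" using i by (auto simp: \<B>_def)
      then show False using q(2) S(2) by (auto simp: X_def)
    qed
    show "l i (q, 0) \<noteq> 0" if i: "i < DIM('a)" for i
    proof
      assume "l i (q, 0) = 0"
      moreover have "{q. l i (q, 0) = 0} \<in> \<B>" using i by (auto simp: \<B>_def)
      ultimately show False using q(2) by blast
    qed
    show "\<sigma> \<inter> (q +o \<tau>) \<noteq> {} \<longleftrightarrow> \<sigma> \<inter> (v +o \<tau>) \<noteq> {}" if "\<sigma> \<in> \<Delta>" "\<tau> \<in> \<Delta>" for \<sigma> \<tau>
      by (rule U(3)[OF q(1) that])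
  qed
qed

lemma allermann_rau_eq_cup:
  assumes c1: "minkowski_weight N \<Delta> k\<^sub>1 c\<^sub>1" and c2: "minkowski_weight N \<Delta> k\<^sub>2 c\<^sub>2"
    and p: "\<And>\<gamma>. \<gamma> \<in> codim_cones \<Delta> (k\<^sub>1 + k\<^sub>2) \<Longrightarrow> generic_point \<Delta>' \<gamma> (p \<gamma>)"
    and v: "generic_displacement \<Delta> v"
  shows "allermann_rau_product N \<Delta> u \<Delta>' p k\<^sub>1 c\<^sub>1 k\<^sub>2 c\<^sub>2 \<gamma> = cup_product N \<Delta> v k\<^sub>1 c\<^sub>1 k\<^sub>2 c\<^sub>2 \<gamma>"
proof (cases "\<gamma> \<in> codim_cones \<Delta> (k\<^sub>1 + k\<^sub>2)")
  case True
  define d where "d = dim \<gamma>"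
  define k where "k = k\<^sub>1 + k\<^sub>2"
  define c where "c = refine_weight \<Delta>' (product_fan \<Delta> \<Delta>) (k\<^sub>1 + k\<^sub>2) (product_weight \<Delta> k\<^sub>1 c\<^sub>1 k\<^sub>2 c\<^sub>2)"
  define e where "e = kappa_iter (N \<times> N) \<Delta>' k c (chi u) DIM('a)"
  have \<gamma>: "\<gamma> \<in> \<Delta>" "d + k = DIM('a)" using True by (auto simp: codim_cones_def d_def k_def)
  have dk: "d + DIM('a) + k = DIM('a \<times> 'a)" using \<gamma>(2) by simp
  have bal: "balanced (d + DIM('a)) (\<lambda>S. real_of_int (c (convex_cone hull S)))"
    unfolding c_def by (rule balanced_refine_weight[OF c1 c2]) (use dk in \<open>simp add: k_def\<close>)
  have supp: "S \<subseteq> diagonal" if "S \<in> complex" "card S = dim \<gamma>" "e (convex_cone hull S) \<noteq> 0" for S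
    using iter_diagonal[OF dk bal that(1)] that(2,3) by (simp add: d_def e_def kappa_weight_def)
  obtain T where T: "T \<in> complex" "positive_combination T (p \<gamma>, p \<gamma>)" "T \<subseteq> diagonal" "card T = dim \<gamma>"
    and push: "pushforward N \<Delta>' e (p \<gamma>) \<gamma> = e (convex_cone hull T)"
    using pushforward_eq[OF \<gamma>(1) p[OF True], of e] supp by blast
  obtain q where q: "\<And>i. i \<le> DIM('a) \<Longrightarrow> generic (q, 0) (K i)" "\<And>i. i < DIM('a) \<Longrightarrow> l i (q, 0) \<noteq> 0"
    "\<And>\<sigma> \<tau>. \<sigma> \<in> \<Delta> \<Longrightarrow> \<tau> \<in> \<Delta> \<Longrightarrow> \<sigma> \<inter> (q +o \<tau>) \<noteq> {} \<longleftrightarrow> \<sigma> \<inter> (v +o \<tau>) \<noteq> {}"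
    by (rule generic_point_near[OF v]) blast
  have pr: "p \<gamma> \<in> rel_interior \<gamma>" using p[OF True] by (simp add: generic_point_def)
  have "real_of_int (e (convex_cone hull T)) =
      degree T diagonal (d + DIM('a)) (\<lambda>S. real_of_int (c (convex_cone hull S))) (q, 0)"
    using degree_iter[OF dk bal T(1) _ T(3) q(1,2)] T(4)
    by (simp add: e_def d_def kappa_weight_def kappa_weight_0)
  also have "\<dots> = (\<Sum>(\<sigma>\<^sub>1, \<sigma>\<^sub>2) \<in> codim_cones \<Delta> k\<^sub>1 \<times> codim_cones \<Delta> k\<^sub>2.
             real (displacement_mult N q \<gamma> \<sigma>\<^sub>1 \<sigma>\<^sub>2) * real_of_int (c\<^sub>1 \<sigma>\<^sub>1) * real_of_int (c\<^sub>2 \<sigma>\<^sub>2))"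
    unfolding c_def
    by (rule degree_diagonal_eq[OF \<gamma>(1) pr T(1-3)]) (use q(1)[of 0] dk T(4) in \<open>simp_all add: K_0 d_def k_def\<close>)
  also have "\<dots> = (\<Sum>(\<sigma>\<^sub>1, \<sigma>\<^sub>2) \<in> codim_cones \<Delta> k\<^sub>1 \<times> codim_cones \<Delta> k\<^sub>2.
             real (displacement_mult N v \<gamma> \<sigma>\<^sub>1 \<sigma>\<^sub>2) * real_of_int (c\<^sub>1 \<sigma>\<^sub>1) * real_of_int (c\<^sub>2 \<sigma>\<^sub>2))"
  proof (rule sum.cong[OF refl], clarify)
    fix a b assume "a \<in> codim_cones \<Delta> k\<^sub>1" "b \<in> codim_cones \<Delta> k\<^sub>2"
    then have "a \<in> \<Delta>" "b \<in> \<Delta>" by (auto simp: codim_cones_def)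
    then have "displacement_mult N q \<gamma> a b = displacement_mult N v \<gamma> a b"
      using q(3)[of a b] by (simp add: displacement_mult_def)
    then show "real (displacement_mult N q \<gamma> a b) * real_of_int (c\<^sub>1 a) * real_of_int (c\<^sub>2 b) =
        real (displacement_mult N v \<gamma> a b) * real_of_int (c\<^sub>1 a) * real_of_int (c\<^sub>2 b)" by simp
  qed
  also have "\<dots> = real_of_int (cup_product N \<Delta> v k\<^sub>1 c\<^sub>1 k\<^sub>2 c\<^sub>2 \<gamma>)"
    using True by (simp add: cup_product_def case_prod_beta)
  finally have "e (convex_cone hull T) = cup_product N \<Delta> v k\<^sub>1 c\<^sub>1 k\<^sub>2 c\<^sub>2 \<gamma>" by linarith
  then show ?thesis
    using True push by (simp add: allermann_rau_product_def e_def c_def k_def)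
qed (simp add: allermann_rau_product_def cup_product_def)

end

theorem theorem4p4:
  fixes N :: "'a::euclidean_space set" and \<Delta> :: "'a set set"
    and c\<^sub>1 c\<^sub>2 :: "'a set \<Rightarrow> int" and k\<^sub>1 k\<^sub>2 :: nat
    and u :: "nat \<Rightarrow> 'a \<Rightarrow> real" and \<Delta>' :: "('a \<times> 'a) set set"
    and p :: "'a set \<Rightarrow> 'a" and v :: 'a
  assumes "full_lattice N"
    and "complete_fan N \<Delta>"
    and "minkowski_weight N \<Delta> k\<^sub>1 c\<^sub>1"
    and "minkowski_weight N \<Delta> k\<^sub>2 c\<^sub>2"
    and "dual_lattice_basis N u"
    and "unimodular_fan (N \<times> N) \<Delta>'"
    and "fan_refines \<Delta>' (product_fan \<Delta> \<Delta>)"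
    and "\<And>i. i < DIM('a) \<Longrightarrow> linear_on_cones \<Delta>' (chi u i)"
    and "\<And>\<gamma>. \<gamma> \<in> codim_cones \<Delta> (k\<^sub>1 + k\<^sub>2) \<Longrightarrow> generic_point \<Delta>' \<gamma> (p \<gamma>)"
    and "v \<in> N"
    and "generic_displacement \<Delta> v"
  shows "allermann_rau_product N \<Delta> u \<Delta>' p k\<^sub>1 c\<^sub>1 k\<^sub>2 c\<^sub>2 = cup_product N \<Delta> v k\<^sub>1 c\<^sub>1 k\<^sub>2 c\<^sub>2"
proof
  fix \<gamma>
  interpret refined_square_coordinates N \<Delta> \<Delta>' u
    using assms by unfold_locales
  show "allermann_rau_product N \<Delta> u \<Delta>' p k\<^sub>1 c\<^sub>1 k\<^sub>2 c\<^sub>2 \<gamma> = cup_product N \<Delta> v k\<^sub>1 c\<^sub>1 k\<^sub>2 c\<^sub>2 \<gamma>"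
    by (rule allermann_rau_eq_cup[OF assms(3,4,9,11)])
qed

end
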